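(* Over $\mathsf{RCA}_0$, $\mathsf{AHT}_2$ implies $\mathsf{IPT}^2_2$; that is, $\mathsf{RCA}_0 \vdash \mathsf{AHT}_2 \rightarrow \mathsf{IPT}^2_2$.
   Context: $\mathsf{RCA}_0$ is the usual base system of reverse mathematics in second-order arithmetic; $\mathbf{N}$ denotes its first-order universe, and all principles below are statements in the language of second-order arithmetic. A map into $k$ means a map into $\{0,\dots,k-1\}$. $[\mathbf{N}]^2$ is the set of pairs $(x,y)$ of elements of $\mathbf{N}$ with $x<y$. For a positive integer $n=2^{t_1}+\dots+2^{t_p}$ with $t_1<\dots<t_p$, put $\lambda(n)=t_1$ and $\mu(n)=t_p$. A set $X$ of positive integers satisfies the Apartness Condition if for all $x,x'\in X$ with $x<x'$ we have $\mu(x)<\lambda(x')$. For an infinite set $H=\{h_1<h_2<h_3<\dots\}$, $AS(H)$ denotes the set of all finite sums of distinct adjacent elements of $H$, i.e. all sums $h_i+h_{i+1}+\dots+h_j$ with $i\le j$ (including single elements, $i=j$). $\mathsf{AHT}_k$ (Adjacent Hindman's Theorem for $k$ colors): for every $c:\mathbf{N}\to k$ there exists an infinite set $H$ of positive integers satisfying the Apartness Condition such that all elements of $AS(H)$ have the same $c$-color. $\mathsf{IPT}^2_k$ (Increasing Polarized Ramsey's Theorem for pairs and $k$ colors): for every $f:[\mathbf{N}]^2\to k$ there exist infinite sets $H_1,H_2\subseteq\mathbf{N}$ and a color $c<k$ such that $f(x_1,x_2)=c$ for all $(x_1,x_2)\in H_1\times H_2$ with $x_1<x_2$. *)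

theory Defs
  imports Main
begin

section \<open>The language of second-order arithmetic\<close>

text \<open>
  Variables are de Bruijn indices, in two independent name spaces: a number quantifier does not
  shift set variables and a set quantifier does not shift number variables.
  Equality between sets is not primitive; as usual it would be defined by extensionality.
\<close>

datatype trm =
    Var nat ("\<sharp>_" [1000] 1000)
  | Zero ("\<^bold>0")
  | One ("\<^bold>1")
  | Add trm trm (infixl "\<^bold>+" 75)
  | Mul trm trm (infixl "\<^bold>*" 80)

datatype fm =
    Fls ("\<^bold>\<bottom>")
  | Eql trm trm (infix "\<^bold>=" 65)
  | Less trm trm (infix "\<^bold><" 65)
  | Mem trm nat (infix "\<^bold>\<in>" 65)
  | Imp fm fm (infixr "\<^bold>\<longrightarrow>" 55)
  | All fm ("\<^bold>\<forall>_" [70] 70)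
  | AllS fm ("\<^bold>\<forall>\<^sub>S_" [70] 70)

abbreviation Neg :: "fm \<Rightarrow> fm" ("\<^bold>\<not>_" [70] 70) where
  "\<^bold>\<not>p \<equiv> p \<^bold>\<longrightarrow> \<^bold>\<bottom>"
abbreviation Con :: "fm \<Rightarrow> fm \<Rightarrow> fm" (infixr "\<^bold>\<and>" 60) where
  "p \<^bold>\<and> q \<equiv> \<^bold>\<not>(p \<^bold>\<longrightarrow> \<^bold>\<not>q)"
abbreviation Dis :: "fm \<Rightarrow> fm \<Rightarrow> fm" (infixr "\<^bold>\<or>" 58) where
  "p \<^bold>\<or> q \<equiv> \<^bold>\<not>p \<^bold>\<longrightarrow> q"
abbreviation Iff :: "fm \<Rightarrow> fm \<Rightarrow> fm" (infix "\<^bold>\<longleftrightarrow>" 54) where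
  "p \<^bold>\<longleftrightarrow> q \<equiv> (p \<^bold>\<longrightarrow> q) \<^bold>\<and> (q \<^bold>\<longrightarrow> p)"
abbreviation Ex :: "fm \<Rightarrow> fm" ("\<^bold>\<exists>_" [70] 70) where
  "\<^bold>\<exists>p \<equiv> \<^bold>\<not>(\<^bold>\<forall>(\<^bold>\<not>p))"
abbreviation ExS :: "fm \<Rightarrow> fm" ("\<^bold>\<exists>\<^sub>S_" [70] 70) where
  "\<^bold>\<exists>\<^sub>Sp \<equiv> \<^bold>\<not>(\<^bold>\<forall>\<^sub>S(\<^bold>\<not>p))"
abbreviation Tru :: fm ("\<^bold>\<top>") where
  "\<^bold>\<top> \<equiv> \<^bold>\<not>\<^bold>\<bottom>"

text \<open>Simultaneous substitution of terms for number variables and of variables for set variables.\<close>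

primrec subt :: "(nat \<Rightarrow> trm) \<Rightarrow> trm \<Rightarrow> trm" where
  "subt s (\<sharp>n) = s n"
| "subt s \<^bold>0 = \<^bold>0"
| "subt s \<^bold>1 = \<^bold>1"
| "subt s (t \<^bold>+ u) = subt s t \<^bold>+ subt s u"
| "subt s (t \<^bold>* u) = subt s t \<^bold>* subt s u"

definition lift :: "trm \<Rightarrow> trm" where
  "lift = subt (\<lambda>n. \<sharp>(Suc n))"

primrec subn :: "(nat \<Rightarrow> trm) \<Rightarrow> fm \<Rightarrow> fm" where
  "subn s \<^bold>\<bottom> = \<^bold>\<bottom>"
| "subn s (t \<^bold>= u) = (subt s t \<^bold>= subt s u)"
| "subn s (t \<^bold>< u) = (subt s t \<^bold>< subt s u)"
| "subn s (t \<^bold>\<in> X) = (subt s t \<^bold>\<in> X)"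
| "subn s (p \<^bold>\<longrightarrow> q) = (subn s p \<^bold>\<longrightarrow> subn s q)"
| "subn s (\<^bold>\<forall>p) = \<^bold>\<forall>(subn (case_nat (\<sharp>0) (\<lambda>n. lift (s n))) p)"
| "subn s (\<^bold>\<forall>\<^sub>Sp) = \<^bold>\<forall>\<^sub>S(subn s p)"

primrec subs :: "(nat \<Rightarrow> nat) \<Rightarrow> fm \<Rightarrow> fm" where
  "subs r \<^bold>\<bottom> = \<^bold>\<bottom>"
| "subs r (t \<^bold>= u) = (t \<^bold>= u)"
| "subs r (t \<^bold>< u) = (t \<^bold>< u)"
| "subs r (t \<^bold>\<in> X) = (t \<^bold>\<in> r X)"
| "subs r (p \<^bold>\<longrightarrow> q) = (subs r p \<^bold>\<longrightarrow> subs r q)"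
| "subs r (\<^bold>\<forall>p) = \<^bold>\<forall>(subs r p)"
| "subs r (\<^bold>\<forall>\<^sub>Sp) = \<^bold>\<forall>\<^sub>S(subs (case_nat 0 (\<lambda>n. Suc (r n))) p)"

abbreviation inst :: "trm \<Rightarrow> fm \<Rightarrow> fm" where
  "inst t \<equiv> subn (case_nat t Var)"
abbreviation instS :: "nat \<Rightarrow> fm \<Rightarrow> fm" where
  "instS X \<equiv> subs (case_nat X id)"
abbreviation liftn :: "fm \<Rightarrow> fm" where
  "liftn \<equiv> subn (\<lambda>n. \<sharp>(Suc n))"
abbreviation lifts :: "fm \<Rightarrow> fm" where
  "lifts \<equiv> subs Suc"

section \<open>Provability\<close>

text \<open>
  Classical two-sorted natural deduction with equality. The formulas of the theory T stand for
  their universal closures: unlike the hypotheses in the list, they are not subject to the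
  eigenvariable conditions of AllI and AllSI.
\<close>

inductive derivable :: "fm set \<Rightarrow> fm list \<Rightarrow> fm \<Rightarrow> bool" ("_; _ \<turnstile> _" [50, 50, 50] 50)
  for T :: "fm set" where
  Ax:    "p \<in> T \<Longrightarrow> T; G \<turnstile> p"
| Hyp:   "p \<in> set G \<Longrightarrow> T; G \<turnstile> p"
| ImpI:  "T; p # G \<turnstile> q \<Longrightarrow> T; G \<turnstile> (p \<^bold>\<longrightarrow> q)"
| ImpE:  "T; G \<turnstile> (p \<^bold>\<longrightarrow> q) \<Longrightarrow> T; G \<turnstile> p \<Longrightarrow> T; G \<turnstile> q"
| Class: "T; \<^bold>\<not>p # G \<turnstile> \<^bold>\<bottom> \<Longrightarrow> T; G \<turnstile> p"
| AllI:  "T; map liftn G \<turnstile> p \<Longrightarrow> T; G \<turnstile> \<^bold>\<forall>p"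
| AllE:  "T; G \<turnstile> \<^bold>\<forall>p \<Longrightarrow> T; G \<turnstile> inst t p"
| AllSI: "T; map lifts G \<turnstile> p \<Longrightarrow> T; G \<turnstile> \<^bold>\<forall>\<^sub>Sp"
| AllSE: "T; G \<turnstile> \<^bold>\<forall>\<^sub>Sp \<Longrightarrow> T; G \<turnstile> instS X p"
| Refl:  "T; G \<turnstile> (t \<^bold>= t)"
| Subst: "T; G \<turnstile> (t \<^bold>= u) \<Longrightarrow> T; G \<turnstile> inst t p \<Longrightarrow> T; G \<turnstile> inst u p"

definition provable :: "fm set \<Rightarrow> fm \<Rightarrow> bool" (infix "\<tturnstile>" 50) where
  "T \<tturnstile> p \<longleftrightarrow> (T; [] \<turnstile> p)"

section \<open>The system RCA_0\<close>

text \<open>In a bounded quantifier the bound must not contain the quantified variable, hence lift.\<close>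

inductive bounded_fm :: "fm \<Rightarrow> bool" where
  "bounded_fm \<^bold>\<bottom>"
| "bounded_fm (t \<^bold>= u)"
| "bounded_fm (t \<^bold>< u)"
| "bounded_fm (t \<^bold>\<in> X)"
| "bounded_fm p \<Longrightarrow> bounded_fm q \<Longrightarrow> bounded_fm (p \<^bold>\<longrightarrow> q)"
| "bounded_fm p \<Longrightarrow> bounded_fm (\<^bold>\<forall>(\<sharp>0 \<^bold>< lift t \<^bold>\<longrightarrow> p))"
| "bounded_fm p \<Longrightarrow> bounded_fm (\<^bold>\<exists>(\<sharp>0 \<^bold>< lift t \<^bold>\<and> p))"

definition Sigma01 :: "fm set" where
  "Sigma01 = {\<^bold>\<exists>p | p. bounded_fm p}"
definition Pi01 :: "fm set" where
  "Pi01 = {\<^bold>\<forall>p | p. bounded_fm p}"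

definition basic_axioms :: "fm set" where
  "basic_axioms = {
     \<^bold>\<not>(\<sharp>0 \<^bold>+ \<^bold>1 \<^bold>= \<^bold>0),
     \<sharp>1 \<^bold>+ \<^bold>1 \<^bold>= \<sharp>0 \<^bold>+ \<^bold>1 \<^bold>\<longrightarrow> \<sharp>1 \<^bold>= \<sharp>0,
     \<sharp>0 \<^bold>+ \<^bold>0 \<^bold>= \<sharp>0,
     \<sharp>1 \<^bold>+ (\<sharp>0 \<^bold>+ \<^bold>1) \<^bold>= (\<sharp>1 \<^bold>+ \<sharp>0) \<^bold>+ \<^bold>1,
     \<sharp>0 \<^bold>* \<^bold>0 \<^bold>= \<^bold>0,
     \<sharp>1 \<^bold>* (\<sharp>0 \<^bold>+ \<^bold>1) \<^bold>= (\<sharp>1 \<^bold>* \<sharp>0) \<^bold>+ \<sharp>1,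
     \<^bold>\<not>(\<sharp>0 \<^bold>< \<^bold>0),
     \<sharp>1 \<^bold>< \<sharp>0 \<^bold>+ \<^bold>1 \<^bold>\<longleftrightarrow> (\<sharp>1 \<^bold>< \<sharp>0 \<^bold>\<or> \<sharp>1 \<^bold>= \<sharp>0)}"

definition induction_axiom :: "fm \<Rightarrow> fm" where
  "induction_axiom p =
     (inst \<^bold>0 p \<^bold>\<and> \<^bold>\<forall>(p \<^bold>\<longrightarrow> subn (case_nat (\<sharp>0 \<^bold>+ \<^bold>1) (\<lambda>n. \<sharp>(Suc n))) p) \<^bold>\<longrightarrow> \<^bold>\<forall>p)"

definition comprehension_axiom :: "fm \<Rightarrow> fm \<Rightarrow> fm" where
  "comprehension_axiom p q =
     (\<^bold>\<forall>(p \<^bold>\<longleftrightarrow> q) \<^bold>\<longrightarrow> \<^bold>\<exists>\<^sub>S\<^bold>\<forall>(\<sharp>0 \<^bold>\<in> 0 \<^bold>\<longleftrightarrow> lifts p))"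

definition RCA0 :: "fm set" where
  "RCA0 = basic_axioms
     \<union> {induction_axiom p | p. p \<in> Sigma01}
     \<union> {comprehension_axiom p q | p q. p \<in> Sigma01 \<and> q \<in> Pi01}"

section \<open>Maps, sums and binary expansions inside second-order arithmetic\<close>

text \<open>
  Arguments that are terms or set variables live in the surrounding context, so they are lifted
  whenever they are used under a quantifier. Conditions on numbers are functions from terms to
  formulas.
\<close>

primrec nm :: "nat \<Rightarrow> trm" where
  "nm 0 = \<^bold>0"
| "nm (Suc k) = nm k \<^bold>+ \<^bold>1"

text \<open>The usual pairing function of reverse mathematics, (i,j) = (i+j)^2 + i.\<close>

definition pair :: "trm \<Rightarrow> trm \<Rightarrow> trm" where
  "pair t u = (t \<^bold>+ u) \<^bold>* (t \<^bold>+ u) \<^bold>+ t"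

text \<open>A map is a set of pairs; val F t u says F(t) = u.\<close>

definition val :: "nat \<Rightarrow> trm \<Rightarrow> trm \<Rightarrow> fm" where
  "val F t u = (pair t u \<^bold>\<in> F)"

definition maps :: "nat \<Rightarrow> (trm \<Rightarrow> fm) \<Rightarrow> (trm \<Rightarrow> fm) \<Rightarrow> fm" where
  "maps F D C =
     (\<^bold>\<forall>(\<sharp>0 \<^bold>\<in> F \<^bold>\<longrightarrow> \<^bold>\<exists>\<^bold>\<exists>(D (\<sharp>1) \<^bold>\<and> C (\<sharp>0) \<^bold>\<and> \<sharp>2 \<^bold>= pair (\<sharp>1) (\<sharp>0))) \<^bold>\<and>
      \<^bold>\<forall>(D (\<sharp>0) \<^bold>\<longrightarrow> \<^bold>\<exists>(val F (\<sharp>1) (\<sharp>0) \<^bold>\<and> \<^bold>\<forall>(val F (\<sharp>2) (\<sharp>0) \<^bold>\<longrightarrow> \<sharp>0 \<^bold>= \<sharp>1))))"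

definition in_N :: "trm \<Rightarrow> fm" where
  "in_N t = \<^bold>\<top>"
definition in_below :: "nat \<Rightarrow> trm \<Rightarrow> fm" where
  "in_below k t = (t \<^bold>< nm k)"
definition in_pairs :: "trm \<Rightarrow> fm" where
  "in_pairs t = \<^bold>\<exists>\<^bold>\<exists>(\<sharp>1 \<^bold>< \<sharp>0 \<^bold>\<and> lift (lift t) \<^bold>= pair (\<sharp>1) (\<sharp>0))"

definition infinite_set :: "nat \<Rightarrow> fm" where
  "infinite_set X = \<^bold>\<forall>\<^bold>\<exists>(\<sharp>1 \<^bold>< \<sharp>0 \<^bold>\<and> \<sharp>0 \<^bold>\<in> X)"
definition positive_set :: "nat \<Rightarrow> fm" where
  "positive_set X = \<^bold>\<forall>(\<sharp>0 \<^bold>\<in> X \<^bold>\<longrightarrow> \<^bold>0 \<^bold>< \<sharp>0)"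

text \<open>n = F(0) + ... + F(q), witnessed by the map S of partial sums.\<close>

definition sum_eq :: "nat \<Rightarrow> trm \<Rightarrow> trm \<Rightarrow> fm" where
  "sum_eq F q n = \<^bold>\<exists>\<^sub>S(
     maps 0 in_N in_N \<^bold>\<and>
     \<^bold>\<forall>(val (Suc F) \<^bold>0 (\<sharp>0) \<^bold>\<longrightarrow> val 0 \<^bold>0 (\<sharp>0)) \<^bold>\<and>
     \<^bold>\<forall>\<^bold>\<forall>\<^bold>\<forall>(val 0 (\<sharp>2) (\<sharp>1) \<^bold>\<and> val (Suc F) (\<sharp>2 \<^bold>+ \<^bold>1) (\<sharp>0)
        \<^bold>\<longrightarrow> val 0 (\<sharp>2 \<^bold>+ \<^bold>1) (\<sharp>1 \<^bold>+ \<sharp>0)) \<^bold>\<and>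
     val 0 q n)"

text \<open>E is the map x to 2^x, by its recursion equations.\<close>

definition exp2 :: "nat \<Rightarrow> fm" where
  "exp2 E =
     (maps E in_N in_N \<^bold>\<and> val E \<^bold>0 \<^bold>1 \<^bold>\<and>
      \<^bold>\<forall>\<^bold>\<forall>(val E (\<sharp>1) (\<sharp>0) \<^bold>\<longrightarrow> val E (\<sharp>1 \<^bold>+ \<^bold>1) (nm 2 \<^bold>* \<sharp>0)))"

text \<open>
  n = 2^{T(0)} + ... + 2^{T(q)} for some q and some T with T(0) < ... < T(q), where l = T(0) and
  m = T(q). The three set variables 2, 1, 0 are T, the map taking x to 2^x, and their composition.
\<close>

definition expansion :: "trm \<Rightarrow> trm \<Rightarrow> trm \<Rightarrow> fm" where
  "expansion n l m = \<^bold>\<exists>\<^sub>S\<^bold>\<exists>\<^sub>S\<^bold>\<exists>\<^sub>S\<^bold>\<exists>(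
     maps 2 in_N in_N \<^bold>\<and>
     \<^bold>\<forall>\<^bold>\<forall>\<^bold>\<forall>(\<sharp>2 \<^bold>< \<sharp>3 \<^bold>\<and> val 2 (\<sharp>2) (\<sharp>1) \<^bold>\<and> val 2 (\<sharp>2 \<^bold>+ \<^bold>1) (\<sharp>0) \<^bold>\<longrightarrow> \<sharp>1 \<^bold>< \<sharp>0) \<^bold>\<and>
     exp2 1 \<^bold>\<and>
     maps 0 in_N in_N \<^bold>\<and>
     \<^bold>\<forall>\<^bold>\<forall>\<^bold>\<forall>(val 2 (\<sharp>2) (\<sharp>1) \<^bold>\<and> val 1 (\<sharp>1) (\<sharp>0) \<^bold>\<longrightarrow> val 0 (\<sharp>2) (\<sharp>0)) \<^bold>\<and>
     sum_eq 0 (\<sharp>0) (lift n) \<^bold>\<and>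
     val 2 \<^bold>0 (lift l) \<^bold>\<and>
     val 2 (\<sharp>0) (lift m))"

definition lambda_eq :: "trm \<Rightarrow> trm \<Rightarrow> fm" where
  "lambda_eq n l = \<^bold>\<exists>(expansion (lift n) (lift l) (\<sharp>0))"
definition mu_eq :: "trm \<Rightarrow> trm \<Rightarrow> fm" where
  "mu_eq n m = \<^bold>\<exists>(expansion (lift n) (\<sharp>0) (lift m))"

definition apart :: "nat \<Rightarrow> fm" where
  "apart X = \<^bold>\<forall>\<^bold>\<forall>(\<sharp>1 \<^bold>\<in> X \<^bold>\<and> \<sharp>0 \<^bold>\<in> X \<^bold>\<and> \<sharp>1 \<^bold>< \<sharp>0
     \<^bold>\<longrightarrow> \<^bold>\<exists>\<^bold>\<exists>(mu_eq (\<sharp>3) (\<sharp>1) \<^bold>\<and> lambda_eq (\<sharp>2) (\<sharp>0) \<^bold>\<and> \<sharp>1 \<^bold>< \<sharp>0))"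

text \<open>E is the strictly increasing enumeration of H.\<close>

definition enumerates :: "nat \<Rightarrow> nat \<Rightarrow> fm" where
  "enumerates E H =
     (maps E in_N in_N \<^bold>\<and>
      \<^bold>\<forall>\<^bold>\<forall>\<^bold>\<forall>(val E (\<sharp>2) (\<sharp>1) \<^bold>\<and> val E (\<sharp>2 \<^bold>+ \<^bold>1) (\<sharp>0) \<^bold>\<longrightarrow> \<sharp>1 \<^bold>< \<sharp>0) \<^bold>\<and>
      \<^bold>\<forall>(\<sharp>0 \<^bold>\<in> H \<^bold>\<longleftrightarrow> \<^bold>\<exists>(val E (\<sharp>0) (\<sharp>1))))"

text \<open>
  x is in AS(H): x = E(i) + E(i+1) + ... + E(i+d) for some i and d, with E the enumeration of H.
  The set variables 1 and 0 are E and the shifted sequence taking k to E(i+k); i and d are the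
  number variables 1 and 0.
\<close>

definition in_AS :: "nat \<Rightarrow> trm \<Rightarrow> fm" where
  "in_AS H x = \<^bold>\<exists>\<^sub>S\<^bold>\<exists>\<^sub>S\<^bold>\<exists>\<^bold>\<exists>(
     enumerates 1 (Suc (Suc H)) \<^bold>\<and>
     maps 0 in_N in_N \<^bold>\<and>
     \<^bold>\<forall>\<^bold>\<forall>(val 1 (\<sharp>3 \<^bold>+ \<sharp>1) (\<sharp>0) \<^bold>\<longrightarrow> val 0 (\<sharp>1) (\<sharp>0)) \<^bold>\<and>
     sum_eq 0 (\<sharp>0) (lift (lift x)))"

section \<open>The two principles\<close>

text \<open>Set variables: 1 is the colouring, 0 is the solution H.\<close>

definition AHT :: "nat \<Rightarrow> fm" where
  "AHT k = \<^bold>\<forall>\<^sub>S(maps 0 in_N (in_below k) \<^bold>\<longrightarrow>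
     \<^bold>\<exists>\<^sub>S(infinite_set 0 \<^bold>\<and> positive_set 0 \<^bold>\<and> apart 0 \<^bold>\<and>
        \<^bold>\<exists>\<^bold>\<forall>(in_AS 0 (\<sharp>0) \<^bold>\<longrightarrow> val 1 (\<sharp>0) (\<sharp>1))))"

text \<open>Set variables: 2 is the colouring, 1 and 0 are the solutions H_1 and H_2.\<close>

definition IPT2 :: "nat \<Rightarrow> fm" where
  "IPT2 k = \<^bold>\<forall>\<^sub>S(maps 0 in_pairs (in_below k) \<^bold>\<longrightarrow>
     \<^bold>\<exists>\<^sub>S\<^bold>\<exists>\<^sub>S(infinite_set 1 \<^bold>\<and> infinite_set 0 \<^bold>\<and>
        \<^bold>\<exists>(in_below k (\<sharp>0) \<^bold>\<and>
          \<^bold>\<forall>\<^bold>\<forall>(\<sharp>1 \<^bold>\<in> 1 \<^bold>\<and> \<sharp>0 \<^bold>\<in> 0 \<^bold>\<and> \<sharp>1 \<^bold>< \<sharp>0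
            \<^bold>\<longrightarrow> val 2 (pair (\<sharp>1) (\<sharp>0)) (\<sharp>2)))))"

end

theory Submission
  imports Defs "HOL-Library.Countable_Set"
begin

text \<open>
  By a Henkin completeness theorem for the calculus it suffices to argue in an arbitrary countable
  model of RCA_0. There the colouring is c(n) = f(\<open>\<lambda>\<close>(n), \<open>\<mu>\<close>(n)). If H is an apart solution of
  AHT_2 for c and h, h' are elements of H with \<open>h \<le> h'\<close>, then the adjacent sum from h to h' has the
  same \<open>\<lambda>\<close> as h and the same \<open>\<mu>\<close> as h', so f(\<open>\<lambda>\<close>(h), \<open>\<mu>\<close>(h')) is the colour of AS(H); and
  \<open>\<mu>(h') < \<lambda>(h)\<close> if \<open>h' < h\<close>. Hence \<open>H\<^sub>1 = \<lambda>(H)\<close> and \<open>H\<^sub>2 = \<mu>(H)\<close> solve IPT^2_2.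
  To use AS(H) inside the model one has to prove that H has an enumeration and that partial sums
  exist, i.e. primitive recursion. Coding finite sets by binary expansions reduces it to the existence
  of the function \<open>2\<^sup>x\<close>, and that comes for free: a solution of AHT_2 for a constant colouring is
  apart, and the formula defining \<open>\<mu>\<close> asserts that the exponential function exists.
\<close>

section \<open>Completeness\<close>

text \<open>This explains the closure properties of definable predicates and functions, and why even
  the claim about \<open>\<lambda>\<close> and \<open>\<mu>\<close> of an adjacent sum is an
  induction inside the model, over possibly nonstandard lengths. Recursion is proved only for steps
  that never decrease their argument. The one way of enlarging a coded finite set is to insert a
  position above all earlier ones, so the pair describing the next stage of a computation must have
  a larger code than the current pair. Both recursions in use, the next element of H and the next
  partial sum, are of this kind. The colouring is \<Delta>_1 with the exponential function as a
  parameter; AHT_2 is therefore applied a second time, after the constant colouring has supplied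
  that function. If \<open>\<lambda>(n) = \<mu>(n)\<close>, there is no pair to ask f about; the
  colour of such n is immaterial, because f is only read off from sums with
  \<open>\<lambda> < \<mu>\<close>.\<close>

abbreviation up :: "(nat \<Rightarrow> trm) \<Rightarrow> nat \<Rightarrow> trm" where
  "up s \<equiv> case_nat (Var 0) (\<lambda>n. lift (s n))"
abbreviation upS :: "(nat \<Rightarrow> nat) \<Rightarrow> nat \<Rightarrow> nat" where
  "upS r \<equiv> case_nat 0 (\<lambda>n. Suc (r n))"

section \<open>Composition laws of substitution\<close>

lemma subt_subt: "subt s (subt r t) = subt (\<lambda>n. subt s (r n)) t"
  by (induct t) auto

lemma subt_Var [simp]: "subt Var t = t"
  by (induct t) auto

lemma up_up: "(\<lambda>n. subt (up s) (up r n)) = up (\<lambda>n. subt s (r n))"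
  by (auto simp: fun_eq_iff lift_def subt_subt split: nat.split)

lemma up_Var [simp]: "up Var = Var"
  by (auto simp: fun_eq_iff lift_def split: nat.split)

lemma subn_subn: "subn s (subn r p) = subn (\<lambda>n. subt s (r n)) p"
  by (induct p arbitrary: s r) (simp_all add: subt_subt up_up)

lemma subn_Var [simp]: "subn Var p = p"
  by (induct p) auto

lemma upS_upS: "(\<lambda>n. upS s (upS r n)) = upS (\<lambda>n. s (r n))"
  by (auto simp: fun_eq_iff split: nat.split)

lemma upS_id [simp]: "upS (\<lambda>n. n) = (\<lambda>n. n)"
  by (auto simp: fun_eq_iff split: nat.split)

lemma subs_subs: "subs s (subs r p) = subs (\<lambda>n. s (r n)) p"
  by (induct p arbitrary: s r) (simp_all add: upS_upS)

lemma subs_id [simp]: "subs (\<lambda>n. n) p = p"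
  by (induct p) auto

lemma subn_subs: "subn s (subs r p) = subs r (subn s p)"
  by (induct p arbitrary: s r) auto

lemma subn_inst: "subn s (inst t p) = inst (subt s t) (subn (up s) p)"
  unfolding subn_subn
  by (rule arg_cong[where f = "\<lambda>x. subn x p"])
     (auto simp: fun_eq_iff lift_def subt_subt split: nat.split)

lemma subn_liftn: "subn (up s) (liftn p) = liftn (subn s p)"
  unfolding subn_subn by (simp add: lift_def)

lemma subs_instS: "subs r (instS X p) = instS (r X) (subs (upS r) p)"
  unfolding subs_subs
  by (rule arg_cong[where f = "\<lambda>x. subs x p"])
     (auto simp: fun_eq_iff split: nat.split)

lemma subs_lifts: "subs (upS r) (lifts p) = lifts (subs r p)"
  unfolding subs_subs by simp

section \<open>Bounds on free variables\<close>

lemma subt_cong: "\<exists>n. \<forall>s r. (\<forall>i<n. s i = r i) \<longrightarrow> subt s t = subt r t"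
proof (induct t)
  case (Var x)
  then show ?case by (intro exI[of _ "Suc x"]) auto
next
  case (Add t u)
  then obtain m n where "\<forall>s r. (\<forall>i<m. s i = r i) \<longrightarrow> subt s t = subt r t"
    "\<forall>s r. (\<forall>i<n. s i = r i) \<longrightarrow> subt s u = subt r u" by blast
  then show ?case by (intro exI[of _ "max m n"]) (auto simp: less_max_iff_disj)
next
  case (Mul t u)
  then obtain m n where "\<forall>s r. (\<forall>i<m. s i = r i) \<longrightarrow> subt s t = subt r t"
    "\<forall>s r. (\<forall>i<n. s i = r i) \<longrightarrow> subt s u = subt r u" by blast
  then show ?case by (intro exI[of _ "max m n"]) (auto simp: less_max_iff_disj)
qed auto

text \<open>All free number variables lie below \<open>n\<close>, phrased through substitutions
  instead of a free-variable function. The bound may be generous, so a quantifier can simply keep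
  it.\<close>

definition suppn :: "nat \<Rightarrow> fm \<Rightarrow> bool" where
  "suppn n p \<longleftrightarrow> (\<forall>s r. (\<forall>i<n. s i = r i) \<longrightarrow> subn s p = subn r p)"
definition supps :: "nat \<Rightarrow> fm \<Rightarrow> bool" where
  "supps n p \<longleftrightarrow> (\<forall>s r. (\<forall>i<n. s i = r i) \<longrightarrow> subs s p = subs r p)"

lemma suppn_mono: "suppn m p \<Longrightarrow> m \<le> n \<Longrightarrow> suppn n p"
  unfolding suppn_def by (meson order_less_le_trans)

lemma supps_mono: "supps m p \<Longrightarrow> m \<le> n \<Longrightarrow> supps n p"
  unfolding supps_def by (meson order_less_le_trans)

lemma suppn_Imp: "suppn m p \<Longrightarrow> suppn n q \<Longrightarrow> suppn (max m n) (Imp p q)"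
  unfolding suppn_def by (simp add: less_max_iff_disj)

lemma supps_Imp: "supps m p \<Longrightarrow> supps n q \<Longrightarrow> supps (max m n) (Imp p q)"
  unfolding supps_def by (simp add: less_max_iff_disj)

lemma suppn_All: "suppn n p \<Longrightarrow> suppn n (All p)"
  unfolding suppn_def
proof (intro allI impI)
  fix s r :: "nat \<Rightarrow> trm"
  assume p: "\<forall>s r. (\<forall>i<n. s i = r i) \<longrightarrow> subn s p = subn r p" and "\<forall>i<n. s i = r i"
  then have "\<forall>i<n. up s i = up r i" by (auto split: nat.split)
  with p have "subn (up s) p = subn (up r) p" by blast
  then show "subn s (All p) = subn r (All p)" by simp
qed

lemma supps_AllS: "supps n p \<Longrightarrow> supps n (AllS p)"
  unfolding supps_def
proof (intro allI impI)
  fix s r :: "nat \<Rightarrow> nat"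
  assume p: "\<forall>s r. (\<forall>i<n. s i = r i) \<longrightarrow> subs s p = subs r p" and "\<forall>i<n. s i = r i"
  then have "\<forall>i<n. upS s i = upS r i" by (auto split: nat.split)
  with p have "subs (upS s) p = subs (upS r) p" by blast
  then show "subs s (AllS p) = subs r (AllS p)" by simp
qed

lemma subt_cong2: "\<exists>n. \<forall>s r. (\<forall>i<n. s i = r i) \<longrightarrow> subt s t = subt r t \<and> subt s u = subt r u"
  using subt_cong[of "Add t u"] by simp

lemma ex_suppn: "\<exists>n. suppn n p"
proof (induct p)
  case (Imp p q)
  then show ?case using suppn_Imp by blast
next
  case (All p)
  then show ?case using suppn_All by blast
next
  case (Eql t u)
  show ?case using subt_cong2[of t u] unfolding suppn_def subn.simps by metis
next
  case (Less t u)
  show ?case using subt_cong2[of t u] unfolding suppn_def subn.simps by metis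
next
  case (Mem t u)
  show ?case using subt_cong[of t] unfolding suppn_def subn.simps by metis
next
  case (AllS p)
  then show ?case by (simp add: suppn_def)
qed (simp add: suppn_def)

lemma ex_supps: "\<exists>n. supps n p"
proof (induct p)
  case (Imp p q)
  then show ?case using supps_Imp by blast
next
  case (AllS p)
  then show ?case using supps_AllS by blast
next
  case (Mem t X)
  then show ?case by (intro exI[of _ "Suc X"]) (auto simp: supps_def)
qed (auto simp: supps_def)

text \<open>A finite context leaves every large enough variable fresh; this later replaces Henkin
  constants.\<close>

lemma ex_suppn_list: "\<exists>n. \<forall>p\<in>set G. suppn n p"
proof (induct G)
  case (Cons a G)
  then obtain n where "\<forall>p\<in>set G. suppn n p" by blast
  moreover obtain m where "suppn m a" using ex_suppn by blast
  ultimately have "\<forall>p\<in>set (a # G). suppn (max m n) p"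
    by (auto intro: suppn_mono)
  then show ?case ..
qed simp

lemma ex_supps_list: "\<exists>n. \<forall>p\<in>set G. supps n p"
proof (induct G)
  case (Cons a G)
  then obtain n where "\<forall>p\<in>set G. supps n p" by blast
  moreover obtain m where "supps m a" using ex_supps by blast
  ultimately have "\<forall>p\<in>set (a # G). supps (max m n) p"
    by (auto intro: supps_mono)
  then show ?case ..
qed simp

section \<open>Admissible rules of the calculus\<close>

lemma weaken: "T; G \<turnstile> p \<Longrightarrow> set G \<subseteq> set G' \<Longrightarrow> T; G' \<turnstile> p"
proof (induct arbitrary: G' rule: derivable.induct)
  case (ImpI p G q)
  then show ?case by (metis derivable.ImpI insert_mono list.simps(15))
next
  case (Class p G)
  then show ?case by (metis derivable.Class insert_mono list.simps(15))
next
  case (AllI G p)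
  then show ?case by (simp add: image_mono derivable.AllI)
next
  case (AllSI G p)
  then show ?case by (simp add: image_mono derivable.AllSI)
next
  case (ImpE G p q)
  then show ?case by (blast intro: derivable.ImpE)
next
  case (Subst G t u p)
  then show ?case by (blast intro: derivable.Subst)
qed (simp_all add: derivable.Ax derivable.Hyp subset_iff derivable.AllE derivable.AllSE derivable.Refl)

text \<open>Captures the closure convention for axioms: an axiom is derivable in every context, in
  particular in the shifted contexts of \<open>AllI\<close> and \<open>AllSI\<close>, so it can be
  generalised and then instantiated freely.\<close>

definition valid_in :: "fm set \<Rightarrow> fm \<Rightarrow> bool" where
  "valid_in T p \<longleftrightarrow> (\<forall>G. T; G \<turnstile> p)"

lemma valid_in_inst: "valid_in T p \<Longrightarrow> valid_in T (inst t p)"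
  unfolding valid_in_def by (blast intro: AllI AllE)

lemma valid_in_instS: "valid_in T p \<Longrightarrow> valid_in T (instS X p)"
  unfolding valid_in_def by (blast intro: AllSI AllSE)

lemma valid_in_subn_aux:
  "valid_in T p \<Longrightarrow> valid_in T (subn (\<lambda>i. if i < n then ts i else Var (i - n)) p)"
proof (induct n arbitrary: p ts)
  case (Suc n)
  \<comment> \<open>The substitution is carried out one variable at a time; the shift by
    \<open>n\<close> protects the variables of \<open>ts 0\<close> from the \<open>n\<close>
    instantiations still to come.\<close>
  let ?t = "subt (\<lambda>i. Var (i + n)) (ts 0)"
  have "valid_in T (subn (\<lambda>i. if i < n then ts (Suc i) else Var (i - n)) (inst ?t p))"
    by (rule Suc.hyps[OF valid_in_inst[OF Suc.prems]])
  moreover have "subn (\<lambda>i. if i < n then ts (Suc i) else Var (i - n)) (inst ?t p)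
      = subn (\<lambda>i. if i < Suc n then ts i else Var (i - Suc n)) p"
    unfolding subn_subn
    by (rule arg_cong[where f = "\<lambda>x. subn x p"], rule ext) (simp add: subt_subt split: nat.split)
  ultimately show ?case by simp
qed simp

lemma valid_in_subn: "valid_in T p \<Longrightarrow> valid_in T (subn s p)"
proof -
  assume p: "valid_in T p"
  obtain n where "suppn n p" using ex_suppn by blast
  then have "subn s p = subn (\<lambda>i. if i < n then s i else Var (i - n)) p"
    unfolding suppn_def by simp
  then show ?thesis using valid_in_subn_aux[OF p] by simp
qed

lemma valid_in_subs_aux:
  "valid_in T p \<Longrightarrow> valid_in T (subs (\<lambda>i. if i < n then ts i else i - n) p)"
proof (induct n arbitrary: p ts)
  case (Suc n)
  have "valid_in T (subs (\<lambda>i. if i < n then ts (Suc i) else i - n) (instS (ts 0 + n) p))"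
    by (rule Suc.hyps[OF valid_in_instS[OF Suc.prems]])
  moreover have "subs (\<lambda>i. if i < n then ts (Suc i) else i - n) (instS (ts 0 + n) p)
      = subs (\<lambda>i. if i < Suc n then ts i else i - Suc n) p"
    unfolding subs_subs
    by (rule arg_cong[where f = "\<lambda>x. subs x p"], rule ext) (simp split: nat.split)
  ultimately show ?case by simp
qed simp

lemma valid_in_subs: "valid_in T p \<Longrightarrow> valid_in T (subs s p)"
proof -
  assume p: "valid_in T p"
  obtain n where "supps n p" using ex_supps by blast
  then have "subs s p = subs (\<lambda>i. if i < n then s i else i - n) p"
    unfolding supps_def by simp
  then show ?thesis using valid_in_subs_aux[OF p] by simp
qed

lemma valid_in_Ax: "p \<in> T \<Longrightarrow> valid_in T p"
  by (simp add: valid_in_def Ax)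

text \<open>Axioms may be open and \<open>T\<close> need not be closed under substitution, so the
  \<open>Ax\<close> case rests on \<open>valid_in_subn\<close>.\<close>

lemma derivable_subn: "T; G \<turnstile> p \<Longrightarrow> T; map (subn s) G \<turnstile> subn s p"
proof (induct arbitrary: s rule: derivable.induct)
  case (Ax p G)
  then show ?case using valid_in_subn valid_in_Ax by (auto simp: valid_in_def)
next
  case (AllI G p)
  from AllI(2)[of "up s"] have "T; map liftn (map (subn s) G) \<turnstile> subn (up s) p"
    by (simp add: subn_liftn o_def)
  then show ?case by (simp add: derivable.AllI)
next
  case (AllE G p t)
  then show ?case by (simp add: subn_inst derivable.AllE)
next
  case (AllSI G p)
  from AllSI(2)[of s] have "T; map lifts (map (subn s) G) \<turnstile> subn s p"
    by (simp add: subn_subs o_def)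
  then show ?case by (simp add: derivable.AllSI)
next
  case (AllSE G p X)
  then show ?case by (simp add: subn_subs derivable.AllSE)
next
  case (Subst G t u p)
  then show ?case by (simp add: subn_inst) (blast intro: derivable.Subst)
next
  case (ImpE G p q)
  then show ?case by (simp) (blast intro: derivable.ImpE)
next
  case (Class p G)
  from Class(2)[of s] show ?case by (auto intro: derivable.Class)
qed (simp_all add: derivable.Hyp derivable.ImpI derivable.Refl)

lemma derivable_subs: "T; G \<turnstile> p \<Longrightarrow> T; map (subs s) G \<turnstile> subs s p"
proof (induct arbitrary: s rule: derivable.induct)
  case (Ax p G)
  then show ?case using valid_in_subs valid_in_Ax by (auto simp: valid_in_def)
next
  case (AllI G p)
  from AllI(2)[of s] have "T; map liftn (map (subs s) G) \<turnstile> subs s p"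
    by (simp add: subn_subs o_def)
  then show ?case by (simp add: derivable.AllI)
next
  case (AllE G p t)
  then show ?case by (simp add: subn_subs[symmetric] derivable.AllE)
next
  case (AllSI G p)
  from AllSI(2)[of "upS s"] have "T; map lifts (map (subs s) G) \<turnstile> subs (upS s) p"
    by (simp add: subs_lifts o_def)
  then show ?case by (simp add: derivable.AllSI)
next
  case (AllSE G p X)
  then show ?case by (simp add: subs_instS derivable.AllSE)
next
  case (Subst G t u p)
  then show ?case by (simp add: subn_subs[symmetric]) (blast intro: derivable.Subst)
next
  case (ImpE G p q)
  then show ?case by (simp) (blast intro: derivable.ImpE)
next
  case (Class p G)
  from Class(2)[of s] show ?case by (auto intro: derivable.Class)
qed (simp_all add: derivable.Hyp derivable.ImpI derivable.Refl)

text \<open>Form of \<open>AllI\<close> with a named eigenvariable: the fresh \<open>k\<close> takes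
  the place of the de Bruijn shift.\<close>

lemma generalize:
  assumes "T; G \<turnstile> inst (Var k) p" "\<forall>q\<in>set (All p # G). suppn k q"
  shows "T; G \<turnstile> All p"
proof (rule AllI)
  \<comment> \<open>Sends \<open>k\<close> to the new variable 0 and lifts all others; by freshness
    it acts on \<open>G\<close> as plain lifting and undoes the instantiation in
    \<open>p\<close>.\<close>
  let ?s = "\<lambda>i. if i = k then Var 0 else Var (Suc i)"
  have G: "map (subn ?s) G = map liftn G"
    using assms(2) by (auto simp: suppn_def)
  have "subn (up ?s) p = subn (up (\<lambda>i. Var (Suc i))) p"
    using assms(2) by (auto simp: suppn_def dest!: spec[of _ ?s])
  then have "subn ?s (inst (Var k) p) = inst (Var 0) (subn (up (\<lambda>i. Var (Suc i))) p)"
    unfolding subn_inst by simp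
  also have "\<dots> = subn Var p"
    unfolding subn_subn
    by (rule arg_cong[where f = "\<lambda>x. subn x p"], rule ext) (simp add: lift_def split: nat.split)
  finally have "subn ?s (inst (Var k) p) = p" by simp
  with derivable_subn[OF assms(1), of ?s] G show "T; map liftn G \<turnstile> p" by simp
qed

lemma generalizeS:
  assumes "T; G \<turnstile> instS k p" "\<forall>q\<in>set (AllS p # G). supps k q"
  shows "T; G \<turnstile> AllS p"
proof (rule AllSI)
  let ?s = "\<lambda>i. if i = k then 0 else Suc i"
  have G: "map (subs ?s) G = map lifts G"
    using assms(2) by (auto simp: supps_def)
  have "subs (upS ?s) p = subs (upS Suc) p"
    using assms(2) by (auto simp: supps_def dest!: spec[of _ ?s])
  then have "subs ?s (instS k p) = instS 0 (subs (upS Suc) p)"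
    unfolding subs_instS by simp
  also have "\<dots> = subs (\<lambda>n. n) p"
    unfolding subs_subs
    by (rule arg_cong[where f = "\<lambda>x. subs x p"], rule ext) (simp split: nat.split)
  finally have "subs ?s (instS k p) = p" by simp
  with derivable_subs[OF assms(1), of ?s] G show "T; map lifts G \<turnstile> p" by simp
qed


section \<open>Henkin's construction of a maximal consistent set\<close>

instance trm :: countable by countable_datatype
instance fm :: countable by countable_datatype

lemma ex_falso: "T; G \<turnstile> Fls \<Longrightarrow> T; G \<turnstile> p"
  by (rule Class) (erule weaken, auto)

lemma hyp_Cons: "T; p # G \<turnstile> p"
  by (rule Hyp) simp

definition witnessed :: "fm \<Rightarrow> fm list \<Rightarrow> bool" where
  "witnessed p G \<longleftrightarrow> (p \<in> set G \<or> Neg p \<in> set G) \<and>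
     (\<forall>q. p = All q \<and> Neg p \<in> set G \<longrightarrow> (\<exists>t. Neg (inst t q) \<in> set G)) \<and>
     (\<forall>q. p = AllS q \<and> Neg p \<in> set G \<longrightarrow> (\<exists>X. Neg (instS X q) \<in> set G))"

text \<open>Contexts are finite, so a fresh variable can serve as counterexample and the language
  needs no new constants. A derivable \<open>p\<close> is added itself, otherwise its
  negation.\<close>

lemma extend_witnessed:
  assumes "\<not> (T; G \<turnstile> Fls)"
  shows "\<exists>G'. \<not> (T; G' \<turnstile> Fls) \<and> set G \<subseteq> set G' \<and> witnessed p G'"
proof (cases "T; Neg p # G \<turnstile> Fls")
  case True
  then have p: "T; G \<turnstile> p" by (rule Class)
  have 1: "\<not> (T; p # G \<turnstile> Fls)" using assms p by (blast intro: ImpI ImpE)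
  \<comment> \<open>Consistency excludes the negation, which makes both witness clauses vacuous in
    this case.\<close>
  have 2: "Neg p \<notin> set (p # G)"
  proof
    assume "Neg p \<in> set (p # G)"
    then have "T; p # G \<turnstile> Neg p" by (rule Hyp)
    with 1 show False by (blast intro: ImpE hyp_Cons)
  qed
  show ?thesis
    by (rule exI[of _ "p # G"]) (use 1 2 in \<open>auto simp: witnessed_def\<close>)
next
  case False
  let ?G = "Neg p # G"
  have imp: "\<exists>G'. \<not> (T; G' \<turnstile> Fls) \<and> set ?G \<subseteq> set G' \<and> r \<in> set G'"
    if "\<not> (T; r # ?G \<turnstile> Fls)" for r
    by (rule exI[of _ "r # ?G"]) (use that in auto)
  show ?thesis
  proof (cases p)
    case (All q)
    obtain k where k: "\<forall>r\<in>set (All q # ?G). suppn k r" using ex_suppn_list by blast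
    have "\<not> (T; Neg (inst (Var k) q) # ?G \<turnstile> Fls)"
    proof
      assume "T; Neg (inst (Var k) q) # ?G \<turnstile> Fls"
      then have "T; ?G \<turnstile> inst (Var k) q" by (rule Class)
      then have "T; ?G \<turnstile> p" unfolding All by (rule generalize) (use k All in auto)
      then show False using False by (blast intro: ImpE hyp_Cons)
    qed
    then show ?thesis
      by (intro exI[of _ "Neg (inst (Var k) q) # ?G"]) (use All in \<open>auto simp: witnessed_def\<close>)
  next
    case (AllS q)
    obtain k where k: "\<forall>r\<in>set (AllS q # ?G). supps k r" using ex_supps_list by blast
    have "\<not> (T; Neg (instS k q) # ?G \<turnstile> Fls)"
    proof
      assume "T; Neg (instS k q) # ?G \<turnstile> Fls"
      then have "T; ?G \<turnstile> instS k q" by (rule Class)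
      then have "T; ?G \<turnstile> p" unfolding AllS by (rule generalizeS) (use k AllS in auto)
      then show False using False by (blast intro: ImpE hyp_Cons)
    qed
    then show ?thesis
      by (intro exI[of _ "Neg (instS k q) # ?G"]) (use AllS in \<open>auto simp: witnessed_def\<close>)
  qed (intro exI[of _ ?G], use False in \<open>auto simp: witnessed_def\<close>)+
qed

text \<open>The closure properties that let \<open>W\<close> be the set of truths of a structure
  whose elements are given by terms and whose sets are given by set variables.\<close>

locale henkin =
  fixes T :: "fm set" and W :: "fm set"
  assumes W_Fls: "Fls \<notin> W"
    and W_mp: "Imp p q \<in> W \<Longrightarrow> p \<in> W \<Longrightarrow> q \<in> W"
    and W_valid: "valid_in T p \<Longrightarrow> p \<in> W"
    and W_total: "p \<in> W \<or> Neg p \<in> W"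
    and W_AllI: "(\<And>t. inst t p \<in> W) \<Longrightarrow> All p \<in> W"
    and W_AllSI: "(\<And>X. instS X p \<in> W) \<Longrightarrow> AllS p \<in> W"

theorem ex_henkin:
  assumes "\<not> T \<tturnstile> p"
  shows "\<exists>W. henkin T W \<and> p \<notin> W"
proof -
  have "\<exists>f. f 0 = [Neg p] \<and> (\<forall>n. \<not> (T; f n \<turnstile> Fls)) \<and>
      (\<forall>n. set (f n) \<subseteq> set (f (Suc n)) \<and> witnessed (from_nat n) (f (Suc n)))"
  proof -
    have 0: "\<not> (T; [Neg p] \<turnstile> Fls)" using assms unfolding provable_def by (blast intro: Class)
    \<comment> \<open>The clause for 0 pins down the first context, which dependent choice would
      otherwise leave open.\<close>
    define P where "P n G \<longleftrightarrow> \<not> (T; G \<turnstile> Fls) \<and> (n = 0 \<longrightarrow> G = [Neg p])" for n :: nat and G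
    obtain f where "\<And>n. P n (f n)"
      "\<And>n. set (f n) \<subseteq> set (f (Suc n)) \<and> witnessed (from_nat n) (f (Suc n))"
      using dependent_nat_choice[of P "\<lambda>n G G'. set G \<subseteq> set G' \<and> witnessed (from_nat n) G'"] 0 extend_witnessed
      unfolding P_def by (metis Zero_not_Suc)
    then show ?thesis unfolding P_def by blast
  qed
  then obtain f where f0: "f 0 = [Neg p]" and cons: "\<And>n. \<not> (T; f n \<turnstile> Fls)"
    and step: "\<And>n. set (f n) \<subseteq> set (f (Suc n))"
    and wit: "\<And>n. witnessed (from_nat n) (f (Suc n))" by blast
  have mono: "m \<le> n \<Longrightarrow> set (f m) \<subseteq> set (f n)" for m n
    using step by (rule lift_Suc_mono_le)
  \<comment> \<open>The deductive closure of the chain rather than its union, so that all validities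
    belong to it and modus ponens is immediate.\<close>
  define W where "W = {q. \<exists>n. T; f n \<turnstile> q}"
  have memW: "q \<in> set (f n) \<Longrightarrow> q \<in> W" for q n unfolding W_def by (auto intro: Hyp)
  have mp: "r \<in> W" if qr: "Imp q r \<in> W" "q \<in> W" for q r
  proof -
    obtain m n where m: "T; f m \<turnstile> Imp q r" and n: "T; f n \<turnstile> q" using qr unfolding W_def by auto
    have "T; f (max m n) \<turnstile> Imp q r" "T; f (max m n) \<turnstile> q"
      by (rule weaken[OF m mono], simp) (rule weaken[OF n mono], simp)
    then show ?thesis unfolding W_def by (blast intro: ImpE)
  qed
  have fls: "Fls \<notin> W" unfolding W_def using cons by blast
  have wit': "\<exists>n. witnessed q (f n)" for q
    using wit[of "to_nat q"] by auto
  have total: "q \<in> W \<or> Neg q \<in> W" for q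
    using wit'[of q] memW unfolding witnessed_def by blast
  have "henkin T W"
  proof
    fix q assume "valid_in T q"
    then show "q \<in> W" unfolding W_def valid_in_def by blast
  next
    fix q assume q: "\<And>t. inst t q \<in> W"
    show "All q \<in> W"
    proof (rule ccontr)
      assume n: "All q \<notin> W"
      obtain n where w: "witnessed (All q) (f n)" using wit' by blast
      then have "Neg (All q) \<in> set (f n)" using n memW unfolding witnessed_def by blast
      with w obtain t where "Neg (inst t q) \<in> set (f n)" unfolding witnessed_def by blast
      with q mp memW fls show False by blast
    qed
  next
    fix q assume q: "\<And>t. instS t q \<in> W"
    show "AllS q \<in> W"
    proof (rule ccontr)
      assume n: "AllS q \<notin> W"
      obtain n where w: "witnessed (AllS q) (f n)" using wit' by blast
      then have "Neg (AllS q) \<in> set (f n)" using n memW unfolding witnessed_def by blast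
      with w obtain t where "Neg (instS t q) \<in> set (f n)" unfolding witnessed_def by blast
      with q mp memW fls show False by blast
    qed
  qed (use mp fls total in blast)+
  moreover have "p \<notin> W" using memW[of "Neg p" 0] f0 mp fls by auto
  ultimately show ?thesis by blast
qed

section \<open>Structures with a restricted range of sets, and the term model\<close>

record 'a struct =
  zer :: 'a
  uni :: 'a
  add :: "'a \<Rightarrow> 'a \<Rightarrow> 'a"
  mul :: "'a \<Rightarrow> 'a \<Rightarrow> 'a"
  les :: "'a \<Rightarrow> 'a \<Rightarrow> bool"
  sts :: "'a set set"

primrec eval :: "'a struct \<Rightarrow> (nat \<Rightarrow> 'a) \<Rightarrow> trm \<Rightarrow> 'a" where
  "eval M e (Var n) = e n"
| "eval M e Zero = zer M"
| "eval M e One = uni M"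
| "eval M e (Add t u) = add M (eval M e t) (eval M e u)"
| "eval M e (Mul t u) = mul M (eval M e t) (eval M e u)"

primrec sat :: "'a struct \<Rightarrow> (nat \<Rightarrow> 'a) \<Rightarrow> (nat \<Rightarrow> 'a set) \<Rightarrow> fm \<Rightarrow> bool" where
  "sat M e s Fls \<longleftrightarrow> False"
| "sat M e s (Eql t u) \<longleftrightarrow> eval M e t = eval M e u"
| "sat M e s (Less t u) \<longleftrightarrow> les M (eval M e t) (eval M e u)"
| "sat M e s (Mem t X) \<longleftrightarrow> eval M e t \<in> s X"
| "sat M e s (Imp p q) \<longleftrightarrow> (sat M e s p \<longrightarrow> sat M e s q)"
| "sat M e s (All p) \<longleftrightarrow> (\<forall>x. sat M (case_nat x e) s p)"
| "sat M e s (AllS p) \<longleftrightarrow> (\<forall>X\<in>sts M. sat M e (case_nat X s) p)"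

lemma eval_subt: "eval M e (subt r t) = eval M (\<lambda>n. eval M e (r n)) t"
  by (induct t) auto

lemma eval_lift [simp]: "eval M (case_nat x e) (lift t) = eval M e t"
  by (simp add: lift_def eval_subt)

lemma case_nat_comp: "(\<lambda>n. f (case_nat x g n)) = case_nat (f x) (\<lambda>n. f (g n))"
  by (auto split: nat.split)

lemma eval_up: "(\<lambda>n. eval M (case_nat x e) (up r n)) = case_nat x (\<lambda>n. eval M e (r n))"
  by (auto simp: fun_eq_iff split: nat.split)

lemma comp_upS: "(\<lambda>n. case_nat X s (upS r n)) = case_nat X (\<lambda>n. s (r n))"
  by (auto simp: fun_eq_iff split: nat.split)

lemma sat_subn: "sat M e s (subn r p) \<longleftrightarrow> sat M (\<lambda>n. eval M e (r n)) s p"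
  by (induct p arbitrary: e s r) (simp_all add: eval_subt eval_up)

lemma sat_subs: "sat M e s (subs r p) \<longleftrightarrow> sat M e (\<lambda>n. s (r n)) p"
  by (induct p arbitrary: e s r) (simp_all add: comp_upS)

text \<open>Quantifying over all assignments matches the reading of axioms as universal closures.
  With no set in \<open>sts M\<close> there would be no assignment and the second condition would be
  empty.\<close>

definition is_model :: "'a struct \<Rightarrow> fm set \<Rightarrow> bool" where
  "is_model M T \<longleftrightarrow> sts M \<noteq> {} \<and> (\<forall>p\<in>T. \<forall>e s. range s \<subseteq> sts M \<longrightarrow> sat M e s p)"

context henkin
begin

text \<open>Carries the rules of the calculus over to \<open>W\<close>: a derivation from finitely
  many members becomes a valid chain of implications, to which \<open>W_mp\<close> applies.\<close>

lemma W_derivable: "\<lbrakk>\<And>G. set H \<subseteq> set G \<Longrightarrow> T; G \<turnstile> p; set H \<subseteq> W\<rbrakk> \<Longrightarrow> p \<in> W"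
proof (induct H arbitrary: p)
  case Nil
  then show ?case by (auto simp: valid_in_def intro: W_valid)
next
  case (Cons h H)
  have "Imp h p \<in> W"
    by (rule Cons.hyps, rule ImpI) (use Cons.prems(1)[of "h # _"] Cons.prems(2) in auto)
  then show ?case using Cons.prems W_mp by auto
qed

lemma W_Imp: "Imp p q \<in> W \<longleftrightarrow> (p \<in> W \<longrightarrow> q \<in> W)"
proof (intro iffI impI)
  assume pq: "p \<in> W \<longrightarrow> q \<in> W"
  show "Imp p q \<in> W"
  proof (cases "q \<in> W")
    case True
    then show ?thesis by (intro W_derivable[of "[q]"]) (auto intro!: ImpI intro: Hyp)
  next
    case False
    then have "Neg p \<in> W" using pq W_total by blast
    show ?thesis
    proof (rule W_derivable[of "[Neg p]"])
      fix G assume "set [Neg p] \<subseteq> set G"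
      then have "T; p # G \<turnstile> Fls" by (intro ImpE[of _ _ p Fls]) (auto intro: Hyp)
      then show "T; G \<turnstile> Imp p q" by (rule ImpI[OF ex_falso])
    qed (use \<open>Neg p \<in> W\<close> in auto)
  qed
qed (rule W_mp)

lemma W_All: "All p \<in> W \<longleftrightarrow> (\<forall>t. inst t p \<in> W)"
proof (intro iffI allI)
  fix t assume "All p \<in> W"
  then show "inst t p \<in> W" by (intro W_derivable[of "[All p]"]) (auto intro: AllE Hyp)
qed (simp add: W_AllI)

lemma W_AllS: "AllS p \<in> W \<longleftrightarrow> (\<forall>t. instS t p \<in> W)"
proof (intro iffI allI)
  fix t assume "AllS p \<in> W"
  then show "instS t p \<in> W" by (intro W_derivable[of "[AllS p]"]) (auto intro: AllSE Hyp)
qed (simp add: W_AllSI)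

lemma W_Refl: "Eql t t \<in> W"
  by (rule W_derivable[of "[]"]) (auto intro: Refl)

lemma W_Subst: "Eql t u \<in> W \<Longrightarrow> inst t p \<in> W \<Longrightarrow> inst u p \<in> W"
  by (rule W_derivable[of "[Eql t u, inst t p]"]) (auto intro: Subst[of _ _ t] Hyp)

lemma inst_lift [simp]: "subt (case_nat t Var) (lift u) = u"
  by (simp add: lift_def subt_subt)

lemma inst_up: "(\<lambda>n. subt (case_nat t Var) (up s n)) = case_nat t s"
  by (auto simp: fun_eq_iff split: nat.split)

lemma W_sym: "Eql t u \<in> W \<Longrightarrow> Eql u t \<in> W"
  using W_Subst[of t u "Eql (Var 0) (lift t)"] W_Refl by simp

lemma W_trans: "Eql t u \<in> W \<Longrightarrow> Eql u v \<in> W \<Longrightarrow> Eql t v \<in> W"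
  using W_Subst[of u v "Eql (lift t) (Var 0)"] by simp

lemma W_Add: "Eql t t' \<in> W \<Longrightarrow> Eql u u' \<in> W \<Longrightarrow> Eql (Add t u) (Add t' u') \<in> W"
  using W_Subst[of t t' "Eql (lift (Add t u)) (Add (Var 0) (lift u))"]
    W_Subst[of u u' "Eql (lift (Add t u)) (Add (lift t') (Var 0))"] W_Refl[of "Add t u"] by simp

lemma W_Mul: "Eql t t' \<in> W \<Longrightarrow> Eql u u' \<in> W \<Longrightarrow> Eql (Mul t u) (Mul t' u') \<in> W"
  using W_Subst[of t t' "Eql (lift (Mul t u)) (Mul (Var 0) (lift u))"]
    W_Subst[of u u' "Eql (lift (Mul t u)) (Mul (lift t') (Var 0))"] W_Refl[of "Mul t u"] by simp

lemma W_Less: "Eql t t' \<in> W \<Longrightarrow> Eql u u' \<in> W \<Longrightarrow> Less t u \<in> W \<Longrightarrow> Less t' u' \<in> W"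
  using W_Subst[of t t' "Less (Var 0) (lift u)"]
    W_Subst[of u u' "Less (lift t') (Var 0)"] by simp

lemma W_Mem: "Eql t t' \<in> W \<Longrightarrow> Mem t X \<in> W \<Longrightarrow> Mem t' X \<in> W"
  using W_Subst[of t t' "Mem (Var 0) X"] by simp

text \<open>The term model. The map \<open>c\<close> represents the classes of terms modulo equality
  in \<open>W\<close> by elements of an arbitrary type, so the carrier can be prescribed.\<close>

lemma truth:
  fixes c :: "trm \<Rightarrow> 'a"
  assumes c: "\<And>t u. c t = c u \<longleftrightarrow> Eql t u \<in> W" and "surj c"
  shows "\<exists>M :: 'a struct. is_model M T \<and> (\<forall>p. \<not> T \<tturnstile> p \<longrightarrow> p \<notin> W \<longrightarrow>
     (\<exists>e s. range s \<subseteq> sts M \<and> \<not> sat M e s p))"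
proof -
  define g where "g = inv c"
  have cg: "c (g x) = x" for x unfolding g_def using \<open>surj c\<close> by (simp add: surj_f_inv_f)
  then have gc: "Eql (g (c t)) t \<in> W" for t using c by metis
  \<comment> \<open>Set variables provide the second-order objects; each one denotes the classes of
    its members according to \<open>W\<close>.\<close>
  define D where "D X = {c t | t. Mem t X \<in> W}" for X
  have D: "c t \<in> D X \<longleftrightarrow> Mem t X \<in> W" for t X unfolding D_def using c by (auto dest: W_sym intro: W_Mem)
  define M where "M = \<lparr>zer = c Zero, uni = c One, add = \<lambda>x y. c (Add (g x) (g y)),
    mul = \<lambda>x y. c (Mul (g x) (g y)), les = \<lambda>x y. Less (g x) (g y) \<in> W, sts = range D\<rparr>"
  have ev: "eval M (\<lambda>n. c (s n)) t = c (subt s t)" for s t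
    by (induct t) (auto simp: M_def c intro: W_Add W_Mul gc)
  have les: "les M (c t) (c u) \<longleftrightarrow> Less t u \<in> W" for t u
    unfolding M_def using W_Less W_sym gc by simp blast
  \<comment> \<open>Stated for all substitutions, since a quantifier changes the assignment and the
    induction would not pass through for the identity alone.\<close>
  have sat: "sat M (\<lambda>n. c (s n)) (\<lambda>X. D (r X)) p \<longleftrightarrow> subn s (subs r p) \<in> W" for s r p
  proof (induct p arbitrary: s r)
    case (All p)
    have "sat M (\<lambda>n. c (s n)) (\<lambda>X. D (r X)) (All p) \<longleftrightarrow>
      (\<forall>t. sat M (case_nat (c t) (\<lambda>n. c (s n))) (\<lambda>X. D (r X)) p)"
      using cg by simp metis
    also have "\<dots> \<longleftrightarrow> (\<forall>t. subn (case_nat t s) (subs r p) \<in> W)"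
      using All[of "case_nat _ s"] by (simp add: case_nat_comp)
    also have "\<dots> \<longleftrightarrow> (\<forall>t. inst t (subn (up s) (subs r p)) \<in> W)"
      by (simp add: subn_subn inst_up)
    finally show ?case by (simp add: W_All)
  next
    case (AllS p)
    have "sat M (\<lambda>n. c (s n)) (\<lambda>X. D (r X)) (AllS p) \<longleftrightarrow>
      (\<forall>X. sat M (\<lambda>n. c (s n)) (case_nat (D X) (\<lambda>X. D (r X))) p)"
      by (simp add: M_def)
    also have "\<dots> \<longleftrightarrow> (\<forall>X. subn s (subs (case_nat X r) p) \<in> W)"
      using AllS[of s "case_nat _ r"] by (simp add: case_nat_comp)
    also have "\<dots> \<longleftrightarrow> (\<forall>X. instS X (subn s (subs (upS r) p)) \<in> W)"
      by (simp add: subn_subs subs_subs comp_upS)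
    finally show ?case by (simp add: W_AllS)
  qed (simp_all add: ev c les D W_Imp W_Fls)
  have "is_model M T" unfolding is_model_def
  proof (intro conjI ballI allI impI)
    show "sts M \<noteq> {}" by (simp add: M_def)
  next
    fix p and e :: "nat \<Rightarrow> 'a" and s :: "nat \<Rightarrow> 'a set"
    assume p: "p \<in> T" and s: "range s \<subseteq> sts M"
    have "\<forall>n. \<exists>X. s n = D X" using s by (auto simp: M_def)
    then obtain r where "\<And>n. s n = D (r n)" by metis
    then have r: "s = (\<lambda>n. D (r n))" by (rule ext)
    have "subn (\<lambda>n. g (e n)) (subs r p) \<in> W"
      using p by (intro W_valid valid_in_subn valid_in_subs valid_in_Ax)
    then have "sat M (\<lambda>n. c (g (e n))) (\<lambda>n. D (r n)) p" by (simp add: sat)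
    then show "sat M e s p" by (simp add: cg r)
  qed
  moreover have "\<exists>e s. range s \<subseteq> sts M \<and> \<not> sat M e s p" if "p \<notin> W" for p
    using that sat[of Var "\<lambda>n. n" p]
    by (intro exI[of _ "\<lambda>n. c (Var n)"] exI[of _ "\<lambda>n. D n"]) (auto simp: M_def)
  ultimately show ?thesis by blast
qed

text \<open>Makes the term model infinite: the successor axioms already separate the numerals in
  \<open>W\<close>.\<close>

lemma nm_inj:
  assumes "basic_axioms \<subseteq> T" "Eql (nm i) (nm j) \<in> W"
  shows "i = j"
proof -
  have "Neg (Eql (Add (Var 0) One) Zero) \<in> T"
    "Imp (Eql (Add (Var 1) One) (Add (Var 0) One)) (Eql (Var 1) (Var 0)) \<in> T"
    using assms(1) unfolding basic_axioms_def by auto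
  then have "subn (\<lambda>_. t) (Neg (Eql (Add (Var 0) One) Zero)) \<in> W"
    "subn (case_nat t (\<lambda>_. u)) (Imp (Eql (Add (Var 1) One) (Add (Var 0) One)) (Eql (Var 1) (Var 0))) \<in> W" for t u
    using valid_in_Ax valid_in_subn W_valid by blast+
  then have Z: "Eql (Add t One) Zero \<notin> W" and
    S: "Eql (Add u One) (Add t One) \<in> W \<Longrightarrow> Eql u t \<in> W" for t u
    using W_Imp W_Fls by auto
  show ?thesis using assms(2)
  proof (induct i arbitrary: j)
    case 0
    then show ?case using W_sym[of "nm 0" "nm j"] Z[of "nm (j - 1)"] by (cases j) auto
  next
    case (Suc i)
    then obtain k where k: "j = Suc k" using Z[of "nm i"] by (cases j) auto
    then have "Eql (nm i) (nm k) \<in> W" using Suc.prems S[of "nm i" "nm k"] by simp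
    then show ?case using Suc.hyps k by simp
  qed
qed

text \<open>The classes of terms are countable because terms are, and infinite by
  \<open>nm_inj\<close>; hence they can be matched with any countably infinite type.\<close>

lemma ex_canonical:
  assumes "basic_axioms \<subseteq> T" "bij (h :: nat \<Rightarrow> 'a)"
  shows "\<exists>c :: trm \<Rightarrow> 'a. surj c \<and> (\<forall>t u. c t = c u \<longleftrightarrow> Eql t u \<in> W)"
proof -
  define q where "q t = {u. Eql t u \<in> W}" for t
  have q: "q t = q u \<longleftrightarrow> Eql t u \<in> W" for t u
    unfolding q_def using W_Refl W_sym W_trans by blast
  have "inj (\<lambda>i. q (nm i))" using nm_inj[OF assms(1)] q by (auto intro: injI)
  then have "infinite (range (\<lambda>i. q (nm i)))" by (rule range_inj_infinite)
  then have "infinite (range q)" by (rule infinite_super[rotated]) auto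
  then have b: "bij_betw (to_nat_on (range q)) (range q) UNIV"
    by (intro to_nat_on_infinite) auto
  let ?c = "\<lambda>t. h (to_nat_on (range q) (q t))"
  have "?c ` UNIV = h ` (to_nat_on (range q) ` range q)" by auto
  then have "surj ?c" using b assms(2) by (simp add: bij_betw_def bij_is_surj)
  moreover have "?c t = ?c u \<longleftrightarrow> q t = q u" for t u
    using b assms(2) by (simp add: bij_betw_def bij_def inj_eq inj_on_eq_iff)
  ultimately show ?thesis using q by (intro exI[of _ ?c]) simp
qed

end

theorem completeness:
  assumes "basic_axioms \<subseteq> T" "bij (h :: nat \<Rightarrow> 'a)"
    and "\<And>(M :: 'a struct) e s. is_model M T \<Longrightarrow> range s \<subseteq> sts M \<Longrightarrow> sat M e s p"
  shows "T \<tturnstile> p"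
proof (rule ccontr)
  assume n: "\<not> T \<tturnstile> p"
  then obtain W where W: "henkin T W" "p \<notin> W" using ex_henkin by blast
  interpret henkin T W by (rule W)
  from ex_canonical[OF assms(1,2)] obtain c :: "trm \<Rightarrow> 'a" where
    "surj c" "\<And>t u. c t = c u \<longleftrightarrow> Eql t u \<in> W" by blast
  from truth[OF this(2,1)] n W(2) assms(3) show False by blast
qed

section \<open>The model\<close>

lemma sat_inst: "sat M e s (inst t p) \<longleftrightarrow> sat M (case_nat (eval M e t) e) s p"
  unfolding sat_subn by (rule arg_cong[where f = "\<lambda>e. sat M e s p"]) (auto split: nat.split)

lemma sat_induction_axiom: "sat M e s (induction_axiom p) \<longleftrightarrow>
   (sat M (case_nat (zer M) e) s p \<longrightarrow>
    (\<forall>x. sat M (case_nat x e) s p \<longrightarrow> sat M (case_nat (add M x (uni M)) e) s p) \<longrightarrow>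
    (\<forall>x. sat M (case_nat x e) s p))"
proof -
  have "sat M (case_nat x e) s (subn (case_nat (Add (Var 0) One) (\<lambda>n. Var (Suc n))) p) \<longleftrightarrow>
    sat M (case_nat (add M x (uni M)) e) s p" for x
    unfolding sat_subn by (rule arg_cong[where f = "\<lambda>e. sat M e s p"]) (auto split: nat.split)
  then show ?thesis by (simp add: induction_axiom_def sat_inst) blast
qed

lemma sat_comprehension_axiom: "sat M e s (comprehension_axiom p q) \<longleftrightarrow>
   ((\<forall>x. sat M (case_nat x e) s p \<longleftrightarrow> sat M (case_nat x e) s q) \<longrightarrow>
    (\<exists>X\<in>sts M. \<forall>x. x \<in> X \<longleftrightarrow> sat M (case_nat x e) s p))"
  by (auto simp: comprehension_axiom_def sat_subs)

text \<open>A bare copy of \<open>nat\<close> as carrier: it has no arithmetic of its own, so the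
  operations of the fixed model can become its class instances.\<close>

typedef mnat = "UNIV :: nat set" ..

lemma bij_Abs_mnat: "bij Abs_mnat"
  by (rule bijI') (auto simp: Abs_mnat_inject intro: Abs_mnat_cases)

definition standard :: "mnat struct" where
  "standard = \<lparr>zer = Abs_mnat 0, uni = Abs_mnat 1,
     add = \<lambda>x y. Abs_mnat (Rep_mnat x + Rep_mnat y),
     mul = \<lambda>x y. Abs_mnat (Rep_mnat x * Rep_mnat y),
     les = \<lambda>x y. Rep_mnat x < Rep_mnat y, sts = UNIV\<rparr>"

lemma standard_model: "is_model standard RCA0"
proof -
  have eq: "x = y \<longleftrightarrow> Rep_mnat x = Rep_mnat y" for x y by (simp add: Rep_mnat_inject)
  have rep: "Rep_mnat (Abs_mnat n) = n" for n by (simp add: Abs_mnat_inverse)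
  have ind: "sat standard e s (induction_axiom p)" for e s p
  proof -
    have "sat standard (case_nat (Abs_mnat n) e) s p"
      if 0: "sat standard (case_nat (Abs_mnat 0) e) s p"
        and step: "\<And>n. sat standard (case_nat (Abs_mnat n) e) s p
          \<Longrightarrow> sat standard (case_nat (Abs_mnat (Suc n)) e) s p" for n
      by (induct n) (simp_all add: that)
    moreover have "\<exists>n. x = Abs_mnat n" for x by (metis Abs_mnat_cases)
    moreover have "add standard (Abs_mnat n) (uni standard) = Abs_mnat (Suc n)"
      "zer standard = Abs_mnat 0" for n
      by (simp_all add: standard_def rep)
    ultimately show ?thesis unfolding sat_induction_axiom by metis
  qed
  have "sat standard e s p" if "p \<in> RCA0" for p e s
    using that unfolding RCA0_def
  proof (elim UnE)
    assume "p \<in> basic_axioms"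
    then show ?thesis
      by (auto simp: basic_axioms_def standard_def eq rep)
  next
    assume "p \<in> {comprehension_axiom p q |p q. p \<in> Sigma01 \<and> q \<in> Pi01}"
    then show ?thesis
      by (auto simp: sat_comprehension_axiom standard_def intro!: exI[of _ "Collect _"])
  qed (use ind in auto)
  then show ?thesis unfolding is_model_def by (simp add: standard_def)
qed


text \<open>\<open>MM\<close> is a counterexample if there is one, so what holds in \<open>MM\<close> is provable. Fixing the model
  globally makes its arithmetic available through type classes on \<open>mnat\<close>; the standard model is
  only needed as a default.\<close>

definition refutes :: "mnat struct \<Rightarrow> fm \<Rightarrow> bool" where
  "refutes M p \<longleftrightarrow> (\<exists>e s. range s \<subseteq> sts M \<and> \<not> sat M e s p)"

definition MM :: "mnat struct" where
  "MM = (SOME M. is_model M RCA0 \<and>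
     ((\<exists>N :: mnat struct. is_model N RCA0 \<and> refutes N (Imp (AHT 2) (IPT2 2))) \<longrightarrow>
       refutes M (Imp (AHT 2) (IPT2 2))))"

lemma MM: "is_model MM RCA0 \<and> ((\<exists>N :: mnat struct. is_model N RCA0 \<and> refutes N (Imp (AHT 2) (IPT2 2))) \<longrightarrow>
       refutes MM (Imp (AHT 2) (IPT2 2)))"
  unfolding MM_def by (rule someI_ex) (use standard_model in blast)

lemma provable_if_MM:
  assumes "\<not> refutes MM (Imp (AHT 2) (IPT2 2))"
  shows "RCA0 \<tturnstile> Imp (AHT 2) (IPT2 2)"
proof (rule completeness[OF _ bij_Abs_mnat])
  show "basic_axioms \<subseteq> RCA0" by (auto simp: RCA0_def)
next
  fix M :: "mnat struct" and e :: "nat \<Rightarrow> mnat" and s :: "nat \<Rightarrow> mnat set"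
  assume "is_model M RCA0" "range s \<subseteq> sts M"
  moreover have "\<not> refutes M (Imp (AHT 2) (IPT2 2))"
    using assms MM \<open>is_model M RCA0\<close> by blast
  ultimately show "sat M e s (Imp (AHT 2) (IPT2 2))"
    unfolding refutes_def by blast
qed

definition second_order :: "mnat set set" ("\<S>") where "\<S> = sts MM"

lemma MM_sat: "p \<in> RCA0 \<Longrightarrow> range s \<subseteq> \<S> \<Longrightarrow> sat MM e s p"
  using MM unfolding is_model_def second_order_def by blast

instantiation mnat :: "{zero, one, plus, times, ord}"
begin
definition "0 = zer MM"
definition "1 = uni MM"
definition "x + y = add MM x y"
definition "x * y = mul MM x y"
definition "x < y \<longleftrightarrow> les MM x y"
definition "x \<le> y \<longleftrightarrow> x < y \<or> x = (y :: mnat)"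
instance ..
end

lemma MM_simps [simp]: "zer MM = 0" "uni MM = 1" "add MM x y = x + y" "mul MM x y = x * y"
  "les MM x y \<longleftrightarrow> x < y" "sts MM = \<S>"
  by (simp_all add: zero_mnat_def one_mnat_def plus_mnat_def times_mnat_def less_mnat_def second_order_def)

section \<open>Bounded formulas with parameters\<close>

type_synonym env = "nat \<Rightarrow> mnat"

text \<open>\<open>view \<sigma> e\<close> assigns to every formula variable a parameter or an entry of \<open>e\<close>.\<close>

definition view :: "(nat \<Rightarrow> mnat + nat) \<Rightarrow> env \<Rightarrow> env" where
  "view \<sigma> e = (\<lambda>i. case \<sigma> i of Inl c \<Rightarrow> c | Inr j \<Rightarrow> e j)"

definition term_fun :: "(env \<Rightarrow> mnat) \<Rightarrow> bool" where
  "term_fun t \<longleftrightarrow> (\<exists>u \<sigma>. t = (\<lambda>e. eval MM (view \<sigma> e) u))"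

text \<open>Definability by a bounded formula, with number parameters hidden in
  \<open>\<sigma>\<close> and set parameters in \<open>s\<close>; environments play the role of free
  variables.\<close>

definition delta0 :: "(env \<Rightarrow> bool) \<Rightarrow> bool" where
  "delta0 P \<longleftrightarrow> (\<exists>p \<sigma> s. bounded_fm p \<and> range s \<subseteq> \<S> \<and> P = (\<lambda>e. sat MM (view \<sigma> e) s p))"

text \<open>Interleaving on even and odd indices brings two formulas with separate parameters under
  one assignment.\<close>

definition mix :: "(nat \<Rightarrow> 'a) \<Rightarrow> (nat \<Rightarrow> 'a) \<Rightarrow> nat \<Rightarrow> 'a" where
  "mix f g n = (if even n then f (n div 2) else g (n div 2))"

lemma mix_even [simp]: "mix f g (2 * n) = f n" and mix_odd [simp]: "mix f g (Suc (2 * n)) = g n"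
  by (simp_all add: mix_def)

lemma view_mix: "view (mix \<sigma> \<tau>) e = mix (view \<sigma> e) (view \<tau> e)"
  by (simp add: view_def mix_def fun_eq_iff)

lemma range_mix: "range f \<subseteq> A \<Longrightarrow> range g \<subseteq> A \<Longrightarrow> range (mix f g) \<subseteq> A"
  by (auto simp: mix_def)

abbreviation "evens \<equiv> subt (\<lambda>i. Var (2 * i))"
abbreviation "odds \<equiv> subt (\<lambda>i. Var (Suc (2 * i)))"
abbreviation "evenf p \<equiv> subn (\<lambda>i. Var (2 * i)) (subs (\<lambda>i. 2 * i) p)"
abbreviation "oddf p \<equiv> subn (\<lambda>i. Var (Suc (2 * i))) (subs (\<lambda>i. Suc (2 * i)) p)"

lemma eval_evens [simp]: "eval M (mix f g) (evens t) = eval M f t"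
  and eval_odds [simp]: "eval M (mix f g) (odds t) = eval M g t"
  by (simp_all add: eval_subt)

lemma sat_evenf [simp]: "sat M (mix f g) (mix s r) (evenf p) = sat M f s p"
  and sat_oddf [simp]: "sat M (mix f g) (mix s r) (oddf p) = sat M g r p"
  by (simp_all add: sat_subn sat_subs)

lemma bounded_fm_subn: "bounded_fm p \<Longrightarrow> bounded_fm (subn s p)"
proof (induct arbitrary: s rule: bounded_fm.induct)
  case (6 p t)
  have "subt (up s) (lift t) = lift (subt s t)" by (simp add: lift_def subt_subt)
  then show ?case using 6 by (simp add: bounded_fm.intros)
next
  case (7 p t)
  have "subt (up s) (lift t) = lift (subt s t)" by (simp add: lift_def subt_subt)
  then show ?case using 7 by (simp add: bounded_fm.intros)
qed (auto intro: bounded_fm.intros)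

lemma bounded_fm_subs: "bounded_fm p \<Longrightarrow> bounded_fm (subs s p)"
  by (induct arbitrary: s rule: bounded_fm.induct) (auto intro: bounded_fm.intros)

lemmas bounded_fm_simps [simp] = bounded_fm_subn bounded_fm_subs bounded_fm.intros

lemma delta0_sat: "bounded_fm p \<Longrightarrow> range s \<subseteq> \<S> \<Longrightarrow> delta0 (\<lambda>e. sat MM (view \<sigma> e) s p)"
  unfolding delta0_def by blast

lemma delta0E:
  assumes "delta0 P"
  obtains p \<sigma> s where "bounded_fm p" "range s \<subseteq> \<S>" "\<And>e. P e \<longleftrightarrow> sat MM (view \<sigma> e) s p"
  using assms unfolding delta0_def by auto

lemma delta0_merge:
  assumes "delta0 P" "delta0 Q"
  obtains p q \<sigma> s where "bounded_fm p" "bounded_fm q" "range s \<subseteq> \<S>"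
    "P = (\<lambda>e. sat MM (view \<sigma> e) s p)" "Q = (\<lambda>e. sat MM (view \<sigma> e) s q)"
proof -
  obtain p \<sigma> s where p: "bounded_fm p" "range s \<subseteq> \<S>" "P = (\<lambda>e. sat MM (view \<sigma> e) s p)"
    using assms(1) unfolding delta0_def by blast
  obtain q \<tau> r where q: "bounded_fm q" "range r \<subseteq> \<S>" "Q = (\<lambda>e. sat MM (view \<tau> e) r q)"
    using assms(2) unfolding delta0_def by blast
  show thesis
    by (rule that[of "evenf p" "oddf q" "mix s r" "mix \<sigma> \<tau>"]) (use p q range_mix in \<open>simp_all add: view_mix\<close>)
qed

lemma term_fun_merge:
  assumes "term_fun t" "term_fun u"
  obtains t' u' \<sigma> where "t = (\<lambda>e. eval MM (view \<sigma> e) t')" "u = (\<lambda>e. eval MM (view \<sigma> e) u')"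
proof -
  obtain t' \<sigma> where t: "t = (\<lambda>e. eval MM (view \<sigma> e) t')" using assms(1) unfolding term_fun_def by blast
  obtain u' \<tau> where u: "u = (\<lambda>e. eval MM (view \<tau> e) u')" using assms(2) unfolding term_fun_def by blast
  show thesis
    by (rule that[of "mix \<sigma> \<tau>" "evens t'" "odds u'"]) (simp_all add: view_mix t u)
qed

lemma ex_second_order: "\<exists>X. X \<in> \<S>"
  using MM unfolding is_model_def second_order_def by blast

lemma term_fun_const: "term_fun (\<lambda>e. c)"
  unfolding term_fun_def by (intro exI[of _ "Var 0"] exI[of _ "\<lambda>_. Inl c"]) (simp add: view_def)

lemma term_fun_var: "term_fun (\<lambda>e. e j)"
  unfolding term_fun_def by (intro exI[of _ "Var 0"] exI[of _ "\<lambda>_. Inr j"]) (simp add: view_def)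

lemma term_fun_add: "term_fun t \<Longrightarrow> term_fun u \<Longrightarrow> term_fun (\<lambda>e. t e + u e)"
proof (erule (1) term_fun_merge)
  fix t' u' \<sigma> assume "t = (\<lambda>e. eval MM (view \<sigma> e) t')" "u = (\<lambda>e. eval MM (view \<sigma> e) u')"
  then show ?thesis unfolding term_fun_def by (auto intro!: exI[of _ "Add t' u'"] exI[of _ \<sigma>])
qed

lemma term_fun_mult: "term_fun t \<Longrightarrow> term_fun u \<Longrightarrow> term_fun (\<lambda>e. t e * u e)"
proof (erule (1) term_fun_merge)
  fix t' u' \<sigma> assume "t = (\<lambda>e. eval MM (view \<sigma> e) t')" "u = (\<lambda>e. eval MM (view \<sigma> e) u')"
  then show ?thesis unfolding term_fun_def by (auto intro!: exI[of _ "Mul t' u'"] exI[of _ \<sigma>])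
qed

lemma delta0_eq: "term_fun t \<Longrightarrow> term_fun u \<Longrightarrow> delta0 (\<lambda>e. t e = u e)"
proof (erule (1) term_fun_merge)
  fix t' u' \<sigma> assume tu: "t = (\<lambda>e. eval MM (view \<sigma> e) t')" "u = (\<lambda>e. eval MM (view \<sigma> e) u')"
  obtain X where "X \<in> \<S>" using ex_second_order by blast
  then show ?thesis using tu delta0_sat[of "Eql t' u'" "\<lambda>_. X" \<sigma>] by auto
qed

lemma delta0_less: "term_fun t \<Longrightarrow> term_fun u \<Longrightarrow> delta0 (\<lambda>e. t e < u e)"
proof (erule (1) term_fun_merge)
  fix t' u' \<sigma> assume tu: "t = (\<lambda>e. eval MM (view \<sigma> e) t')" "u = (\<lambda>e. eval MM (view \<sigma> e) u')"
  obtain X where "X \<in> \<S>" using ex_second_order by blast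
  then show ?thesis using tu delta0_sat[of "Less t' u'" "\<lambda>_. X" \<sigma>] by auto
qed

lemma delta0_mem: "X \<in> \<S> \<Longrightarrow> term_fun t \<Longrightarrow> delta0 (\<lambda>e. t e \<in> X)"
proof -
  assume "X \<in> \<S>" "term_fun t"
  then obtain t' \<sigma> where "t = (\<lambda>e. eval MM (view \<sigma> e) t')" unfolding term_fun_def by blast
  with \<open>X \<in> \<S>\<close> show ?thesis using delta0_sat[of "Mem t' 0" "\<lambda>_. X" \<sigma>] by auto
qed

lemma delta0_imp: "delta0 P \<Longrightarrow> delta0 Q \<Longrightarrow> delta0 (\<lambda>e. P e \<longrightarrow> Q e)"
proof (erule (1) delta0_merge)
  fix p q \<sigma> s assume "bounded_fm p" "bounded_fm q" "range s \<subseteq> \<S>"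
    "P = (\<lambda>e. sat MM (view \<sigma> e) s p)" "Q = (\<lambda>e. sat MM (view \<sigma> e) s q)"
  then show ?thesis using delta0_sat[of "Imp p q" s \<sigma>] by simp
qed

lemma delta0_False: "delta0 (\<lambda>e. False)"
proof -
  obtain X where "X \<in> \<S>" using ex_second_order by blast
  then show ?thesis using delta0_sat[of "Fls" "\<lambda>_. X"] by auto
qed

lemma delta0_not: "delta0 P \<Longrightarrow> delta0 (\<lambda>e. \<not> P e)"
  using delta0_imp[OF _ delta0_False] by simp

lemma delta0_and: "delta0 P \<Longrightarrow> delta0 Q \<Longrightarrow> delta0 (\<lambda>e. P e \<and> Q e)"
  using delta0_not[OF delta0_imp[OF _ delta0_not, of P Q]] by simp

lemma delta0_or: "delta0 P \<Longrightarrow> delta0 Q \<Longrightarrow> delta0 (\<lambda>e. P e \<or> Q e)"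
  using delta0_imp[OF delta0_not, of P Q] by (simp add: disj_imp)

lemma delta0_le: "term_fun t \<Longrightarrow> term_fun u \<Longrightarrow> delta0 (\<lambda>e. t e \<le> u e)"
  unfolding less_eq_mnat_def by (intro delta0_or delta0_less delta0_eq)

text \<open>\<open>pull\<close> and \<open>pullf\<close> detach the first entry of the environment, so that it can be quantified.\<close>

definition pull :: "(nat \<Rightarrow> mnat + nat) \<Rightarrow> nat \<Rightarrow> mnat + nat" where
  "pull \<sigma> i = (case \<sigma> i of Inl c \<Rightarrow> Inl c | Inr j \<Rightarrow> Inr (j - 1))"

definition pullf :: "(nat \<Rightarrow> mnat + nat) \<Rightarrow> fm \<Rightarrow> fm" where
  "pullf \<sigma> = subn (\<lambda>i. Var (if \<sigma> i = Inr 0 then 0 else Suc i))"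

text \<open>The same detachment below one binder: variable 0 is kept and the detached entry becomes
  variable 1. Two detached entries serve as witness and induction variable.\<close>

definition pullf2 :: "(nat \<Rightarrow> mnat + nat) \<Rightarrow> fm \<Rightarrow> fm" where
  "pullf2 \<sigma> = subn (case_nat (Var 0) (\<lambda>i. Var (if \<sigma> i = Inr 0 then Suc 0 else Suc (Suc i))))"

lemma bounded_fm_pullf [simp]: "bounded_fm p \<Longrightarrow> bounded_fm (pullf \<sigma> p)"
  "bounded_fm p \<Longrightarrow> bounded_fm (pullf2 \<sigma> p)"
  by (simp_all add: pullf_def pullf2_def)

lemma sat_pullf [simp]: "sat M (case_nat x (view (pull \<sigma>) e)) s (pullf \<sigma> p) \<longleftrightarrow> sat M (view \<sigma> (case_nat x e)) s p"
  unfolding pullf_def sat_subn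
  by (rule arg_cong[where f = "\<lambda>e. sat M e s p"], rule ext) (auto simp: view_def pull_def split: nat.split sum.split)

lemma sat_pullf2 [simp]: "sat M (case_nat y (case_nat x (view (pull \<sigma>) e))) s (pullf2 \<sigma> p) \<longleftrightarrow>
  sat M (case_nat y (view \<sigma> (case_nat x e))) s p"
  unfolding pullf2_def sat_subn
  by (rule arg_cong[where f = "\<lambda>e. sat M e s p"], rule ext) (auto simp: view_def pull_def split: nat.split sum.split)

text \<open>Convention for all binders: the bound variable is entry 0 of the environment, and the
  other variables form the shifted remainder passed to \<open>P\<close>.\<close>

lemma delta0_bex:
  assumes "term_fun t" "delta0 (\<lambda>e. P (e 0) (\<lambda>i. e (Suc i)))"
  shows "delta0 (\<lambda>e. \<exists>x<t e. P x e)"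
proof -
  from assms(2) obtain p \<sigma> s where p: "bounded_fm p" "range s \<subseteq> \<S>"
    and P: "\<And>e. P (e 0) (\<lambda>i. e (Suc i)) \<longleftrightarrow> sat MM (view \<sigma> e) s p"
    by (rule delta0E) blast
  from assms(1) obtain u \<tau> where t: "t = (\<lambda>e. eval MM (view \<tau> e) u)" unfolding term_fun_def by blast
  \<comment> \<open>The matrix moves to odd indices and the bounding term to even ones;
    \<open>up\<close> keeps the quantified variable at 0.\<close>
  let ?q = "subn (up (\<lambda>i. Var (Suc (2 * i)))) (subs (\<lambda>i. Suc (2 * i)) (pullf \<sigma> p))"
  have q: "sat MM (case_nat x (mix f (view (pull \<sigma>) e))) (mix r s) ?q \<longleftrightarrow> P x e" for x f e r
    using P[of "case_nat x e"] by (simp add: sat_subn sat_subs eval_up)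
  have "delta0 (\<lambda>e. sat MM (view (mix \<tau> (pull \<sigma>)) e) (mix s s) (Ex (Con (Less (Var 0) (lift (evens u))) ?q)))"
    by (rule delta0_sat) (use p range_mix in simp_all)
  then show ?thesis by (simp add: view_mix q t)
qed

lemma delta0_ball:
  assumes "term_fun t" "delta0 (\<lambda>e. P (e 0) (\<lambda>i. e (Suc i)))"
  shows "delta0 (\<lambda>e. \<forall>x<t e. P x e)"
  using delta0_not[OF delta0_bex[OF assms(1), of "\<lambda>x e. \<not> P x e", OF delta0_not[OF assms(2)]]] by simp

lemma delta0_reindex:
  assumes "delta0 P"
  shows "delta0 (\<lambda>e. P (\<lambda>i. e (\<rho> i)))"
proof -
  obtain p \<sigma> s where p: "bounded_fm p" "range s \<subseteq> \<S>" "P = (\<lambda>e. sat MM (view \<sigma> e) s p)"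
    using assms unfolding delta0_def by blast
  have "view \<sigma> (\<lambda>i. e (\<rho> i)) = view (\<lambda>i. case \<sigma> i of Inl c \<Rightarrow> Inl c | Inr j \<Rightarrow> Inr (\<rho> j)) e" for e
    by (auto simp: view_def fun_eq_iff split: sum.split)
  with p show ?thesis by (auto intro: delta0_sat)
qed

lemmas delta0_intros = delta0_eq delta0_less delta0_le delta0_mem delta0_and delta0_or delta0_imp delta0_not delta0_bex delta0_ball
  term_fun_const term_fun_var term_fun_add term_fun_mult

text \<open>The \<Sigma>_1 induction scheme freed of syntax: \<open>k\<close> is the unbounded
  witness, \<open>x\<close> the induction variable, and \<open>e\<close> holds the remaining
  parameters.\<close>

lemma delta0_witness_induct:
  assumes "delta0 (\<lambda>e. P (e 0) (e 1) (\<lambda>i. e (Suc (Suc i))))"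
    and "\<exists>k. P k 0 e" "\<And>x. \<exists>k. P k x e \<Longrightarrow> \<exists>k. P k (x + 1) e"
  shows "\<exists>k. P k x e"
proof -
  from assms(1) obtain p \<sigma> s where p: "bounded_fm p" "range s \<subseteq> \<S>"
    and P: "\<And>e. P (e 0) (e 1) (\<lambda>i. e (Suc (Suc i))) \<longleftrightarrow> sat MM (view \<sigma> e) s p"
    by (rule delta0E) blast
  let ?p = "pullf2 (pull \<sigma>) (pullf \<sigma> p)"
  have "sat MM (view (pull (pull \<sigma>)) e) s (induction_axiom (Ex ?p))"
    by (rule MM_sat) (use p in \<open>auto simp: RCA0_def Sigma01_def\<close>)
  moreover have "sat MM (case_nat k (case_nat x (view (pull (pull \<sigma>)) e))) s ?p \<longleftrightarrow> P k x e" for k x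
    using P[of "case_nat k (case_nat x e)"] by simp
  ultimately show ?thesis using assms(2,3) by (simp add: sat_induction_axiom)
qed

lemma delta0_induct:
  assumes "delta0 (\<lambda>e. P (e 0))" "P 0" "\<And>x. P x \<Longrightarrow> P (x + 1)"
  shows "P x"
  using delta0_witness_induct[of "\<lambda>k x e. P x" "\<lambda>_. 0" x] delta0_reindex[OF assms(1), of Suc] assms(2,3) by simp

lemma comprehension_in_RCA0:
  "bounded_fm p \<Longrightarrow> bounded_fm q \<Longrightarrow> comprehension_axiom (Ex p) (All q) \<in> RCA0"
  unfolding RCA0_def Sigma01_def Pi01_def by (rule UnI2) blast

lemma comprehension:
  assumes "delta0 (\<lambda>e. P (e 0) (e 1) (\<lambda>i. e (Suc (Suc i))))" "delta0 (\<lambda>e. Q (e 0) (e 1) (\<lambda>i. e (Suc (Suc i))))"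
    and PQ: "\<And>x. (\<exists>k. P k x e) \<longleftrightarrow> (\<forall>k. Q k x e)"
  shows "\<exists>X\<in>\<S>. \<forall>x. x \<in> X \<longleftrightarrow> (\<exists>k. P k x e)"
proof -
  obtain p q \<sigma> s where pq: "bounded_fm p" "bounded_fm q" "range s \<subseteq> \<S>"
    and P: "\<And>e. P (e 0) (e 1) (\<lambda>i. e (Suc (Suc i))) \<longleftrightarrow> sat MM (view \<sigma> e) s p"
    and Q: "\<And>e. Q (e 0) (e 1) (\<lambda>i. e (Suc (Suc i))) \<longleftrightarrow> sat MM (view \<sigma> e) s q"
    by (rule delta0_merge[OF assms(1,2)]) (auto simp: fun_eq_iff)
  let ?f = "\<lambda>p. pullf2 (pull \<sigma>) (pullf \<sigma> p)" and ?e = "view (pull (pull \<sigma>)) e"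
  have "sat MM ?e s (comprehension_axiom (Ex (?f p)) (All (?f q)))"
    by (rule MM_sat) (use pq in \<open>simp_all add: comprehension_in_RCA0\<close>)
  moreover have "sat MM (case_nat k (case_nat x ?e)) s (?f p) \<longleftrightarrow> P k x e" for k x
    using P[of "case_nat k (case_nat x e)"] by simp
  moreover have "sat MM (case_nat k (case_nat x ?e)) s (?f q) \<longleftrightarrow> Q k x e" for k x
    using Q[of "case_nat k (case_nat x e)"] by simp
  ultimately show ?thesis using PQ by (simp add: sat_comprehension_axiom)
qed

section \<open>Arithmetic in the model\<close>

lemma basic_axiom: "p \<in> basic_axioms \<Longrightarrow> \<exists>s. sat MM e s p"
  using ex_second_order MM_sat[of p "\<lambda>_. _" e] unfolding RCA0_def by blast

lemma pa_basic:
  fixes x y :: mnat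
  shows pa1: "x + 1 \<noteq> 0" and pa2: "x + 1 = y + 1 \<Longrightarrow> x = y" and pa3: "x + 0 = x"
    and pa4: "x + (y + 1) = (x + y) + 1" and pa5: "x * 0 = 0" and pa6: "x * (y + 1) = x * y + x"
    and pa7: "\<not> x < 0" and pa8: "x < y + 1 \<longleftrightarrow> x < y \<or> x = y"
proof -
  let ?e = "case_nat x (\<lambda>_. y)" and ?f = "case_nat y (\<lambda>_. x)"
  note b = basic_axioms_def
  show "x + 1 \<noteq> 0" "x + 0 = x" "x * 0 = 0" "\<not> x < 0"
    "x + 1 = y + 1 \<Longrightarrow> x = y" "x + (y + 1) = (x + y) + 1" "x * (y + 1) = x * y + x"
    "x < y + 1 \<longleftrightarrow> x < y \<or> x = y"
    using basic_axiom[of "\<^bold>\<not>(\<sharp>0 \<^bold>+ \<^bold>1 \<^bold>= \<^bold>0)" ?e]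
      basic_axiom[of "\<sharp>1 \<^bold>+ \<^bold>1 \<^bold>= \<sharp>0 \<^bold>+ \<^bold>1 \<^bold>\<longrightarrow> \<sharp>1 \<^bold>= \<sharp>0" ?f]
      basic_axiom[of "\<sharp>0 \<^bold>+ \<^bold>0 \<^bold>= \<sharp>0" ?e]
      basic_axiom[of "\<sharp>1 \<^bold>+ (\<sharp>0 \<^bold>+ \<^bold>1) \<^bold>= (\<sharp>1 \<^bold>+ \<sharp>0) \<^bold>+ \<^bold>1" ?f]
      basic_axiom[of "\<sharp>0 \<^bold>* \<^bold>0 \<^bold>= \<^bold>0" ?e]
      basic_axiom[of "\<sharp>1 \<^bold>* (\<sharp>0 \<^bold>+ \<^bold>1) \<^bold>= (\<sharp>1 \<^bold>* \<sharp>0) \<^bold>+ \<sharp>1" ?f]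
      basic_axiom[of "\<^bold>\<not>(\<sharp>0 \<^bold>< \<^bold>0)" ?e]
      basic_axiom[of "\<sharp>1 \<^bold>< \<sharp>0 \<^bold>+ \<^bold>1 \<^bold>\<longleftrightarrow> (\<sharp>1 \<^bold>< \<sharp>0 \<^bold>\<or> \<sharp>1 \<^bold>= \<sharp>0)" ?f]
    by (simp_all add: b) argo
qed

lemma pa_add_assoc: "(x + y) + z = x + (y + z)" for x y z :: mnat
  by (rule delta0_induct[of "\<lambda>z. (x + y) + z = x + (y + z)"], (intro delta0_intros)[1]) (auto simp: pa3 pa4)

lemma pa_zero_add: "0 + x = x" for x :: mnat
  by (rule delta0_induct[of "\<lambda>z. 0 + z = z"], (intro delta0_intros)[1]) (simp_all add: pa3 pa4)

lemma pa_Suc_add: "(x + 1) + y = (x + y) + 1" for x y :: mnat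
  by (rule delta0_induct[of "\<lambda>z. (x + 1) + z = (x + z) + 1"], (intro delta0_intros)[1]) (simp_all add: pa3 pa4)

lemma pa_add_commute: "x + y = y + x" for x y :: mnat
  by (rule delta0_induct[of "\<lambda>z. x + z = z + x"], (intro delta0_intros)[1]) (simp_all add: pa3 pa4 pa_zero_add pa_Suc_add)

instance mnat :: comm_monoid_add
  by standard (rule pa_add_assoc pa_add_commute pa_zero_add)+

lemma pa_zero_mult: "0 * x = 0" for x :: mnat
  by (rule delta0_induct[of "\<lambda>z. 0 * z = 0"], (intro delta0_intros)[1]) (simp_all add: pa5 pa6)

lemma pa_Suc_mult: "(x + 1) * y = x * y + y" for x y :: mnat
  by (rule delta0_induct[of "\<lambda>z. (x + 1) * z = x * z + z"], (intro delta0_intros)[1]) (simp_all add: pa5 pa6 ac_simps)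

lemma pa_mult_commute: "x * y = y * x" for x y :: mnat
  by (rule delta0_induct[of "\<lambda>z. x * z = z * x"], (intro delta0_intros)[1]) (simp_all add: pa5 pa6 pa_zero_mult pa_Suc_mult)

lemma pa_mult_1: "x * 1 = x" for x :: mnat
  using pa6[of x 0] by (simp add: pa5)

lemma pa_distrib: "x * (y + z) = x * y + x * z" for x y :: mnat
  by (rule delta0_induct[of "\<lambda>z. x * (y + z) = x * y + x * z"], (intro delta0_intros)[1])
     (simp_all add: pa5 pa6 add.assoc[symmetric])

lemma pa_mult_assoc: "(x * y) * z = x * (y * z)" for x y :: mnat
  by (rule delta0_induct[of "\<lambda>z. (x * y) * z = x * (y * z)"], (intro delta0_intros)[1])
     (simp_all add: pa5 pa6 pa_distrib pa_mult_1)

instance mnat :: comm_semiring_1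
proof
  fix a b c :: mnat
  show "1 * a = a" using pa_Suc_mult[of 0 a] by (simp add: pa_zero_mult)
  show "(0::mnat) \<noteq> 1" using pa1[of 0] by simp
  show "(a + b) * c = a * c + b * c" by (simp add: pa_mult_commute[of _ c] pa_distrib)
qed (rule pa_mult_assoc pa_mult_commute pa_zero_mult pa5)+

lemma pa_cancel: "x + z = y + z \<Longrightarrow> x = y" for x y z :: mnat
proof -
  have "x + z = y + z \<longrightarrow> x = y"
  proof (rule delta0_induct[of "\<lambda>z. x + z = y + z \<longrightarrow> x = y"], (intro delta0_intros)[1])
    fix z assume "x + z = y + z \<longrightarrow> x = y"
    then show "x + (z + 1) = y + (z + 1) \<longrightarrow> x = y"
      unfolding pa4 using pa2[of "x + z" "y + z"] by blast
  qed simp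
  then show "x + z = y + z \<Longrightarrow> x = y" by blast
qed

section \<open>Order and subtraction\<close>

lemma zero_or_Suc: "x = 0 \<or> (\<exists>k. x = k + 1)" for x :: mnat
proof -
  have "\<exists>k. x = 0 \<or> x = k + 1"
    by (rule delta0_witness_induct[of "\<lambda>k x e. x = 0 \<or> x = k + 1" "\<lambda>_. 0"], intro delta0_intros) auto
  then show ?thesis by blast
qed

lemma pa_add_eq_0: "x + y = 0 \<Longrightarrow> y = 0" for x y :: mnat
  using zero_or_Suc[of y] pa1 by (auto simp: add.assoc[symmetric])

text \<open>The order is primitive and known only through its behaviour at 0 and at successors; its
  reduction to addition lets the order laws follow from cancellation.\<close>

lemma less_iff_ex: "x < y \<longleftrightarrow> (\<exists>k. y = x + (k + 1))" for x y :: mnat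
proof
  assume "x < y"
  \<comment> \<open>The witness is moved in front of the implication to obtain a \<Sigma>_1
    induction statement.\<close>
  moreover have "\<exists>k. x < y \<longrightarrow> y = x + (k + 1)"
  proof (rule delta0_witness_induct[of "\<lambda>k y e. x < y \<longrightarrow> y = x + (k + 1)" "\<lambda>_. 0"], intro delta0_intros)
    fix y assume "\<exists>k. x < y \<longrightarrow> y = x + (k + 1)"
    then show "\<exists>k. x < y + 1 \<longrightarrow> y + 1 = x + (k + 1)"
      unfolding pa8 by (metis add.assoc add.left_neutral)
  qed (simp add: pa7)
  ultimately show "\<exists>k. y = x + (k + 1)" by blast
next
  assume "\<exists>k. y = x + (k + 1)"
  then obtain k where "y = x + (k + 1)" by blast
  moreover have "x < x + (k + 1)"
    by (rule delta0_induct[of "\<lambda>k. x < x + (k + 1)"], (intro delta0_intros)[1])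
       (simp_all add: pa8 add.assoc[symmetric])
  ultimately show "x < y" by simp
qed

lemma le_iff_ex: "x \<le> y \<longleftrightarrow> (\<exists>k. y = x + k)" for x y :: mnat
  unfolding less_eq_mnat_def less_iff_ex using zero_or_Suc by (metis add.right_neutral)

lemma pa_linear: "x \<le> y \<or> y \<le> x" for x y :: mnat
proof -
  have "\<exists>k. y = x + k \<or> x = y + k"
  proof (rule delta0_witness_induct[of "\<lambda>k y e. y = x + k \<or> x = y + k" "\<lambda>_. 0"], intro delta0_intros)
    fix y assume "\<exists>k. y = x + k \<or> x = y + k"
    then show "\<exists>k. y + 1 = x + k \<or> x = y + 1 + k"
      using zero_or_Suc by (metis add.assoc add.commute add.right_neutral)
  qed (rule exI[of _ x], simp)
  then show ?thesis unfolding le_iff_ex by blast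
qed

lemma pa_antisym: "x \<le> y \<Longrightarrow> y \<le> x \<Longrightarrow> x = y" for x y :: mnat
proof -
  assume "x \<le> y" "y \<le> x"
  then obtain k l where k: "y = x + k" and l: "x = y + l" unfolding le_iff_ex by blast
  then have "(k + l) + x = 0 + x" by (metis add.assoc add.commute add.left_neutral)
  then have "l = 0" using pa_cancel pa_add_eq_0 by blast
  then show "x = y" using l by simp
qed

instance mnat :: linorder
proof
  fix x y z :: mnat
  show "x \<le> x" by (simp add: less_eq_mnat_def)
  show "x \<le> y \<Longrightarrow> y \<le> z \<Longrightarrow> x \<le> z" unfolding le_iff_ex by (metis add.assoc)
  show "x < y \<longleftrightarrow> x \<le> y \<and> \<not> y \<le> x"
  proof
    assume "x < y"
    then obtain k where k: "y = x + (k + 1)" unfolding less_iff_ex by blast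
    have "x \<noteq> y"
    proof
      assume "x = y"
      then have "0 + x = (k + 1) + x" using k by (simp add: add.commute)
      then have "0 = k + 1" by (rule pa_cancel)
      then show False using pa1[of k] by simp
    qed
    with \<open>x < y\<close> show "x \<le> y \<and> \<not> y \<le> x" using pa_antisym[of x y] by (auto simp: less_eq_mnat_def)
  qed (auto simp: less_eq_mnat_def)
qed (use pa_linear pa_antisym in auto)

text \<open>Truncated subtraction with default 0. It is not in the language of arithmetic, but the
  classes of cancellative monoids and ordered semidomains demand it.\<close>

instantiation mnat :: minus
begin
definition "x - y = (if y \<le> x then (THE k. x = y + k) else 0)" for x y :: mnat
instance ..
end

lemma pa_add_diff: "(x + y) - x = y" for x y :: mnat
proof -
  have "(THE k. x + y = x + k) = y" by (rule the_equality) (simp, metis add.commute pa_cancel)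
  then show ?thesis by (auto simp: minus_mnat_def le_iff_ex)
qed

lemma pa_diff_0: "\<not> y \<le> x \<Longrightarrow> x - y = 0" for x y :: mnat
  by (simp add: minus_mnat_def)

lemma pa_zero_diff: "0 - x = 0" for x :: mnat
  using pa7[of x] pa_add_diff[of 0 0] by (cases "x = 0") (auto intro: pa_diff_0 simp: less_eq_mnat_def)

instance mnat :: cancel_comm_monoid_add
proof
  fix a b c :: mnat
  show "a + b - a = b" by (rule pa_add_diff)
  show "a - b - c = a - (b + c)"
  proof (cases "b \<le> a")
    case True
    then obtain d where d: "a = b + d" unfolding le_iff_ex by blast
    show ?thesis
    proof (cases "c \<le> d")
      case True
      then obtain k where k: "d = c + k" unfolding le_iff_ex by blast
      then have "a = (b + c) + k" by (simp add: d add.assoc)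
      then show ?thesis using d k pa_add_diff[of "b + c" k] pa_add_diff[of b d] pa_add_diff[of c k] by simp
    next
      case False
      moreover have "\<not> b + c \<le> b + d"
      proof
        assume "b + c \<le> b + d"
        then obtain k where "b + d = b + (c + k)" unfolding le_iff_ex by (auto simp: add.assoc)
        then have "d = c + k" using pa_cancel[of d b "c + k"] by (simp add: add.commute)
        then show False using False le_iff_ex by blast
      qed
      ultimately show ?thesis by (simp add: d pa_add_diff pa_diff_0)
    qed
  next
    case False
    moreover have "\<not> b + c \<le> a" using False unfolding le_iff_ex by (metis add.assoc)
    ultimately show ?thesis by (simp add: pa_diff_0 pa_zero_diff)
  qed
qed

instance mnat :: linordered_semidom
proof
  fix a b c :: mnat
  show "a * (b - c) = a * b - a * c"
  proof (cases "c \<le> b")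
    case True
    then show ?thesis by (auto simp: le_iff_ex pa_distrib)
  next
    case False
    then have "b \<le> c" by simp
    then obtain k where "c = b + k" unfolding le_iff_ex by blast
    then show ?thesis using False
      by (simp add: pa_diff_0[of c b] pa5)
        (simp add: \<open>c = b + k\<close> pa_distrib diff_diff_add[symmetric] pa_zero_diff)
  qed
  show less: "a < b \<Longrightarrow> 0 < c \<Longrightarrow> c * a < c * b"
    unfolding less_iff_ex
  proof (elim exE)
    fix k l assume "b = a + (k + 1)" "c = 0 + (l + 1)"
    then have "c * b = c * a + ((l * (k + 1) + k) + 1)"
      by (simp add: distrib_left distrib_right add.assoc add.left_commute)
    then show "\<exists>k. c * b = c * a + (k + 1)" by blast
  qed
  show "a \<noteq> 0 \<Longrightarrow> b \<noteq> 0 \<Longrightarrow> a * b \<noteq> 0"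
    using zero_or_Suc[of a] zero_or_Suc[of b] pa1 by (auto simp: pa6 add.assoc[symmetric])
  show "a \<le> b \<Longrightarrow> c + a \<le> c + b" unfolding le_iff_ex by (metis add.assoc)
  show "(0::mnat) < 1" unfolding less_iff_ex by (rule exI[of _ 0]) simp
  show "b \<le> a \<Longrightarrow> a - b + b = a" unfolding le_iff_ex by (auto simp: add.commute pa_add_diff)
qed

instance mnat :: ordered_cancel_comm_monoid_diff
proof
  fix a b c :: mnat
  show "a \<le> b \<longleftrightarrow> (\<exists>c. b = a + c)" by (rule le_iff_ex)
qed (simp_all add: pa_zero_diff)

text \<open>Discreteness of the order, which ordered semidomains in general lack.\<close>

lemma less_add_one_iff: "x < y + 1 \<longleftrightarrow> x \<le> y" for x y :: mnat
  by (simp add: pa8 less_eq_mnat_def)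

lemma add_one_le_iff: "x + 1 \<le> y \<longleftrightarrow> x < y" for x y :: mnat
  by (metis less_add_one_iff not_less)

section \<open>Recursive predicates and functions\<close>

definition sigma1 :: "(env \<Rightarrow> bool) \<Rightarrow> bool" where
  "sigma1 P \<longleftrightarrow> (\<exists>A. delta0 A \<and> P = (\<lambda>e. \<exists>y. A (case_nat y e)))"

definition delta1 :: "(env \<Rightarrow> bool) \<Rightarrow> bool" where
  "delta1 P \<longleftrightarrow> sigma1 P \<and> sigma1 (\<lambda>e. \<not> P e)"

text \<open>A \<Sigma>_1 graph suffices because functions are total: both \<open>P (t e)\<close> and
  its negation can be expressed by an existential over the value \<open>t e\<close>.\<close>

definition delta1_fun :: "(env \<Rightarrow> mnat) \<Rightarrow> bool" where
  "delta1_fun t \<longleftrightarrow> sigma1 (\<lambda>e. e 0 = t (\<lambda>i. e (Suc i)))"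

lemma sigma1I: "delta0 A \<Longrightarrow> (\<And>e. P e \<longleftrightarrow> (\<exists>y. A (case_nat y e))) \<Longrightarrow> sigma1 P"
  unfolding sigma1_def fun_eq_iff by blast

lemma sigma1E:
  assumes "sigma1 P"
  obtains A where "delta0 A" "P = (\<lambda>e. \<exists>y. A (case_nat y e))"
  using assms unfolding sigma1_def by blast

lemma env_case: "(\<lambda>i. (e :: env) (case_nat a \<rho> i)) = case_nat (e a) (\<lambda>i. e (\<rho> i))"
  by (rule case_nat_comp)

lemma env_eta [simp]: "case_nat (e 0) (\<lambda>i. e (Suc i)) = (e :: env)"
  by (auto simp: fun_eq_iff split: nat.split)

lemma delta0_env2: "delta0 A \<Longrightarrow> delta0 (\<lambda>e. A (case_nat (e i) (\<lambda>k. e (\<rho> k))))"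
  using delta0_reindex[of A "case_nat i \<rho>"] by (simp add: env_case)

lemma delta0_env3: "delta0 A \<Longrightarrow> delta0 (\<lambda>e. A (case_nat (e i) (case_nat (e j) (\<lambda>k. e (\<rho> k)))))"
  using delta0_reindex[of A "case_nat i (case_nat j \<rho>)"] by (simp add: env_case)

lemma sigma1_delta0: "delta0 P \<Longrightarrow> sigma1 P"
  by (rule sigma1I[of "\<lambda>e. P (\<lambda>i. e (Suc i))"]) (simp_all add: delta0_reindex)

text \<open>Two unbounded witnesses are contracted to one by quantifying a common bound, which
  avoids coding pairs.\<close>

lemma sigma1_ex:
  assumes "sigma1 (\<lambda>e. P (e 0) (\<lambda>i. e (Suc i)))"
  shows "sigma1 (\<lambda>e. \<exists>x. P x e)"
proof -
  from assms obtain A where A: "delta0 A" and "(\<lambda>e. P (e 0) (\<lambda>i. e (Suc i))) = (\<lambda>e. \<exists>y. A (case_nat y e))"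
    by (rule sigma1E)
  then have P: "P x e \<longleftrightarrow> (\<exists>y. A (case_nat y (case_nat x e)))" for x e
    by (auto dest!: fun_cong[of _ _ "case_nat x e"])
  show ?thesis
  proof (rule sigma1I[of "\<lambda>e. \<exists>x<e 0 + 1. \<exists>y<e 0 + 1. A (case_nat y (case_nat x (\<lambda>i. e (Suc i))))"])
    show "delta0 (\<lambda>e. \<exists>x<e 0 + 1. \<exists>y<e 0 + 1. A (case_nat y (case_nat x (\<lambda>i. e (Suc i)))))"
      by (intro delta0_intros delta0_env3 A)
    show "(\<exists>x. P x e) \<longleftrightarrow> (\<exists>z. \<exists>x<case_nat z e 0 + 1. \<exists>y<case_nat z e 0 + 1.
        A (case_nat y (case_nat x (\<lambda>i. case_nat z e (Suc i)))))" for e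
    proof
      assume "\<exists>x. P x e"
      then obtain x y where "A (case_nat y (case_nat x e))" unfolding P by blast
      then show "\<exists>z. \<exists>x<case_nat z e 0 + 1. \<exists>y<case_nat z e 0 + 1.
        A (case_nat y (case_nat x (\<lambda>i. case_nat z e (Suc i))))"
        by (intro exI[of _ "x + y"] exI[of _ x] exI[of _ y] conjI) (simp_all add: less_add_one_iff)
    qed (auto simp: P)
  qed
qed

lemma sigma1_reindex:
  assumes "sigma1 P"
  shows "sigma1 (\<lambda>e. P (\<lambda>i. e (\<rho> i)))"
proof -
  from assms obtain A where A: "delta0 A" and P: "P = (\<lambda>e. \<exists>y. A (case_nat y e))" by (rule sigma1E)
  show ?thesis
    by (rule sigma1I[of "\<lambda>e. A (case_nat (e 0) (\<lambda>i. e (Suc (\<rho> i))))"], rule delta0_env2[OF A]) (simp add: P)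
qed

lemma sigma1_or:
  assumes "sigma1 P" "sigma1 Q"
  shows "sigma1 (\<lambda>e. P e \<or> Q e)"
proof -
  from assms(1) obtain A where A: "delta0 A" and P: "P = (\<lambda>e. \<exists>y. A (case_nat y e))" by (rule sigma1E)
  from assms(2) obtain B where B: "delta0 B" and Q: "Q = (\<lambda>e. \<exists>y. B (case_nat y e))" by (rule sigma1E)
  show ?thesis by (rule sigma1I[of "\<lambda>e. A e \<or> B e"]) (simp_all add: P Q delta0_or A B ex_disj_distrib)
qed

lemma sigma1_delta0_and:
  assumes "delta0 A" "sigma1 Q"
  shows "sigma1 (\<lambda>e. A e \<and> Q e)"
proof -
  from assms(2) obtain B where B: "delta0 B" and Q: "Q = (\<lambda>e. \<exists>y. B (case_nat y e))" by (rule sigma1E)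
  show ?thesis
    by (rule sigma1I[of "\<lambda>e. A (\<lambda>i. e (Suc i)) \<and> B e"]) (simp_all add: Q delta0_and delta0_reindex assms(1) B)
qed

lemma sigma1_and:
  assumes "sigma1 P" "sigma1 Q"
  shows "sigma1 (\<lambda>e. P e \<and> Q e)"
proof -
  from assms(1) obtain A where A: "delta0 A" and P: "P = (\<lambda>e. \<exists>y. A (case_nat y e))" by (rule sigma1E)
  have "sigma1 (\<lambda>e. \<exists>y. A (case_nat y e) \<and> Q e)"
    by (rule sigma1_ex) (use A assms(2) in \<open>simp add: sigma1_delta0_and sigma1_reindex\<close>)
  then show ?thesis by (simp add: P)
qed

text \<open>\<Sigma>_1 bounding follows from \<Sigma>_1 induction on the length of the initial
  segment, with the bound \<open>b\<close> as witness.\<close>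

lemma delta0_collection:
  assumes A: "delta0 A" and "\<forall>x<t. \<exists>y. A (case_nat y (case_nat x e))"
  shows "\<exists>b. \<forall>x<t. \<exists>y<b. A (case_nat y (case_nat x e))"
proof -
  \<comment> \<open>The guard \<open>x < t\<close> keeps the statement true for every
    \<open>z\<close>, since the induction runs without an upper limit.\<close>
  have "\<exists>b. \<forall>x<z. x < t \<longrightarrow> (\<exists>y<b. A (case_nat y (case_nat x e)))" for z
  proof (rule delta0_witness_induct[of "\<lambda>b z e. \<forall>x<z. x < t \<longrightarrow> (\<exists>y<b. A (case_nat y (case_nat x e)))" e z])
    show "delta0 (\<lambda>e. \<forall>x<e 1. x < t \<longrightarrow> (\<exists>y<e 0. A (case_nat y (case_nat x (\<lambda>i. e (Suc (Suc i)))))))"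
      by (intro delta0_intros delta0_env3 A)
  next
    fix z assume "\<exists>b. \<forall>x<z. x < t \<longrightarrow> (\<exists>y<b. A (case_nat y (case_nat x e)))"
    then obtain b where b: "\<And>x. x < z \<Longrightarrow> x < t \<Longrightarrow> \<exists>y<b. A (case_nat y (case_nat x e))" by blast
    show "\<exists>b. \<forall>x<z + 1. x < t \<longrightarrow> (\<exists>y<b. A (case_nat y (case_nat x e)))"
    proof (cases "z < t")
      case True
      then obtain y where y: "A (case_nat y (case_nat z e))" using assms(2) by blast
      have "\<exists>y'<max b (y + 1). A (case_nat y' (case_nat x e))" if "x < z + 1" "x < t" for x
      proof (cases "x = z")
        case True
        then show ?thesis using y by (intro exI[of _ y]) (auto simp: less_max_iff_disj less_add_one_iff)
      next
        case False
        then have "x < z" using that by (simp add: less_add_one_iff)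
        then show ?thesis using b that by (auto simp: less_max_iff_disj)
      qed
      then show ?thesis by blast
    next
      case False
      then show ?thesis using b by (metis less_add_one_iff order_le_less)
    qed
  qed simp
  then show ?thesis by (metis less_add_one_iff order_less_imp_le)
qed

text \<open>Collection replaces the witnesses under the bounded quantifier by a single bound, which
  becomes the leading existential.\<close>

lemma sigma1_ball_var:
  assumes "sigma1 (\<lambda>e. P (e 0) (\<lambda>i. e (Suc i)))"
  shows "sigma1 (\<lambda>e. \<forall>x<e j. P x e)"
proof -
  from assms obtain A where A: "delta0 A" and "(\<lambda>e. P (e 0) (\<lambda>i. e (Suc i))) = (\<lambda>e. \<exists>y. A (case_nat y e))"
    by (rule sigma1E)
  then have P: "P x e \<longleftrightarrow> (\<exists>y. A (case_nat y (case_nat x e)))" for x e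
    by (auto dest!: fun_cong[of _ _ "case_nat x e"])
  show ?thesis
  proof (rule sigma1I[of "\<lambda>e. \<forall>x<e (Suc j). \<exists>y<e 0. A (case_nat y (case_nat x (\<lambda>i. e (Suc i))))"])
    show "delta0 (\<lambda>e. \<forall>x<e (Suc j). \<exists>y<e 0. A (case_nat y (case_nat x (\<lambda>i. e (Suc i)))))"
      by (intro delta0_intros delta0_env3 A)
    show "(\<forall>x<e j. P x e) \<longleftrightarrow> (\<exists>b. \<forall>x<case_nat b e (Suc j). \<exists>y<case_nat b e 0.
        A (case_nat y (case_nat x (\<lambda>i. case_nat b e (Suc i)))))" for e
      using delta0_collection[OF A, of "e j" e] by (auto simp: P)
  qed
qed

lemma sigma1_subst: "delta1_fun t \<Longrightarrow> sigma1 (\<lambda>e. P (e 0) (\<lambda>i. e (Suc i))) \<Longrightarrow> sigma1 (\<lambda>e. P (t e) e)"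
  using sigma1_ex[of "\<lambda>v e. v = t e \<and> P v e"] sigma1_and by (simp add: delta1_fun_def)

lemma sigma1_ball:
  assumes "delta1_fun t" "sigma1 (\<lambda>e. P (e 0) (\<lambda>i. e (Suc i)))"
  shows "sigma1 (\<lambda>e. \<forall>x<t e. P x e)"
proof (rule sigma1_subst[OF assms(1), of "\<lambda>v e. \<forall>x<v. P x e"])
  have "sigma1 (\<lambda>e. P (e 0) (\<lambda>i. e (Suc (Suc i))))"
    using sigma1_reindex[OF assms(2), of "case_nat 0 (\<lambda>i. Suc (Suc i))"] by simp
  then show "sigma1 (\<lambda>e. \<forall>x<e 0. P x (\<lambda>i. e (Suc i)))" by (rule sigma1_ball_var)
qed

section \<open>Closure properties of recursive predicates and functions\<close>

lemma delta1_delta0: "delta0 P \<Longrightarrow> delta1 P"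
  by (simp add: delta1_def sigma1_delta0 delta0_not)

lemma delta1_sigma1: "delta1 P \<Longrightarrow> sigma1 P"
  by (simp add: delta1_def)

lemma delta1_not: "delta1 P \<Longrightarrow> delta1 (\<lambda>e. \<not> P e)"
  by (simp add: delta1_def)

lemma delta1_and: "delta1 P \<Longrightarrow> delta1 Q \<Longrightarrow> delta1 (\<lambda>e. P e \<and> Q e)"
  unfolding delta1_def de_Morgan_conj de_Morgan_disj by (elim conjE) (intro conjI sigma1_and sigma1_or)

lemma delta1_or: "delta1 P \<Longrightarrow> delta1 Q \<Longrightarrow> delta1 (\<lambda>e. P e \<or> Q e)"
  unfolding delta1_def de_Morgan_conj de_Morgan_disj by (elim conjE) (intro conjI sigma1_and sigma1_or)

lemma delta1_imp: "delta1 P \<Longrightarrow> delta1 Q \<Longrightarrow> delta1 (\<lambda>e. P e \<longrightarrow> Q e)"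
  unfolding imp_conv_disj by (intro delta1_or delta1_not)

lemma delta1_subst: "delta1_fun t \<Longrightarrow> delta1 (\<lambda>e. P (e 0) (\<lambda>i. e (Suc i))) \<Longrightarrow> delta1 (\<lambda>e. P (t e) e)"
  unfolding delta1_def by (elim conjE, intro conjI sigma1_subst[of t P] sigma1_subst[of t "\<lambda>v e. \<not> P v e"])

lemma delta1_reindex: "delta1 P \<Longrightarrow> delta1 (\<lambda>e. P (\<lambda>i. e (\<rho> i)))"
  unfolding delta1_def by (elim conjE, rule conjI, erule sigma1_reindex[of P], erule sigma1_reindex[of "\<lambda>e. \<not> P e"])

lemma delta1_fun_reindex: "delta1_fun t \<Longrightarrow> delta1_fun (\<lambda>e. t (\<lambda>i. e (\<rho> i)))"
  unfolding delta1_fun_def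
  using sigma1_reindex[of "\<lambda>e. e 0 = t (\<lambda>i. e (Suc i))" "case_nat 0 (\<lambda>i. Suc (\<rho> i))"] by simp

lemma delta1_fun_term_fun: "term_fun t \<Longrightarrow> term_fun (\<lambda>e. t (\<lambda>i. e (Suc i))) \<Longrightarrow> delta1_fun t"
  unfolding delta1_fun_def by (intro sigma1_delta0 delta0_eq term_fun_var)

lemma delta1_fun_const: "delta1_fun (\<lambda>e. c)"
  by (intro delta1_fun_term_fun term_fun_const)

lemma delta1_fun_var: "delta1_fun (\<lambda>e. e j)"
  by (intro delta1_fun_term_fun term_fun_var)

lemma delta1_subst1: "delta1 (\<lambda>e. P (e 0)) \<Longrightarrow> delta1_fun t \<Longrightarrow> delta1 (\<lambda>e. P (t e))"
  by (rule delta1_subst)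

lemma delta1_subst2:
  assumes "delta1 (\<lambda>e. P (e 0) (e 1))" "delta1_fun t" "delta1_fun u"
  shows "delta1 (\<lambda>e. P (t e) (u e))"
proof (rule delta1_subst[OF assms(2), of "\<lambda>v e. P v (u e)"])
  show "delta1 (\<lambda>e. P (e 0) (u (\<lambda>i. e (Suc i))))"
    by (rule delta1_subst[of _ "\<lambda>v e. P (e 0) v"], rule delta1_fun_reindex[OF assms(3)])
       (use delta1_reindex[OF assms(1), of "case_nat 1 (\<lambda>_. 0)"] in simp)
qed

lemma delta1_fun_comp1:
  assumes "delta1_fun (\<lambda>e. f (e 0))" "delta1_fun t"
  shows "delta1_fun (\<lambda>e. f (t e))"
  unfolding delta1_fun_def
  by (rule sigma1_subst[of "\<lambda>e. t (\<lambda>i. e (Suc i))" "\<lambda>v e. e 0 = f v"], rule delta1_fun_reindex[OF assms(2)])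
     (use sigma1_reindex[OF assms(1)[unfolded delta1_fun_def], of "case_nat 1 (\<lambda>_. 0)"] in simp)

lemma delta1_fun_comp2:
  assumes "delta1_fun (\<lambda>e. f (e 0) (e 1))" "delta1_fun t" "delta1_fun u"
  shows "delta1_fun (\<lambda>e. f (t e) (u e))"
  unfolding delta1_fun_def
proof (rule sigma1_subst[of "\<lambda>e. t (\<lambda>i. e (Suc i))" "\<lambda>v e. e 0 = f v (u (\<lambda>i. e (Suc i)))"], rule delta1_fun_reindex[OF assms(2)])
  show "sigma1 (\<lambda>e. e (Suc 0) = f (e 0) (u (\<lambda>i. e (Suc (Suc i)))))"
    by (rule sigma1_subst[of "\<lambda>e. u (\<lambda>i. e (Suc (Suc i)))" "\<lambda>v e. e 1 = f (e 0) v", simplified], rule delta1_fun_reindex[OF assms(3)])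
       (use sigma1_reindex[OF assms(1)[unfolded delta1_fun_def], of "case_nat (Suc (Suc 0)) (case_nat 1 (\<lambda>_. 0))"] in simp)
qed

lemma delta1_fun_add: "delta1_fun t \<Longrightarrow> delta1_fun u \<Longrightarrow> delta1_fun (\<lambda>e. t e + u e)"
  by (rule delta1_fun_comp2[of "(+)"], intro delta1_fun_term_fun term_fun_add term_fun_var)

lemma delta1_fun_mult: "delta1_fun t \<Longrightarrow> delta1_fun u \<Longrightarrow> delta1_fun (\<lambda>e. t e * u e)"
  by (rule delta1_fun_comp2[of "(*)"], intro delta1_fun_term_fun term_fun_mult term_fun_var)

lemma delta1_eq: "delta1_fun t \<Longrightarrow> delta1_fun u \<Longrightarrow> delta1 (\<lambda>e. t e = u e)"
  by (rule delta1_subst2[of "(=)"], intro delta1_delta0 delta0_eq term_fun_var)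

lemma delta1_less: "delta1_fun t \<Longrightarrow> delta1_fun u \<Longrightarrow> delta1 (\<lambda>e. t e < u e)"
  by (rule delta1_subst2[of "(<)"], intro delta1_delta0 delta0_less term_fun_var)

lemma delta1_le: "delta1_fun t \<Longrightarrow> delta1_fun u \<Longrightarrow> delta1 (\<lambda>e. t e \<le> u e)"
  by (rule delta1_subst2[of "(\<le>)"], intro delta1_delta0 delta0_le term_fun_var)

lemma delta1_mem: "X \<in> \<S> \<Longrightarrow> delta1_fun t \<Longrightarrow> delta1 (\<lambda>e. t e \<in> X)"
  by (rule delta1_subst1[of "\<lambda>x. x \<in> X"], intro delta1_delta0 delta0_mem term_fun_var)

lemma delta1_const: "delta1 (\<lambda>e. b)"
  using delta1_delta0[OF delta0_False] delta1_not[OF delta1_delta0[OF delta0_False]] by (cases b) simp_all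

lemma delta1_ball:
  assumes "delta1_fun t" "delta1 (\<lambda>e. P (e 0) (\<lambda>i. e (Suc i)))"
  shows "delta1 (\<lambda>e. \<forall>x<t e. P x e)"
proof -
  have "sigma1 (\<lambda>e. \<exists>x. x < t e \<and> \<not> P x e)"
    by (rule sigma1_ex, rule sigma1_and, rule delta1_sigma1, rule delta1_less[OF delta1_fun_var delta1_fun_reindex[OF assms(1)]])
       (use assms(2) in \<open>simp add: delta1_def\<close>)
  then show ?thesis using sigma1_ball[of t P] assms unfolding delta1_def by simp
qed

lemma delta1_bex: "delta1_fun t \<Longrightarrow> delta1 (\<lambda>e. P (e 0) (\<lambda>i. e (Suc i))) \<Longrightarrow> delta1 (\<lambda>e. \<exists>x<t e. P x e)"
  using delta1_not[OF delta1_ball[of t "\<lambda>x e. \<not> P x e"]] delta1_not by simp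

lemma delta1_ball_le: "delta1_fun t \<Longrightarrow> delta1 (\<lambda>e. P (e 0) (\<lambda>i. e (Suc i))) \<Longrightarrow> delta1 (\<lambda>e. \<forall>x\<le>t e. P x e)"
  unfolding less_add_one_iff[symmetric] by (intro delta1_ball delta1_fun_add delta1_fun_const)

lemma delta1_bex_le: "delta1_fun t \<Longrightarrow> delta1 (\<lambda>e. P (e 0) (\<lambda>i. e (Suc i))) \<Longrightarrow> delta1 (\<lambda>e. \<exists>x\<le>t e. P x e)"
  unfolding less_add_one_iff[symmetric] by (intro delta1_bex delta1_fun_add delta1_fun_const)

lemma delta1_fun_graph: "delta1 (\<lambda>e. e 0 = t (\<lambda>i. e (Suc i))) \<Longrightarrow> delta1_fun t"
  by (simp add: delta1_def delta1_fun_def)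

lemma delta1_fun_if:
  assumes "delta1 P" "delta1_fun t" "delta1_fun u"
  shows "delta1_fun (\<lambda>e. if P e then t e else u e)"
proof (rule delta1_fun_graph)
  have "delta1 (\<lambda>e. P (\<lambda>i. e (Suc i)) \<and> e 0 = t (\<lambda>i. e (Suc i)) \<or> \<not> P (\<lambda>i. e (Suc i)) \<and> e 0 = u (\<lambda>i. e (Suc i)))"
    by (intro delta1_and delta1_or delta1_not delta1_eq delta1_fun_var delta1_fun_reindex[OF assms(2)] delta1_fun_reindex[OF assms(3)] delta1_reindex[OF assms(1)])
  then show "delta1 (\<lambda>e. e 0 = (if P (\<lambda>i. e (Suc i)) then t (\<lambda>i. e (Suc i)) else u (\<lambda>i. e (Suc i))))"
    by (rule back_subst[of delta1]) auto
qed

lemmas rec_intros = delta1_const delta1_eq delta1_less delta1_le delta1_mem delta1_and delta1_or delta1_imp delta1_not delta1_bex delta1_ball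
  delta1_bex_le delta1_ball_le delta1_fun_const delta1_fun_var delta1_fun_add delta1_fun_mult delta1_fun_if

lemma sigma1_induct:
  assumes "sigma1 (\<lambda>e. P (e 0))" "P 0" "\<And>x. P x \<Longrightarrow> P (x + 1)"
  shows "P x"
proof -
  from assms(1) obtain A where A: "delta0 A" and "(\<lambda>e. P (e 0)) = (\<lambda>e. \<exists>y. A (case_nat y e))" by (rule sigma1E)
  then have P: "P x \<longleftrightarrow> (\<exists>y. A (case_nat y (case_nat x (\<lambda>_. 0))))" for x
    by (auto dest!: fun_cong[of _ _ "case_nat x (\<lambda>_. 0)"])
  have "\<exists>y. A (case_nat y (case_nat x (\<lambda>_. 0)))"
    by (rule delta0_witness_induct[of "\<lambda>y x e. A (case_nat y (case_nat x e))"])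
       (use assms(2,3) delta0_env3[OF A] in \<open>simp_all add: P\<close>)
  then show ?thesis using P by blast
qed

lemmas delta1_induct = sigma1_induct[OF delta1_sigma1]

lemma delta1_comprehension:
  assumes "delta1 (\<lambda>e. P (e 0))"
  shows "Collect P \<in> \<S>"
proof -
  from assms obtain A where A: "delta0 A" and "(\<lambda>e. P (e 0)) = (\<lambda>e. \<exists>y. A (case_nat y e))"
    unfolding delta1_def by (blast elim: sigma1E)
  then have P: "P x \<longleftrightarrow> (\<exists>y. A (case_nat y (case_nat x (\<lambda>_. 0))))" for x
    by (auto dest!: fun_cong[of _ _ "case_nat x (\<lambda>_. 0)"])
  from assms obtain B where B: "delta0 B" and "(\<lambda>e. \<not> P (e 0)) = (\<lambda>e. \<exists>y. B (case_nat y e))"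
    unfolding delta1_def by (blast elim: sigma1E)
  then have notP: "\<not> P x \<longleftrightarrow> (\<exists>y. B (case_nat y (case_nat x (\<lambda>_. 0))))" for x
    by (auto dest!: fun_cong[of _ _ "case_nat x (\<lambda>_. 0)"])
  have "\<exists>X\<in>\<S>. \<forall>x. x \<in> X \<longleftrightarrow> (\<exists>y. A (case_nat y (case_nat x (\<lambda>_. 0))))"
    by (rule comprehension[of "\<lambda>y x e. A (case_nat y (case_nat x e))" "\<lambda>y x e. \<not> B (case_nat y (case_nat x e))"])
       (rule delta0_env3[OF A], rule delta0_not, rule delta0_env3[OF B], metis P notP)
  then obtain X where "X \<in> \<S>" and X: "\<And>x. x \<in> X \<longleftrightarrow> P x" using P by blast
  moreover have "X = Collect P" using X by auto
  ultimately show ?thesis by simp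
qed

section \<open>Pairing, and functions coded as sets\<close>

definition prd :: "mnat \<Rightarrow> mnat \<Rightarrow> mnat" where
  "prd x y = (x + y) * (x + y) + x"

lemma le_mult_self: "x \<le> x * x" for x :: mnat
proof (cases "x = 0")
  case False
  then have "1 \<le> x" by (metis add_0 add_one_le_iff not_gr_zero)
  then show ?thesis using mult_left_mono[of 1 x x] by simp
qed simp

lemma prd_le1: "x \<le> prd x y" and prd_le2: "y \<le> prd x y"
proof -
  show "x \<le> prd x y" by (simp add: prd_def)
  have "y \<le> (x + y)" by simp
  also have "\<dots> \<le> (x + y) * (x + y)" by (rule le_mult_self)
  also have "\<dots> \<le> prd x y" by (simp add: prd_def)
  finally show "y \<le> prd x y" .
qed

text \<open>The value \<open>prd x y\<close> stays below the square of \<open>x + y + 1\<close>, so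
  the sum of the components is decided before the components themselves.\<close>

lemma prd_less: "x + y < u + v \<Longrightarrow> prd x y < prd u v"
proof -
  assume "x + y < u + v"
  then have "x + y + 1 \<le> u + v" by (simp add: add_one_le_iff)
  then have "(x + y + 1) * (x + y + 1) \<le> (u + v) * (u + v)" by (intro mult_mono) auto
  moreover have "(x + y + 1) * (x + y + 1) = prd x y + (x + y + y + 1)"
    by (simp add: prd_def algebra_simps)
  moreover have "\<dots> > prd x y" by (simp add: add_pos_nonneg add_nonneg_pos)
  moreover have "(u + v) * (u + v) \<le> prd u v" by (simp add: prd_def)
  ultimately show ?thesis by order
qed

lemma prd_inject [simp]: "prd x y = prd u v \<longleftrightarrow> x = u \<and> y = v"
proof
  assume eq: "prd x y = prd u v"
  then have "x + y = u + v" using prd_less[of x y u v] prd_less[of u v x y] by (metis less_irrefl linorder_neqE)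
  then show "x = u \<and> y = v" using eq by (auto simp: prd_def)
qed simp

lemma delta1_fun_prd: "delta1_fun t \<Longrightarrow> delta1_fun u \<Longrightarrow> delta1_fun (\<lambda>e. prd (t e) (u e))"
  unfolding prd_def by (intro rec_intros)

lemmas rec_intros' = rec_intros delta1_fun_prd

text \<open>The bound \<open>x \<le> z\<close> loses nothing because \<open>x \<le> prd x y\<close>,
  and it keeps the definition \<Delta>_1.\<close>

definition graph :: "(mnat \<Rightarrow> mnat) \<Rightarrow> mnat set" where
  "graph f = {z. \<exists>x\<le>z. z = prd x (f x)}"

abbreviation recf :: "(mnat \<Rightarrow> mnat) \<Rightarrow> bool" where
  "recf f \<equiv> delta1_fun (\<lambda>e. f (e 0))"

lemma prd_graph [simp]: "prd x y \<in> graph f \<longleftrightarrow> y = f x"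
  by (auto simp: graph_def prd_le1)

lemma graph_second_order:
  assumes "recf f"
  shows "graph f \<in> \<S>"
  unfolding graph_def by (intro delta1_comprehension rec_intros' delta1_fun_comp1[OF assms])

definition functional :: "mnat set \<Rightarrow> bool" where
  "functional F \<longleftrightarrow> (\<forall>z\<in>F. \<exists>x y. z = prd x y) \<and> (\<forall>x. \<exists>y. prd x y \<in> F \<and> (\<forall>z. prd x z \<in> F \<longrightarrow> z = y))"

lemma functional_graph [simp]: "functional (graph f)"
  by (auto simp: functional_def) (auto simp: graph_def)

text \<open>With \<open>graph_second_order\<close>, the functions coded by sets of the model are
  exactly those satisfying \<open>recf\<close>; formulas about maps thus become statements about
  functions.\<close>

lemma functionalE:
  assumes "functional F" "F \<in> \<S>"
  obtains f where "recf f" "F = graph f"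
proof -
  obtain f where "\<forall>x. prd x (f x) \<in> F \<and> (\<forall>z. prd x z \<in> F \<longrightarrow> z = f x)"
    using assms(1) unfolding functional_def by metis
  then have f: "prd x y \<in> F \<longleftrightarrow> y = f x" for x y by blast
  have "F = graph f"
  proof (intro set_eqI iffI)
    fix z assume "z \<in> F"
    then obtain x y where "z = prd x y" using assms(1) unfolding functional_def by blast
    then show "z \<in> graph f" using \<open>z \<in> F\<close> f by simp
  qed (auto simp: graph_def f)
  moreover have "delta1 (\<lambda>e. prd (e 1) (e 0) \<in> F)" by (intro rec_intros' assms(2))
  then have "recf f" by (intro delta1_fun_graph) (simp add: f)
  ultimately show thesis by (rule that[rotated])
qed

section \<open>Exponentiation and recursion\<close>

locale exponential =
  fixes E :: "mnat \<Rightarrow> mnat"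
  assumes rec_E: "recf E" and E_0 [simp]: "E 0 = 1" and E_Suc: "E (x + 1) = 2 * E x"
begin

lemmas delta1_fun_E = delta1_fun_comp1[OF rec_E]

lemma E_pos [simp]: "0 < E x"
  by (rule delta1_induct[of "\<lambda>x. 0 < E x"], (intro rec_intros delta1_fun_E)[1]) (simp_all add: E_Suc)

lemma E_add: "E (x + y) = E x * E y"
  by (rule delta1_induct[of "\<lambda>y. E (x + y) = E x * E y"], (intro rec_intros delta1_fun_E)[1])
     (simp_all add: E_Suc add.assoc[symmetric] mult.left_commute)

lemma E_greater: "x < E x"
proof (rule delta1_induct[of "\<lambda>x. x < E x"], (intro rec_intros delta1_fun_E)[1])
  fix x assume "x < E x"
  then have "x + 1 \<le> E x" by (simp add: add_one_le_iff)
  also have "\<dots> < 2 * E x" by (simp add: mult_2)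
  finally show "x + 1 < E (x + 1)" by (simp add: E_Suc)
qed simp

lemma E_less_dvd:
  assumes "x < y"
  obtains b where "E y = b * (2 * E x)" "0 < b"
proof -
  from assms obtain k where "y = x + 1 + k" using less_iff_ex by (metis add.assoc add.commute)
  then have "E y = E k * (2 * E x)" using E_Suc[of 0] by (simp add: E_add mult.commute)
  then show thesis by (rule that) simp
qed

lemma pos_mult_le: "0 < b \<Longrightarrow> x \<le> b * x" for x b :: mnat
  using mult_right_mono[of 1 b x] by (simp add: add_one_le_iff[of 0, simplified])

lemma E_less: "x < y \<Longrightarrow> 2 * E x \<le> E y"
  by (metis E_less_dvd pos_mult_le)

text \<open>Digit \<open>j\<close> in base 2: \<open>u\<close> collects the digits above position
  \<open>j\<close> and \<open>v\<close> those below. A number thereby codes the finite set of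
  positions of its ones.\<close>

definition bit :: "mnat \<Rightarrow> mnat \<Rightarrow> bool" where
  "bit j s \<longleftrightarrow> (\<exists>u\<le>s. \<exists>v<E j. s = u * (2 * E j) + E j + v)"

lemma delta1_bit: "delta1_fun t \<Longrightarrow> delta1_fun u \<Longrightarrow> delta1 (\<lambda>e. bit (t e) (u e))"
  by (rule delta1_subst2[of bit], unfold bit_def, (intro rec_intros delta1_fun_E)[1])

lemma bitI: "v < E j \<Longrightarrow> s = u * (2 * E j) + E j + v \<Longrightarrow> bit j s"
proof -
  assume v: "v < E j" and s: "s = u * (2 * E j) + E j + v"
  have "u \<le> (2 * E j) * u" by (rule pos_mult_le) simp
  also have "\<dots> \<le> s" by (simp add: s mult.commute add.assoc)
  finally show ?thesis unfolding bit_def using v s by blast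
qed

lemma bit_le: "bit j s \<Longrightarrow> E j \<le> s"
  unfolding bit_def by (auto simp: add.assoc add.left_commute)

lemma bit_less: "bit j s \<Longrightarrow> j < s"
  using bit_le E_greater by (metis less_le_trans)

lemma bit_0 [simp]: "\<not> bit j 0"
  using bit_less[of j 0] by auto

text \<open>Inserting an element means adding a power of two; there is no carry because
  \<open>k\<close> exceeds every position present.\<close>

lemma bit_adjoin:
  assumes "s < E k"
  shows "bit j (s + E k) \<longleftrightarrow> bit j s \<or> j = k"
proof -
  consider "j < k" | "j = k" | "k < j" by (rule linorder_cases)
  then show ?thesis
  proof cases
    case 1
    then obtain b where b: "E k = b * (2 * E j)" by (rule E_less_dvd)
    have "bit j (s + E k) \<longleftrightarrow> bit j s"
    proof
      assume "bit j s"
      then obtain u v where v: "v < E j" and s: "s = u * (2 * E j) + E j + v" unfolding bit_def by blast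
      have "s + E k = (u + b) * (2 * E j) + E j + v" by (simp add: s b algebra_simps)
      then show "bit j (s + E k)" by (rule bitI[OF v])
    next
      assume "bit j (s + E k)"
      then obtain u v where v: "v < E j" and s: "s + E k = u * (2 * E j) + E j + v" unfolding bit_def by blast
      \<comment> \<open>The higher digits \<open>u\<close> must contain the contribution
        \<open>b\<close> of \<open>E k\<close>; subtracting it leaves an expansion of
        \<open>s\<close> with the same digit \<open>j\<close>.\<close>
      have "b \<le> u"
      proof (rule ccontr)
        assume "\<not> b \<le> u"
        then have "u + 1 \<le> b" by (simp add: add_one_le_iff)
        then have "(u + 1) * (2 * E j) \<le> b * (2 * E j)" by (rule mult_right_mono) simp
        also have "\<dots> \<le> s + E k" by (simp add: b)
        also have "\<dots> < (u + 1) * (2 * E j)" unfolding s using v by (simp add: distrib_right mult_2 add.assoc)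
        finally show False by simp
      qed
      then obtain w where "u = b + w" using le_iff_ex by blast
      then have "u * (2 * E j) + E j + v = (w * (2 * E j) + E j + v) + E k" by (simp add: b algebra_simps)
      then have "s + E k = (w * (2 * E j) + E j + v) + E k" by (simp only: s)
      then show "bit j s" by (intro bitI[OF v]) simp
    qed
    then show ?thesis using 1 by auto
  next
    case 2
    then show ?thesis using assms bitI[of s k "s + E k" 0] by (simp add: add.commute)
  next
    case 3
    have "s + E k < 2 * E k" using assms by (simp add: mult_2)
    also have "\<dots> \<le> E j" using 3 by (rule E_less)
    finally have "s + E k < E j" .
    moreover have "s \<le> s + E k" by simp
    ultimately have "\<not> E j \<le> s" "\<not> E j \<le> s + E k" by order+
    then show ?thesis using 3 bit_le by auto
  qed
qed

text \<open>Since steps never decrease, each new pair has a larger code than the previous one, so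
  computations are coded by repeated use of \<open>bit_adjoin\<close>.\<close>

lemma inflationary_recursion:
  fixes g :: "mnat \<Rightarrow> mnat \<Rightarrow> mnat"
  assumes g: "delta1_fun (\<lambda>e. g (e 0) (e 1))" and le: "\<And>n y. y \<le> g n y"
  obtains f where "recf f" "f 0 = a" "\<And>n. f (n + 1) = g n (f n)"
proof -
  \<comment> \<open>\<open>s\<close> codes a finite set of pairs each of which is justified by a predecessor in the set\<close>
  define C where "C s \<longleftrightarrow> (\<forall>k<s. bit k s \<longrightarrow> k = prd 0 a \<or>
    (\<exists>n\<le>k. \<exists>y\<le>k. k = prd (n + 1) (g n y) \<and> bit (prd n y) s))" for s
  have "delta1 (\<lambda>e. C (e 0))" unfolding C_def
    by (intro rec_intros' delta1_bit delta1_fun_comp2[OF g])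
  note delta1_C = delta1_subst1[of C, OF this]
  have C0: "y = a" if "C s" "bit (prd 0 y) s" for s y
    using that bit_less[OF that(2)] unfolding C_def by auto
  have C1: "\<exists>x. y = g n x \<and> bit (prd n x) s" if "C s" "bit (prd (n + 1) y) s" for s n y
    using that bit_less[OF that(2)] pa1 unfolding C_def by fastforce
  \<comment> \<open>\<open>s < 2 * E (prd n y)\<close> makes the latest pair the top digit and
    leaves room for the next one; \<open>y < s\<close> provides the bound of a quantifier.\<close>
  have ex: "\<exists>s. C s \<and> (\<exists>y<s. bit (prd n y) s \<and> s < 2 * E (prd n y))" for n
  proof (rule sigma1_induct[of "\<lambda>n. \<exists>s. C s \<and> (\<exists>y<s. bit (prd n y) s \<and> s < 2 * E (prd n y))"])
    show "sigma1 (\<lambda>e. \<exists>s. C s \<and> (\<exists>y<s. bit (prd (e 0) y) s \<and> s < 2 * E (prd (e 0) y)))"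
      by (intro sigma1_ex delta1_sigma1 rec_intros' delta1_bit delta1_fun_E delta1_C)
  next
    let ?s = "E (prd 0 a)"
    have b: "bit k ?s \<longleftrightarrow> k = prd 0 a" for k using bit_adjoin[of 0 "prd 0 a" k] by simp
    then have "C ?s" unfolding C_def by blast
    moreover have "a < ?s" using bit_less[of "prd 0 a" ?s] b prd_le2[of a 0] by (simp add: order_le_less_trans)
    ultimately show "\<exists>s. C s \<and> (\<exists>y<s. bit (prd 0 y) s \<and> s < 2 * E (prd 0 y))"
      using b by (intro exI[of _ ?s] conjI exI[of _ a]) (simp_all add: mult_2)
  next
    fix n assume "\<exists>s. C s \<and> (\<exists>y<s. bit (prd n y) s \<and> s < 2 * E (prd n y))"
    then obtain s y where C: "C s" and y: "bit (prd n y) s" "s < 2 * E (prd n y)" by blast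
    let ?z = "g n y"
    let ?k = "prd (n + 1) ?z" and ?s = "s + E (prd (n + 1) (g n y))"
    have "n + y < n + 1 + ?z" using le[of y n] by (simp add: add_strict_increasing add.assoc add_pos_nonneg)
    then have less: "prd n y < ?k" by (rule prd_less)
    have "s < E ?k" using y(2) E_less[OF less] by order
    then have b: "bit j ?s \<longleftrightarrow> bit j s \<or> j = ?k" for j by (rule bit_adjoin)
    have "C ?s" unfolding C_def
    proof (intro allI impI)
      fix k assume "bit k ?s"
      then consider "k = ?k" | "bit k s" using b by blast
      then show "k = prd 0 a \<or> (\<exists>n\<le>k. \<exists>y\<le>k. k = prd (n + 1) (g n y) \<and> bit (prd n y) ?s)"
      proof cases
        case 1
        have "n \<le> k" using prd_le1[of "n + 1" ?z] 1 by (meson add_increasing2 order_trans zero_le_one le_add_same_cancel1)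
        moreover have "y \<le> k" using prd_le2[of ?z "n + 1"] le[of y n] 1 by order
        ultimately show ?thesis using 1 y(1) b by blast
      next
        case 2
        then show ?thesis using C bit_less b unfolding C_def by blast
      qed
    qed
    moreover have "?k < ?s" using b bit_less by blast
    then have "?z < ?s" using prd_le2[of ?z "n + 1"] by order
    moreover have "?s < 2 * E ?k" using \<open>s < E ?k\<close> by (simp add: mult_2)
    ultimately show "\<exists>s. C s \<and> (\<exists>y<s. bit (prd (n + 1) y) s \<and> s < 2 * E (prd (n + 1) y))"
      using b by blast
  qed
  \<comment> \<open>Values lie below the codes containing them, so agreement of two computations has
    bounded quantifiers and is open to \<Delta>_1 induction.\<close>
  have unique: "\<forall>y<s. \<forall>z<t. bit (prd n y) s \<longrightarrow> bit (prd n z) t \<longrightarrow> y = z" if st: "C s" "C t" for s t n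
  proof (rule delta1_induct[of "\<lambda>n. \<forall>y<s. \<forall>z<t. bit (prd n y) s \<longrightarrow> bit (prd n z) t \<longrightarrow> y = z"])
    show "delta1 (\<lambda>e. \<forall>y<s. \<forall>z<t. bit (prd (e 0) y) s \<longrightarrow> bit (prd (e 0) z) t \<longrightarrow> y = z)"
      by (intro rec_intros' delta1_bit)
    show "\<forall>y<s. \<forall>z<t. bit (prd 0 y) s \<longrightarrow> bit (prd 0 z) t \<longrightarrow> y = z"
      using C0 that by blast
    fix n assume IH: "\<forall>y<s. \<forall>z<t. bit (prd n y) s \<longrightarrow> bit (prd n z) t \<longrightarrow> y = z"
    show "\<forall>y<s. \<forall>z<t. bit (prd (n + 1) y) s \<longrightarrow> bit (prd (n + 1) z) t \<longrightarrow> y = z"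
    proof (intro allI impI)
      fix y z assume "bit (prd (n + 1) y) s" "bit (prd (n + 1) z) t"
      then obtain x w where xw: "y = g n x" "z = g n w" and b: "bit (prd n x) s" "bit (prd n w) t"
        using C1 st by blast
      then have "x < s" "w < t" using bit_less prd_le2 by (meson order_le_less_trans)+
      then show "y = z" using IH b xw by blast
    qed
  qed
  have unique': "y = z" if "C s" "C t" "bit (prd n y) s" "bit (prd n z) t" for s t n y z
    using unique[OF that(1,2)] that(3,4) bit_less prd_le2 by (meson order_le_less_trans)
  \<comment> \<open>All codes agree on the value, and the existential over \<open>s\<close> gives a
    \<Sigma>_1 graph, which is enough for \<open>recf\<close>.\<close>
  define f where "f n = (THE y. \<exists>s. C s \<and> bit (prd n y) s)" for n
  have "\<exists>!y. \<exists>s. C s \<and> bit (prd n y) s" for n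
    using ex[of n] unique' by blast
  then have "\<exists>s. C s \<and> bit (prd n (f n)) s" for n
    unfolding f_def by (rule theI')
  then have fI: "y = f n \<longleftrightarrow> (\<exists>s. C s \<and> bit (prd n y) s)" for n y
    using unique' by blast
  show thesis
  proof (rule that[of f])
    show "recf f" unfolding delta1_fun_def fI
      by (intro sigma1_ex delta1_sigma1 rec_intros' delta1_bit delta1_C)
    show "f 0 = a" using fI[of "f 0" 0] C0 by blast
    fix n
    obtain s where "C s" "bit (prd (n + 1) (f (n + 1))) s" using fI[of "f (n + 1)" "n + 1"] by blast
    then obtain x where "f (n + 1) = g n x" "bit (prd n x) s" using C1 by blast
    moreover from this have "x = f n" using fI[of x n] \<open>C s\<close> by blast
    ultimately show "f (n + 1) = g n (f n)" by simp
  qed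
qed

end

section \<open>The meaning of the formulas in the model\<close>

lemma eval_pair [simp]: "eval MM e (pair t u) = prd (eval MM e t) (eval MM e u)"
  by (simp add: pair_def prd_def)

lemma eval_nm_2 [simp]: "eval MM e (nm 2) = 2"
  by (simp add: numeral_2_eq_2)

lemma nth_env: "case_nat x e 0 = x" "case_nat x e 1 = e 0" "case_nat x e 2 = e 1" "case_nat x e 3 = e 2"
  by (simp_all add: numeral_3_eq_3 numeral_2_eq_2)

lemma sat_val [simp]: "sat MM e s (val F t u) \<longleftrightarrow> prd (eval MM e t) (eval MM e u) \<in> s F"
  by (simp add: val_def)

lemmas sat_simps = sat.simps eval.simps MM_simps sat_val eval_pair eval_nm_2 eval_lift nth_env
  simp_thms not_all not_imp Set.ball_simps(10)

lemma sat_ExI: "sat M (case_nat x e) s p \<Longrightarrow> sat M e s (Ex p)"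
  and sat_ExSI: "X \<in> sts M \<Longrightarrow> sat M e (case_nat X s) p \<Longrightarrow> sat M e s (ExS p)"
  by auto

lemma sat_maps [simp]: "sat MM e s (maps F in_N in_N) \<longleftrightarrow> functional (s F)"
  by (simp only: maps_def in_N_def functional_def sat_simps) blast

definition sum_set :: "mnat set \<Rightarrow> mnat \<Rightarrow> mnat \<Rightarrow> bool" where
  "sum_set F q n \<longleftrightarrow> (\<exists>S\<in>\<S>. functional S \<and> (\<forall>v. prd 0 v \<in> F \<longrightarrow> prd 0 v \<in> S) \<and>
     (\<forall>i a b. prd i a \<in> S \<and> prd (i + 1) b \<in> F \<longrightarrow> prd (i + 1) (a + b) \<in> S) \<and> prd q n \<in> S)"

lemma sat_sum_eq [simp]: "sat MM e s (sum_eq F q n) \<longleftrightarrow> sum_set (s F) (eval MM e q) (eval MM e n)"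
  by (simp only: sum_eq_def sum_set_def sat_simps sat_maps nat.case)

lemma sum_set_graph: "sum_set (graph f) q n \<longleftrightarrow>
  (\<exists>g. recf g \<and> g 0 = f 0 \<and> (\<forall>i. g (i + 1) = g i + f (i + 1)) \<and> g q = n)"
proof
  assume "sum_set (graph f) q n"
  then obtain S where S: "S \<in> \<S>" "functional S" and *: "(\<forall>v. prd 0 v \<in> graph f \<longrightarrow> prd 0 v \<in> S) \<and>
     (\<forall>i a b. prd i a \<in> S \<and> prd (i + 1) b \<in> graph f \<longrightarrow> prd (i + 1) (a + b) \<in> S) \<and> prd q n \<in> S"
    unfolding sum_set_def by blast
  from S obtain g where "recf g" "S = graph g" by (auto elim: functionalE)
  then show "\<exists>g. recf g \<and> g 0 = f 0 \<and> (\<forall>i. g (i + 1) = g i + f (i + 1)) \<and> g q = n"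
    using * by (intro exI[of _ g]) auto
next
  assume "\<exists>g. recf g \<and> g 0 = f 0 \<and> (\<forall>i. g (i + 1) = g i + f (i + 1)) \<and> g q = n"
  then show "sum_set (graph f) q n"
    unfolding sum_set_def
  proof (elim exE conjE)
    fix g assume "recf g" "g 0 = f 0" "\<forall>i. g (i + 1) = g i + f (i + 1)" "g q = n"
    then show "\<exists>S\<in>\<S>. functional S \<and> (\<forall>v. prd 0 v \<in> graph f \<longrightarrow> prd 0 v \<in> S) \<and>
     (\<forall>i a b. prd i a \<in> S \<and> prd (i + 1) b \<in> graph f \<longrightarrow> prd (i + 1) (a + b) \<in> S) \<and> prd q n \<in> S"
      by (intro bexI[of _ "graph g"] graph_second_order) auto
  qed
qed

lemma sat_exp2: "sat MM e s (exp2 E) \<longleftrightarrow> functional (s E) \<and> prd 0 1 \<in> s E \<and>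
    (\<forall>x y. prd x y \<in> s E \<longrightarrow> prd (x + 1) (2 * y) \<in> s E)"
  by (simp add: exp2_def)

lemma sat_exp2_graph: "recf E \<Longrightarrow> s k = graph E \<Longrightarrow> sat MM e s (exp2 k) \<longleftrightarrow> exponential E"
  by (auto simp: sat_exp2 exponential_def)

text \<open>\<open>E\<close> stays existential as in the formula \<open>expansion\<close>: each
  expansion brings its own exponential function, and \<open>exponential_unique\<close> later
  identifies them.\<close>

definition expansion_fun :: "mnat \<Rightarrow> mnat \<Rightarrow> mnat \<Rightarrow> bool" where
  "expansion_fun n l m \<longleftrightarrow> (\<exists>E t g q. exponential E \<and> recf t \<and> recf g \<and> (\<forall>i<q. t i < t (i + 1)) \<and>
     g 0 = E (t 0) \<and> (\<forall>i. g (i + 1) = g i + E (t (i + 1))) \<and> g q = n \<and> l = t 0 \<and> m = t q)"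

text \<open>Expansions occur in the apartness that AHT asserts, so they are unpacked but never
  constructed.\<close>

lemma sat_expansion:
  assumes "sat MM e s (expansion n l m)"
  shows "expansion_fun (eval MM e n) (eval MM e l) (eval MM e m)"
proof -
  from assms obtain T E C q where S: "T \<in> \<S>" "E \<in> \<S>" "C \<in> \<S>" and
    *: "functional T" "\<forall>i a b. i < q \<and> prd i a \<in> T \<and> prd (i + 1) b \<in> T \<longrightarrow> a < b"
    "sat MM (case_nat q e) (case_nat C (case_nat E (case_nat T s))) (exp2 1)"
    "functional C" "\<forall>i a b. prd i a \<in> T \<and> prd a b \<in> E \<longrightarrow> prd i b \<in> C"
    "sum_set C q (eval MM e n)" "prd 0 (eval MM e l) \<in> T" "prd q (eval MM e m) \<in> T"
    unfolding expansion_def by (auto simp: imp_conjL)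
  from S * obtain t where t: "recf t" "T = graph t" by (auto elim: functionalE)
  from *(3) have "functional E" by (simp add: sat_exp2)
  then obtain E' where E: "recf E'" "E = graph E'" using S by (auto elim: functionalE)
  from S * obtain c where c: "recf c" "C = graph c" by (auto elim: functionalE)
  \<comment> \<open>The formula demands one inclusion between the composition and \<open>C\<close>;
    both being total functions, it is an equality.\<close>
  have c': "c = (\<lambda>i. E' (t i))" using *(5) unfolding c t E by auto
  from *(6)[unfolded c sum_set_graph] obtain g where "recf g" "g 0 = c 0"
    "\<forall>i. g (i + 1) = g i + c (i + 1)" "g q = eval MM e n" by blast
  moreover have "exponential E'" using *(3) E by (simp add: sat_exp2_graph)
  ultimately show ?thesis unfolding expansion_fun_def using *(2,7,8) t(1) unfolding t c'
    by (intro exI[of _ E'] exI[of _ t] exI[of _ g] exI[of _ q]) simp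
qed

lemma sat_apart:
  assumes "sat MM e s (apart X)" "x \<in> s X" "y \<in> s X" "x < y"
  shows "\<exists>l m l' m'. expansion_fun x l m \<and> expansion_fun y l' m' \<and> m < l'"
proof -
  from assms have "sat MM (case_nat y (case_nat x e)) s
      (Ex (Ex (Con (mu_eq (\<sharp>3) (\<sharp>1)) (Con (lambda_eq (\<sharp>2) (\<sharp>0)) (\<sharp>1 \<^bold>< \<sharp>0)))))"
    unfolding apart_def by simp
  then have "\<exists>m l' l m'. m < l' \<and>
    sat MM (case_nat l (case_nat l' (case_nat m (case_nat y (case_nat x e))))) s (expansion (lift \<sharp>3) \<sharp>0 (lift \<sharp>1)) \<and>
    sat MM (case_nat m' (case_nat l' (case_nat m (case_nat y (case_nat x e))))) s (expansion (lift \<sharp>2) (lift \<sharp>0) \<sharp>0)"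
    by (simp only: sat_simps mu_eq_def lambda_eq_def) blast
  then obtain m l' l m' where less: "m < l'" and
    1: "sat MM (case_nat l (case_nat l' (case_nat m (case_nat y (case_nat x e))))) s (expansion (lift \<sharp>3) \<sharp>0 (lift \<sharp>1))" and
    2: "sat MM (case_nat m' (case_nat l' (case_nat m (case_nat y (case_nat x e))))) s (expansion (lift \<sharp>2) (lift \<sharp>0) \<sharp>0)"
    by blast
  have "expansion_fun x l m" using sat_expansion[OF 1] by (simp add: numeral_3_eq_3)
  moreover have "expansion_fun y l' m'" using sat_expansion[OF 2] by simp
  ultimately show ?thesis using less by blast
qed

definition in_AS_fun :: "(mnat \<Rightarrow> mnat) \<Rightarrow> mnat \<Rightarrow> bool" where
  "in_AS_fun h x \<longleftrightarrow> (\<exists>i d g. recf g \<and> g 0 = h i \<and> (\<forall>k. g (k + 1) = g k + h (i + (k + 1))) \<and> g d = x)"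

text \<open>Membership in AS(H) is a premise of homogeneity in AHT, so witnesses have to be produced
  inside the model: the enumeration, the shifted sequence and the partial sums.\<close>

lemma sat_in_AS:
  assumes h: "recf h" "\<And>n. h n < h (n + 1)" "s H = range h" and "in_AS_fun h (eval MM e x)"
  shows "sat MM e s (in_AS H x)"
proof -
  from assms(4) obtain i d g where g: "recf g" "g 0 = h i" "\<forall>k. g (k + 1) = g k + h (i + (k + 1))" "g d = eval MM e x"
    unfolding in_AS_fun_def by blast
  let ?f = "\<lambda>k. h (i + k)"
  have f: "recf ?f" by (intro delta1_fun_comp1[OF h(1)] rec_intros)
  have "sum_set (graph ?f) d (eval MM e x)" unfolding sum_set_graph using g by (intro exI[of _ g]) simp
  moreover have "\<forall>k v. prd (i + k) v \<in> graph h \<longrightarrow> prd k v \<in> graph ?f" by simp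
  ultimately have "sat MM (case_nat d (case_nat i e)) (case_nat (graph ?f) (case_nat (graph h) s))
     (Con (enumerates 1 (Suc (Suc H))) (Con (maps 0 in_N in_N)
     (Con (All (All (Imp (val 1 (\<sharp>3 \<^bold>+ \<sharp>1) (\<sharp>0)) (val 0 (\<sharp>1) (\<sharp>0))))) (sum_eq 0 (\<sharp>0) (lift (lift x))))))"
    using h(2,3) by (simp only: enumerates_def sat_simps sat_maps sat_sum_eq functional_graph prd_graph nat.case) auto
  then have "sat MM e (case_nat (graph ?f) (case_nat (graph h) s)) (Ex (Ex
     (Con (enumerates 1 (Suc (Suc H))) (Con (maps 0 in_N in_N)
     (Con (All (All (Imp (val 1 (\<sharp>3 \<^bold>+ \<sharp>1) (\<sharp>0)) (val 0 (\<sharp>1) (\<sharp>0))))) (sum_eq 0 (\<sharp>0) (lift (lift x))))))))"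
    by (intro sat_ExI)
  then show ?thesis unfolding in_AS_def
    using graph_second_order[OF h(1)] graph_second_order[OF f]
    by (intro sat_ExSI[of "graph h" MM e s] sat_ExSI[of "graph ?f" MM e "case_nat (graph h) s"]) (simp_all only: MM_simps)
qed

definition infinite_in :: "mnat set \<Rightarrow> bool" where
  "infinite_in H \<longleftrightarrow> (\<forall>x. \<exists>y\<in>H. x < y)"

lemma sat_infinite [simp]: "sat MM e s (infinite_set X) \<longleftrightarrow> infinite_in (s X)"
  by (auto simp: infinite_set_def infinite_in_def)

text \<open>The last clause is conditional on a recursive enumeration of \<open>H\<close>, whose
  existence is settled separately by \<open>ex_enumeration\<close>.\<close>

lemma sat_AHT:
  assumes AHT: "sat MM e s (AHT 2)" and c: "recf c" "\<And>x. c x < 2"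
  obtains H j where "H \<in> \<S>" "infinite_in H"
    "\<forall>x\<in>H. \<forall>y\<in>H. x < y \<longrightarrow> (\<exists>l m l' m'. expansion_fun x l m \<and> expansion_fun y l' m' \<and> m < l')"
    "\<forall>h x. recf h \<and> (\<forall>n. h n < h (n + 1)) \<and> H = range h \<and> in_AS_fun h x \<longrightarrow> c x = j"
proof -
  have "sat MM e (case_nat (graph c) s) (maps 0 in_N (in_below 2))"
    using c by (auto simp: maps_def in_N_def in_below_def) (auto simp: graph_def)
  with AHT graph_second_order[OF c(1)] have "sat MM e (case_nat (graph c) s)
    (ExS (Con (infinite_set 0) (Con (positive_set 0) (Con (apart 0) (Ex (All (Imp (in_AS 0 (\<sharp>0)) (val 1 (\<sharp>0) (\<sharp>1)))))))))"
    unfolding AHT_def sat.simps(5,7) MM_simps by blast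
  then obtain H j where H: "H \<in> \<S>" "infinite_in H"
    "sat MM e (case_nat H (case_nat (graph c) s)) (apart 0)"
    and j: "\<And>x. sat MM (case_nat x (case_nat j e)) (case_nat H (case_nat (graph c) s)) (in_AS 0 (\<sharp>0)) \<Longrightarrow> j = c x"
    by (simp only: sat_simps sat_infinite prd_graph) blast
  show thesis
  proof (rule that[OF H(1,2)])
    show "\<forall>x\<in>H. \<forall>y\<in>H. x < y \<longrightarrow> (\<exists>l m l' m'. expansion_fun x l m \<and> expansion_fun y l' m' \<and> m < l')"
      using sat_apart[OF H(3)] by simp
    show "\<forall>h x. recf h \<and> (\<forall>n. h n < h (n + 1)) \<and> H = range h \<and> in_AS_fun h x \<longrightarrow> c x = j"
    proof (intro allI impI, elim conjE)
      fix h x assume "recf h" "\<forall>n. h n < h (n + 1)" "H = range h" "in_AS_fun h x"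
      then show "c x = j" using j[OF sat_in_AS[of h], of x] by simp
    qed
  qed
qed

lemma sat_IPT2:
  assumes "\<And>f. f \<in> \<S> \<Longrightarrow> (\<And>x y. x < y \<Longrightarrow> prd (prd x y) 0 \<in> f \<longleftrightarrow> prd (prd x y) 1 \<notin> f) \<Longrightarrow>
    \<exists>H1\<in>\<S>. \<exists>H2\<in>\<S>. infinite_in H1 \<and> infinite_in H2 \<and>
      (\<exists>j<2. \<forall>x\<in>H1. \<forall>y\<in>H2. x < y \<longrightarrow> prd (prd x y) j \<in> f)"
  shows "sat MM e s (IPT2 2)"
proof -
  have key: "prd (prd x y) 0 \<in> f \<longleftrightarrow> prd (prd x y) 1 \<notin> f"
    if f: "sat MM e (case_nat f s) (maps 0 in_pairs (in_below 2))" and "x < y" for f x y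
  proof -
    have 1: "\<exists>c. prd (prd x y) c \<in> f \<and> (\<forall>d. prd (prd x y) d \<in> f \<longrightarrow> d = c)"
      using f \<open>x < y\<close> by (simp only: maps_def in_pairs_def sat_simps) blast
    have 2: "d < 2" if "prd (prd x y) d \<in> f" for d
      using f that by (simp only: maps_def in_below_def sat_simps) (metis prd_inject)
    have "d = 0 \<or> d = 1" if "d < 2" for d :: mnat
      using that by (metis add.left_neutral add_one_le_iff le_zero_eq less_add_one_iff not_le one_add_one order_antisym)
    with 1 2 show ?thesis by (metis zero_neq_one)
  qed
  have "\<exists>H1\<in>\<S>. \<exists>H2\<in>\<S>. infinite_in H1 \<and> infinite_in H2 \<and>
      (\<exists>j<2. \<forall>x\<in>H1. \<forall>y\<in>H2. x < y \<longrightarrow> prd (prd x y) j \<in> f)"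
    if "f \<in> \<S>" "sat MM e (case_nat f s) (maps 0 in_pairs (in_below 2))" for f
    by (rule assms[OF that(1) key[OF that(2)]])
  note main = this[unfolded in_below_def]
  show ?thesis unfolding IPT2_def in_below_def
    by (simp only: sat_simps sat_infinite, intro ballI impI, drule (1) main, blast)
qed

section \<open>The colouring\<close>

lemma exponential_unique:
  assumes "exponential E" "exponential E'"
  shows "E = E'"
proof
  interpret E: exponential E by fact
  interpret E': exponential E' by fact
  show "E x = E' x" for x
    by (rule delta1_induct[of "\<lambda>x. E x = E' x"], (intro rec_intros E.delta1_fun_E E'.delta1_fun_E)[1])
       (simp_all add: E.E_Suc E'.E_Suc)
qed

text \<open>If nothing is least, \<Delta>_1 induction pushes the absence of elements through every
  initial segment.\<close>

lemma least_element:
  assumes "delta1 (\<lambda>e. P (e 0))" "P x"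
  shows "\<exists>m. P m \<and> (\<forall>k<m. \<not> P k)"
proof (rule ccontr)
  assume no: "\<nexists>m. P m \<and> (\<forall>k<m. \<not> P k)"
  have "\<forall>k<x + 1. \<not> P k"
  proof (rule delta1_induct[of "\<lambda>x. \<forall>k<x. \<not> P k"])
    show "delta1 (\<lambda>e. \<forall>k<e 0. \<not> P k)" by (intro rec_intros delta1_subst1[OF assms(1)])
    show "\<forall>k<n + 1. \<not> P k" if "\<forall>k<n. \<not> P k" for n
    proof -
      have "\<not> P n" using no that by blast
      then show ?thesis using that by (simp add: pa8)
    qed
  qed simp
  then show False using assms(2) by (simp add: less_add_one_iff)
qed

text \<open>Iterates the map from \<open>y\<close> to the next element of \<open>H\<close> above it;
  the map exceeds its argument, so inflationary recursion applies.\<close>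

lemma ex_enumeration:
  assumes "exponential E" and H: "H \<in> \<S>" "infinite_in H"
  obtains h where "recf h" "\<And>n. h n < h (n + 1)" "H = range h"
proof -
  interpret exponential E by fact
  have "delta1 (\<lambda>e. e 0 \<in> H \<and> y < e 0)" for y by (intro rec_intros H)
  moreover have "\<exists>z. z \<in> H \<and> y < z" for y using H(2) unfolding infinite_in_def by blast
  ultimately have "\<exists>z. (z \<in> H \<and> y < z) \<and> (\<forall>k<z. \<not> (k \<in> H \<and> y < k))" for y
    using least_element[of "\<lambda>z. z \<in> H \<and> y < z"] by blast
  then obtain N where N: "\<And>y. N y \<in> H" "\<And>y. y < N y" "\<And>y k. k \<in> H \<Longrightarrow> y < k \<Longrightarrow> N y \<le> k"
    by (metis not_le)
  \<comment> \<open>A characterisation by bounded quantifiers shows the graph of \<open>N\<close> to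
    be \<Delta>_1, although \<open>N\<close> was merely chosen.\<close>
  have N_eq: "z = N y \<longleftrightarrow> z \<in> H \<and> y < z \<and> (\<forall>k<z. k \<in> H \<longrightarrow> k \<le> y)" for z y
    using N by (metis leD linorder_cases order.strict_trans2 not_le)
  have "delta1_fun (\<lambda>e. N (e 1))"
    by (rule delta1_fun_graph, unfold N_eq) (intro rec_intros H)
  moreover have "\<exists>m. m \<in> H \<and> (\<forall>k<m. k \<notin> H)"
    by (rule least_element[of "\<lambda>z. z \<in> H"], intro rec_intros H) (rule N(1))
  then obtain a where a: "a \<in> H" "\<And>k. k \<in> H \<Longrightarrow> a \<le> k" by (metis not_le)
  ultimately obtain h where h: "recf h" "h 0 = a" "\<And>n. h (n + 1) = N (h n)"
    by (rule_tac inflationary_recursion[of "\<lambda>n. N" a]) (auto intro: order_less_imp_le N(2))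
  note delta1_fun_h = delta1_fun_comp1[OF h(1)]
  \<comment> \<open>To be combined with the next claim at \<open>n = x\<close>: an element
    \<open>x\<close> of \<open>H\<close> satisfies \<open>x \<le> h x\<close> and is therefore a
    value of \<open>h\<close>.\<close>
  have "n \<le> h n" for n
    by (rule delta1_induct[of "\<lambda>n. n \<le> h n"], (intro rec_intros delta1_fun_h)[1])
      (simp_all add: h add_one_le_iff N(2) order_le_less_trans)
  moreover have "\<forall>x\<le>h n. x \<in> H \<longrightarrow> (\<exists>i\<le>n. h i = x)" for n
  proof (rule delta1_induct[of "\<lambda>n. \<forall>x\<le>h n. x \<in> H \<longrightarrow> (\<exists>i\<le>n. h i = x)"])
    show "delta1 (\<lambda>e. \<forall>x\<le>h (e 0). x \<in> H \<longrightarrow> (\<exists>i\<le>e 0. h i = x))"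
      by (intro rec_intros delta1_fun_h H)
    show "\<forall>x\<le>h 0. x \<in> H \<longrightarrow> (\<exists>i\<le>0. h i = x)"
      using h(2) a(2) by (metis order_antisym order_refl)
    fix n assume IH: "\<forall>x\<le>h n. x \<in> H \<longrightarrow> (\<exists>i\<le>n. h i = x)"
    show "\<forall>x\<le>h (n + 1). x \<in> H \<longrightarrow> (\<exists>i\<le>n + 1. h i = x)"
    proof (intro allI impI)
      fix x assume x: "x \<le> h (n + 1)" "x \<in> H"
      show "\<exists>i\<le>n + 1. h i = x"
      proof (cases "x \<le> h n")
        case True
        then obtain i where "i \<le> n" "h i = x" using IH x by blast
        then show ?thesis by (intro exI[of _ i]) (simp add: add_increasing2)
      next
        case False
        then have "h (n + 1) \<le> x" using N(3)[OF x(2), of "h n"] by (simp add: h(3))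
        then show ?thesis using x by (intro exI[of _ "n + 1"]) simp
      qed
    qed
  qed
  ultimately have "x \<in> H \<Longrightarrow> x \<in> range h" for x by blast
  moreover have "h n \<in> H" for n
    by (rule delta1_induct[of "\<lambda>n. h n \<in> H"], (intro rec_intros delta1_fun_h H)[1]) (simp_all add: h N a)
  ultimately have "H = range h" by blast
  moreover have "h n < h (n + 1)" for n by (simp add: h(3) N(2))
  ultimately show thesis using h(1) that by blast
qed

context exponential
begin

text \<open>\<open>low l n\<close> and \<open>high m n\<close> say \<open>\<lambda>(n) = l\<close> and \<open>\<mu>(n) = m\<close>, with bounded quantifiers over \<open>E\<close>.\<close>

definition low :: "mnat \<Rightarrow> mnat \<Rightarrow> bool" where
  "low l n \<longleftrightarrow> (\<exists>a\<le>n. n = E l * (2 * a + 1))"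
definition high :: "mnat \<Rightarrow> mnat \<Rightarrow> bool" where
  "high m n \<longleftrightarrow> E m \<le> n \<and> n < 2 * E m"

lemma delta1_low: "delta1_fun t \<Longrightarrow> delta1_fun u \<Longrightarrow> delta1 (\<lambda>e. low (t e) (u e))"
  by (rule delta1_subst2[of low], unfold low_def, (intro rec_intros delta1_fun_E)[1])

lemma delta1_high: "delta1_fun t \<Longrightarrow> delta1_fun u \<Longrightarrow> delta1 (\<lambda>e. high (t e) (u e))"
  by (rule delta1_subst2[of high], unfold high_def, (intro rec_intros delta1_fun_E)[1])

lemma lowI:
  assumes "n = E l * (2 * a + 1)"
  shows "low l n"
proof -
  have "a \<le> 2 * a + 1" by (simp add: mult_2 add.assoc)
  also have "\<dots> \<le> E l * (2 * a + 1)" by (rule pos_mult_le) simp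
  finally show ?thesis unfolding low_def using assms by blast
qed

lemma low_less:
  assumes "low l n"
  shows "l < n"
proof -
  from assms obtain a where a: "n = E l * (2 * a + 1)" unfolding low_def by blast
  have "E l \<le> (2 * a + 1) * E l" by (rule pos_mult_le) (simp add: add_nonneg_pos)
  then show ?thesis using E_greater[of l] unfolding a by (simp add: mult.commute)
qed

lemma high_less: "high m n \<Longrightarrow> m < n"
  unfolding high_def using E_greater[of m] by (elim conjE) order

lemma odd_neq_even: "2 * a + 1 \<noteq> 2 * b" for a b :: mnat
proof
  assume eq: "2 * a + 1 = 2 * b"
  have "a < b"
  proof (rule ccontr)
    assume "\<not> a < b"
    then have "2 * b \<le> 2 * a" by (intro mult_left_mono) auto
    also have "\<dots> < 2 * a + 1" by (simp add: less_add_one_iff)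
    finally show False using eq by simp
  qed
  then have "2 * (a + 1) \<le> 2 * b" by (intro mult_left_mono) (auto simp: add_one_le_iff)
  moreover have "2 * (a + 1) = 2 * b + 1" by (simp add: eq[symmetric] distrib_left add.assoc)
  ultimately have "2 * b + 1 \<le> 2 * b" by simp
  then show False by (simp add: add_one_le_iff)
qed

text \<open>Cancelling the smaller power leaves an odd number on one side and an even number on the
  other.\<close>

lemma low_not_less: "low l n \<Longrightarrow> low k n \<Longrightarrow> \<not> l < k"
proof
  assume "low l n" "low k n" "l < k"
  then obtain a c where ac: "n = E l * (2 * a + 1)" "n = E k * (2 * c + 1)" unfolding low_def by blast
  obtain b where b: "E k = b * (2 * E l)" using \<open>l < k\<close> by (rule E_less_dvd)
  from ac b have "E l * (2 * a + 1) = E l * (2 * (b * (2 * c + 1)))" by (simp add: ac_simps)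
  then have "2 * a + 1 = 2 * (b * (2 * c + 1))"
    using mult_strict_left_mono[OF _ E_pos[of l]] by (metis linorder_neqE less_irrefl)
  then show False using odd_neq_even by blast
qed

lemma low_unique: "low l n \<Longrightarrow> low k n \<Longrightarrow> l = k"
  using low_not_less by (metis linorder_neqE)

lemma high_mono: "high m n \<Longrightarrow> high k n' \<Longrightarrow> n \<le> n' \<Longrightarrow> m \<le> k"
  unfolding high_def using E_less[of k m] by (meson leD le_less_linear order_le_less_trans order_trans)

lemma high_unique: "high m n \<Longrightarrow> high k n \<Longrightarrow> m = k"
  by (simp add: order_antisym high_mono)

lemma low_le_high:
  assumes "low l n" "high m n"
  shows "l \<le> m"
proof (rule ccontr)
  assume "\<not> l \<le> m"
  then have "2 * E m \<le> E l" by (simp add: E_less)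
  also obtain a where a: "n = E l * (2 * a + 1)" using assms(1) unfolding low_def by blast
  have "E l \<le> (2 * a + 1) * E l" by (rule pos_mult_le) (simp add: add_nonneg_pos)
  then have "E l \<le> n" by (simp add: a mult.commute)
  finally have "2 * E m \<le> n" .
  moreover have "n < 2 * E m" using assms(2) by (simp add: high_def)
  ultimately show False by order
qed

text \<open>The summand \<open>h\<close> is a multiple of \<open>2 * E l\<close>, so it changes the
  odd cofactor of \<open>E l\<close> by an even amount.\<close>

lemma low_add:
  assumes "low l s" "low k h" "l < k"
  shows "low l (s + h)"
proof -
  from assms obtain a c where ac: "s = E l * (2 * a + 1)" "h = E k * (2 * c + 1)" unfolding low_def by blast
  obtain b where b: "E k = b * (2 * E l)" using assms(3) by (rule E_less_dvd)
  from ac b have "s + h = E l * (2 * (a + b * (2 * c + 1)) + 1)" by (simp add: algebra_simps)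
  then show ?thesis by (rule lowI)
qed

text \<open>There is no carry: \<open>h\<close> and \<open>2 * E m\<close> are both multiples of
  \<open>E k\<close>, so the strict inequality between them leaves a gap of at least
  \<open>E k\<close>, more than \<open>s\<close>.\<close>

lemma high_add:
  assumes "low k h" "high m h" "s < E k"
  shows "high m (s + h)"
proof -
  obtain a where h: "h = E k * (2 * a + 1)" using assms(1) unfolding low_def by blast
  have "k < m + 1" using low_le_high[OF assms(1,2)] by (simp add: less_add_one_iff)
  then obtain b where b: "2 * E m = b * (2 * E k)" by (metis E_less_dvd E_Suc)
  have "(2 * a + 1) * E k < (2 * b) * E k" using assms(2) b unfolding high_def h by (simp add: ac_simps)
  then have "2 * a + 1 < 2 * b" by (rule mult_right_less_imp_less) simp
  then have "2 * a + 1 + 1 \<le> 2 * b" by (simp add: add_one_le_iff)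
  then have "(2 * a + 1 + 1) * E k \<le> (2 * b) * E k" by (rule mult_right_mono) simp
  then have "E k + h \<le> 2 * E m" unfolding h b by (simp add: algebra_simps)
  moreover have "s + h < E k + h" using assms(3) by simp
  ultimately have "s + h < 2 * E m" by order
  then show ?thesis using assms(2) unfolding high_def by (simp add: add_increasing)
qed

text \<open>Along the partial sums each new power exceeds the sum so far, so the least exponent
  persists and the latest one is the greatest.\<close>

lemma expansion_low_high:
  assumes "expansion_fun n l m"
  shows "low l n \<and> high m n"
proof -
  from assms obtain E' t g q where E': "exponential E'" and t: "recf t" "\<And>i. i < q \<Longrightarrow> t i < t (i + 1)"
    and g: "recf g" "g 0 = E' (t 0)" "\<And>i. g (i + 1) = g i + E' (t (i + 1))" "g q = n" "l = t 0" "m = t q"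
    unfolding expansion_fun_def by blast
  have "E' = E" using E' exponential_axioms by (rule exponential_unique)
  note g = g[unfolded this]
  have single: "low k (E k)" "high k (E k)" for k
    using lowI[of "E k" k 0] by (simp_all add: high_def mult_2)
  \<comment> \<open>The guard is due to \<open>t\<close> being known to increase only up to
    \<open>q\<close>.\<close>
  have "i \<le> q \<longrightarrow> low l (g i) \<and> high (t i) (g i) \<and> l \<le> t i" for i
  proof (rule delta1_induct[of "\<lambda>i. i \<le> q \<longrightarrow> low l (g i) \<and> high (t i) (g i) \<and> l \<le> t i"])
    show "delta1 (\<lambda>e. e 0 \<le> q \<longrightarrow> low l (g (e 0)) \<and> high (t (e 0)) (g (e 0)) \<and> l \<le> t (e 0))"
      by (intro rec_intros delta1_low delta1_high delta1_fun_comp1[OF g(1)] delta1_fun_comp1[OF t(1)])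
    show "0 \<le> q \<longrightarrow> low l (g 0) \<and> high (t 0) (g 0) \<and> l \<le> t 0"
      using single by (simp add: g)
    fix i assume IH: "i \<le> q \<longrightarrow> low l (g i) \<and> high (t i) (g i) \<and> l \<le> t i"
    show "i + 1 \<le> q \<longrightarrow> low l (g (i + 1)) \<and> high (t (i + 1)) (g (i + 1)) \<and> l \<le> t (i + 1)"
    proof
      assume "i + 1 \<le> q"
      then have i: "i < q" by (simp add: add_one_le_iff)
      note less = t(2)[OF i]
      have IH': "low l (g i)" "high (t i) (g i)" "l \<le> t i" using IH i by auto
      have "g i < E (t (i + 1))" using IH'(2) E_less[OF less] unfolding high_def by (elim conjE) order
      then show "low l (g (i + 1)) \<and> high (t (i + 1)) (g (i + 1)) \<and> l \<le> t (i + 1)"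
        using low_add[OF IH'(1) single(1), of "t (i + 1)"] high_add[OF single] less IH'(3) unfolding g(3)
        by auto
    qed
  qed
  from this[of q] show ?thesis using g by simp
qed

end

section \<open>The two solution sets inside the model\<close>

lemma proposition2_in_MM:
  assumes AHT: "sat MM e s (AHT 2)"
  shows "sat MM e s (IPT2 2)"
proof (rule sat_IPT2)
  fix f assume f: "f \<in> \<S>" and f01: "\<And>x y. x < y \<Longrightarrow> prd (prd x y) 0 \<in> f \<longleftrightarrow> prd (prd x y) 1 \<notin> f"
  have "\<exists>E. exponential E"
  proof -
    have "recf (\<lambda>_. 0)" "(0 :: mnat) < 2" by (rule delta1_fun_const) simp
    then obtain H where H: "infinite_in H" and "\<forall>x\<in>H. \<forall>y\<in>H. x < y \<longrightarrow>
        (\<exists>l m l' m'. expansion_fun x l m \<and> expansion_fun y l' m' \<and> m < l')"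
      by (rule sat_AHT[OF AHT])
    moreover obtain x y where "x \<in> H" "y \<in> H" "x < y" using H unfolding infinite_in_def by metis
    ultimately show ?thesis unfolding expansion_fun_def by blast
  qed
  then obtain E where "exponential E" by blast
  then interpret exponential E .
  \<comment> \<open>Both exponents are below \<open>n\<close>, which bounds the quantifiers. On
    proper pairs the default 0 is colour 0 of \<open>f\<close>; where the exponents coincide, the
    value is irrelevant.\<close>
  define c :: "mnat \<Rightarrow> mnat" where
    "c n = (if \<exists>l\<le>n. \<exists>m\<le>n. low l n \<and> high m n \<and> prd (prd l m) 1 \<in> f then 1 else 0)" for n
  have rec_c: "recf c" unfolding c_def by (intro rec_intros' delta1_low delta1_high f)
  have c_less: "c n < 2" for n by (simp add: c_def)
  obtain H j where H: "H \<in> \<S>" "infinite_in H"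
    and apart: "\<forall>x\<in>H. \<forall>y\<in>H. x < y \<longrightarrow>
      (\<exists>l m l' m'. expansion_fun x l m \<and> expansion_fun y l' m' \<and> m < l')"
    and "\<forall>h x. recf h \<and> (\<forall>n. h n < h (n + 1)) \<and> H = range h \<and> in_AS_fun h x \<longrightarrow> c x = j"
    by (rule sat_AHT[OF AHT rec_c c_less])
  obtain h where h: "recf h" "\<And>n. h n < h (n + 1)" "H = range h"
    using ex_enumeration[OF \<open>exponential E\<close> H] by blast
  then have mono: "c x = j" if "in_AS_fun h x" for x
    using that \<open>\<forall>h x. _ \<longrightarrow> c x = j\<close> by blast
  note delta1_fun_h = delta1_fun_comp1[OF h(1)]
  have less_h: "i < k \<Longrightarrow> h i < h k" for i k
  proof -
    have "h i < h (i + d + 1)" for d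
      by (rule delta1_induct[of "\<lambda>d. h i < h (i + d + 1)"], (intro rec_intros delta1_fun_h)[1])
         (use h(2) in \<open>auto simp: add.assoc[symmetric] intro: order_less_trans\<close>)
    then show "i < k \<Longrightarrow> h i < h k" by (auto simp: less_iff_ex add.assoc)
  qed
  \<comment> \<open>Apartness provides expansions for pairs of elements, so \<open>h i\<close> is
    paired with its successor in \<open>H\<close>.\<close>
  have ends: "\<exists>l m. low l (h i) \<and> high m (h i)" for i
    using apart[unfolded h(3)] h(2) expansion_low_high by (metis rangeI)
  have apart_h: "m < l" if m: "high m (h i)" and l: "low l (h k)" and "i < k" for i k l m
  proof -
    obtain m' l' where "high m' (h i)" "low l' (h k)" "m' < l'"
      using apart[unfolded h(3)] less_h[OF \<open>i < k\<close>] expansion_low_high by (metis rangeI)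
    then show ?thesis using m l high_unique low_unique by blast
  qed
  have sums: "\<exists>g. recf g \<and> g 0 = h i \<and> (\<forall>k. g (k + 1) = g k + h (i + (k + 1)))" for i
  proof -
    have "delta1_fun (\<lambda>e. e 1 + h (i + (e 0 + 1)))" by (intro rec_intros delta1_fun_h)
    then obtain g where "recf g" "g 0 = h i" "\<And>k. g (k + 1) = g k + h (i + (k + 1))"
      by (rule inflationary_recursion[of "\<lambda>k y. y + h (i + (k + 1))" "h i"]) auto
    then show ?thesis by blast
  qed
  have colour: "prd (prd l m) j \<in> f" if l: "low l (h i)" and m: "high m (h (i + d))" and "l < m" for i d l m
  proof -
    obtain g where g: "recf g" "g 0 = h i" "\<And>k. g (k + 1) = g k + h (i + (k + 1))"
      using sums by blast
    \<comment> \<open>The invariant records that a partial sum and its last summand share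
      \<open>\<mu>\<close>; the bound on \<open>m\<close> keeps it \<Delta>_1.\<close>
    have "low l (g k) \<and> (\<exists>m\<le>g k. high m (g k) \<and> high m (h (i + k)))" for k
    proof (rule delta1_induct[of "\<lambda>k. low l (g k) \<and> (\<exists>m\<le>g k. high m (g k) \<and> high m (h (i + k)))"])
      show "delta1 (\<lambda>e. low l (g (e 0)) \<and> (\<exists>m\<le>g (e 0). high m (g (e 0)) \<and> high m (h (i + e 0))))"
        by (intro rec_intros delta1_low delta1_high delta1_fun_h delta1_fun_comp1[OF g(1)])
      show "low l (g 0) \<and> (\<exists>m\<le>g 0. high m (g 0) \<and> high m (h (i + 0)))"
        using ends[of i] l high_less by (auto simp: g(2) intro: order_less_imp_le)
      fix k assume "low l (g k) \<and> (\<exists>m\<le>g k. high m (g k) \<and> high m (h (i + k)))"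
      then obtain m where low: "low l (g k)" and m: "high m (g k)" "high m (h (i + k))" by blast
      let ?x = "h (i + (k + 1))"
      obtain l' m' where lm: "low l' ?x" "high m' ?x" using ends by blast
      have "m < l'" using apart_h[OF m(2) lm(1)] by (simp add: less_add_one_iff)
      from E_less[OF this] have "g k < E l'" using m(1) unfolding high_def by (elim conjE) order
      moreover have "l < l'" using low_le_high[OF low m(1)] \<open>m < l'\<close> by order
      ultimately have "low l (g (k + 1))" "high m' (g (k + 1))"
        unfolding g(3) using low_add[OF low lm(1)] high_add[OF lm] by auto
      then show "low l (g (k + 1)) \<and> (\<exists>m\<le>g (k + 1). high m (g (k + 1)) \<and> high m (h (i + (k + 1))))"
        using lm(2) high_less order_less_imp_le by blast
    qed
    from this[of d] obtain m' where low: "low l (g d)" and "high m' (g d)" "high m' (h (i + d))" by blast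
    then have high: "high m (g d)" using m high_unique by blast
    have "in_AS_fun h (g d)" unfolding in_AS_fun_def using g by blast
    then have "c (g d) = j" by (rule mono)
    \<comment> \<open>Uniqueness of the two exponents collapses the quantifiers in the definition of
      \<open>c\<close>.\<close>
    moreover have "(\<exists>l\<le>g d. \<exists>m\<le>g d. low l (g d) \<and> high m (g d) \<and> prd (prd l m) 1 \<in> f)
        \<longleftrightarrow> prd (prd l m) 1 \<in> f"
      using low high low_unique high_unique low_less high_less order_less_imp_le by blast
    ultimately show ?thesis using f01[OF \<open>l < m\<close>] by (auto simp: c_def split: if_splits)
  qed
  \<comment> \<open>Apartness raises \<open>\<lambda>\<close> by at least one from each element to
    the next, so the index never exceeds \<open>\<lambda>\<close>.\<close>
  have large: "\<exists>l\<le>h i. \<exists>m\<le>h i. low l (h i) \<and> high m (h i) \<and> i \<le> l" for i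
  proof (rule delta1_induct[of "\<lambda>i. \<exists>l\<le>h i. \<exists>m\<le>h i. low l (h i) \<and> high m (h i) \<and> i \<le> l"])
    show "delta1 (\<lambda>e. \<exists>l\<le>h (e 0). \<exists>m\<le>h (e 0). low l (h (e 0)) \<and> high m (h (e 0)) \<and> e 0 \<le> l)"
      by (intro rec_intros delta1_low delta1_high delta1_fun_h)
    show "\<exists>l\<le>h 0. \<exists>m\<le>h 0. low l (h 0) \<and> high m (h 0) \<and> 0 \<le> l"
      using ends[of 0] low_less high_less order_less_imp_le zero_le by metis
    fix i assume "\<exists>l\<le>h i. \<exists>m\<le>h i. low l (h i) \<and> high m (h i) \<and> i \<le> l"
    then obtain l m where lm: "low l (h i)" "high m (h i)" "i \<le> l" by blast
    obtain l' m' where lm': "low l' (h (i + 1))" "high m' (h (i + 1))" using ends by blast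
    have "m < l'" using apart_h[OF lm(2) lm'(1)] by (simp add: less_add_one_iff)
    then have "i + 1 \<le> l'" using low_le_high[OF lm(1,2)] lm(3) unfolding add_one_le_iff by order
    then show "\<exists>l\<le>h (i + 1). \<exists>m\<le>h (i + 1). low l (h (i + 1)) \<and> high m (h (i + 1)) \<and> i + 1 \<le> l"
      using lm' low_less high_less order_less_imp_le by blast
  qed
  \<comment> \<open>Bounding the index by the member makes both sets \<Delta>_1; by
    \<open>large\<close> the bound holds for the members that witness infinity.\<close>
  let ?H1 = "{l. \<exists>i\<le>l. low l (h i)}" and ?H2 = "{m. \<exists>i\<le>m. high m (h i)}"
  have "?H1 \<in> \<S>" by (intro delta1_comprehension rec_intros delta1_low delta1_fun_h)
  moreover have "?H2 \<in> \<S>" by (intro delta1_comprehension rec_intros delta1_high delta1_fun_h)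
  moreover have "infinite_in ?H1" "infinite_in ?H2" unfolding infinite_in_def
  proof (safe)
    fix x
    obtain l m where lm: "low l (h (x + 1))" "high m (h (x + 1))" "x + 1 \<le> l" using large by blast
    moreover have "l \<le> m" using lm low_le_high by blast
    ultimately have "x < l" "x < m" "x + 1 \<le> m" unfolding add_one_le_iff by order+
    then show "\<exists>y\<in>?H1. x < y" "\<exists>y\<in>?H2. x < y" using lm by blast+
  qed
  moreover have "\<forall>x\<in>?H1. \<forall>y\<in>?H2. x < y \<longrightarrow> prd (prd x y) j \<in> f"
  proof (intro ballI impI)
    fix x y assume "x \<in> ?H1" "y \<in> ?H2" and less: "x < y"
    then obtain i k where x: "low x (h i)" and y: "high y (h k)" by blast
    have "\<not> k < i" using apart_h[OF y x] less by (metis less_asym)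
    then have "i \<le> k" by simp
    then obtain d where "k = i + d" unfolding le_iff_ex by blast
    then show "prd (prd x y) j \<in> f" using colour[OF x _ less] y by blast
  qed
  moreover have "j < 2"
  proof -
    have "in_AS_fun h (h 0)" unfolding in_AS_fun_def using sums[of 0] by blast
    then have "c (h 0) = j" by (rule mono)
    then show ?thesis using c_less[of "h 0"] by simp
  qed
  ultimately show "\<exists>H1\<in>\<S>. \<exists>H2\<in>\<S>. infinite_in H1 \<and> infinite_in H2 \<and>
      (\<exists>j<2. \<forall>x\<in>H1. \<forall>y\<in>H2. x < y \<longrightarrow> prd (prd x y) j \<in> f)" by blast
qed

theorem proposition2:
  shows "RCA0 \<tturnstile> (AHT 2 \<^bold>\<longrightarrow> IPT2 2)"
  by (rule provable_if_MM) (auto simp: refutes_def intro: proposition2_in_MM)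

end
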